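(* Suppose $(\gamma,H)\in\mathcal P^{m,\alpha}(M)$. There exists a $C^{m-1,\alpha}$ function $\mu>0$ on $S^2$ (depending on $(\gamma,H)$) such that for any $C^{m-1,\alpha}$ function $H_0$ on $S^2$ satisfying $$H_0\ge H-\mu$$ pointwise, one has $(\gamma,H_0)\in\mathcal P^{m,\alpha}(M)$.
   Context: $M$ is a smooth 3-manifold with boundary diffeomorphic to $\mathbb R^3\setminus B$, $B$ an open ball, so $\partial M\cong S^2$. Fix $\tfrac12<\delta<1$, $m\ge 3$, $\alpha\in(0,1)$. $C^{m,\alpha}_\delta(M)$ is the weighted Hölder space of functions on $M$ decaying to $0$ at rate $r^{-\delta}$, with $k$-th derivatives decaying at rate $r^{-\delta-k}$, $k\le m$, and with appropriately weighted Hölder $\alpha$-seminorms of the $m$-th derivatives bounded. A $C^{m,\alpha}$ Riemannian metric $g$ on $M$ (up to and on $\partial M$) is asymptotically flat (AF) if $g_{ij}-\delta_{ij}\in C^{m,\alpha}_\delta(M)$. As a space of metrics, $\mathcal P^{m,\alpha}(M)$ is the space of AF metrics on $M$ with non-negative scalar curvature. Boundary data are pairs $(\gamma,H)$ with $\gamma$ a $C^{m,\alpha}$ Riemannian metric on $S^2$ and $H$ a $C^{m-1,\alpha}$ function on $S^2$. A metric $g\in\mathcal P^{m,\alpha}(M)$ is an admissible extension of $(\gamma,H)$ if $g$ induces the metric $\gamma$ on $\partial M$ and $H_{\partial M}\le H$ pointwise, where $H_{\partial M}$ is the mean curvature of $\partial M$ with respect to the unit normal pointing into $M$. One writes $(\gamma,H)\in\mathcal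 P^{m,\alpha}(M)$ if the boundary data $(\gamma,H)$ admit an admissible extension $g\in\mathcal P^{m,\alpha}(M)$. *)

theory Defs
  imports "HOL-Analysis.Analysis"
begin

section \<open>Partial derivatives and Hoelder regularity\<close>

text \<open>
  All derivatives are taken within the domain \<open>S\<close>. They are used for \<open>S = UNIV\<close> and for the
  exterior of the open unit ball, where derivatives within \<open>S\<close> are unique also at boundary points
  and, at these points, express regularity up to the boundary.
\<close>

definition pdiff :: "(real^'n) set \<Rightarrow> 'n \<Rightarrow> (real^'n \<Rightarrow> real) \<Rightarrow> real^'n \<Rightarrow> real" where
  "pdiff S i f x = frechet_derivative f (at x within S) (axis i 1)"

fun pdiffs :: "(real^'n) set \<Rightarrow> 'n list \<Rightarrow> (real^'n \<Rightarrow> real) \<Rightarrow> real^'n \<Rightarrow> real" where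
  "pdiffs S [] f = f"
| "pdiffs S (i # is) f = pdiff S i (pdiffs S is f)"

definition C_k_on :: "nat \<Rightarrow> (real^'n) set \<Rightarrow> (real^'n \<Rightarrow> real) \<Rightarrow> bool" where
  "C_k_on k S f \<longleftrightarrow>
     (\<forall>is. length is < k \<longrightarrow> pdiffs S is f differentiable_on S) \<and>
     (\<forall>is. length is \<le> k \<longrightarrow> continuous_on S (pdiffs S is f))"

definition C_k_alpha_on :: "nat \<Rightarrow> real \<Rightarrow> (real^'n) set \<Rightarrow> (real^'n \<Rightarrow> real) \<Rightarrow> bool" where
  "C_k_alpha_on k \<alpha> S f \<longleftrightarrow> C_k_on k S f \<and>
     (\<forall>is K. length is = k \<and> compact K \<and> K \<subseteq> S \<longrightarrow>
        (\<exists>C. \<forall>x\<in>K. \<forall>y\<in>K. \<bar>pdiffs S is f x - pdiffs S is f y\<bar> \<le> C * dist x y powr \<alpha>))"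


section \<open>The exterior domain and weighted Hoelder spaces\<close>

text \<open>
  The manifold \<open>M\<close> is identified with the complement of the open unit ball by the diffeomorphism
  that provides its asymptotically flat coordinates; its boundary is then the unit sphere.
\<close>

definition M :: "(real^3) set" where
  "M = - ball 0 1"

definition S2 :: "(real^3) set" where
  "S2 = sphere 0 1"

definition weighted_holder :: "nat \<Rightarrow> real \<Rightarrow> real \<Rightarrow> (real^3 \<Rightarrow> real) set" where
  "weighted_holder m \<alpha> \<delta> = {f. C_k_on m M f \<and>
     (\<forall>is. length is \<le> m \<longrightarrow>
        (\<exists>C. \<forall>x\<in>M. norm x powr (\<delta> + real (length is)) * \<bar>pdiffs M is f x\<bar> \<le> C)) \<and>
     (\<forall>is. length is = m \<longrightarrow>
        (\<exists>C. \<forall>x\<in>M. \<forall>y\<in>M.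
           min (norm x) (norm y) powr (\<delta> + real m + \<alpha>) * \<bar>pdiffs M is f x - pdiffs M is f y\<bar>
             \<le> C * dist x y powr \<alpha>))}"


section \<open>Riemannian metrics on the exterior domain and their curvatures\<close>

text \<open>The entry \<open>g x $ i $ j\<close> is the component \<open>g\<^sub>i\<^sub>j(x)\<close> in the standard coordinates.\<close>

type_synonym metric = "real^3 \<Rightarrow> real^3^3"

definition riemannian :: "metric \<Rightarrow> bool" where
  "riemannian g \<longleftrightarrow>
     (\<forall>x\<in>M. transpose (g x) = g x \<and> (\<forall>v. v \<noteq> 0 \<longrightarrow> v \<bullet> (g x *v v) > 0))"

text \<open>
  Since \<open>norm x \<ge> 1\<close> on \<open>M\<close>, the weighted conditions contain that the metric
  is of class \<open>C^{m,\<alpha>}\<close> up to and on the boundary.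
\<close>

definition asymptotically_flat :: "nat \<Rightarrow> real \<Rightarrow> real \<Rightarrow> metric \<Rightarrow> bool" where
  "asymptotically_flat m \<alpha> \<delta> g \<longleftrightarrow> riemannian g \<and>
     (\<forall>i j. (\<lambda>x. g x $ i $ j - (if i = j then 1 else 0)) \<in> weighted_holder m \<alpha> \<delta>)"

definition ginv :: "metric \<Rightarrow> 3 \<Rightarrow> 3 \<Rightarrow> real^3 \<Rightarrow> real" where
  "ginv g i j x = matrix_inv (g x) $ i $ j"

text \<open>\<open>christoffel g k i j\<close> is \<open>\<Gamma>\<^sup>k\<^sub>i\<^sub>j\<close>.\<close>

definition christoffel :: "metric \<Rightarrow> 3 \<Rightarrow> 3 \<Rightarrow> 3 \<Rightarrow> real^3 \<Rightarrow> real" where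
  "christoffel g k i j x = (\<Sum>l\<in>UNIV. ginv g k l x *
     (pdiff M i (\<lambda>y. g y $ j $ l) x + pdiff M j (\<lambda>y. g y $ i $ l) x
        - pdiff M l (\<lambda>y. g y $ i $ j) x)) / 2"

definition ricci :: "metric \<Rightarrow> 3 \<Rightarrow> 3 \<Rightarrow> real^3 \<Rightarrow> real" where
  "ricci g i j x =
     (\<Sum>k\<in>UNIV. pdiff M k (christoffel g k i j) x - pdiff M j (christoffel g k i k) x) +
     (\<Sum>k\<in>UNIV. \<Sum>l\<in>UNIV. christoffel g k k l x * christoffel g l i j x
        - christoffel g k j l x * christoffel g l i k x)"

definition scalar_curvature :: "metric \<Rightarrow> real^3 \<Rightarrow> real" where
  "scalar_curvature g x = (\<Sum>i\<in>UNIV. \<Sum>j\<in>UNIV. ginv g i j x * ricci g i j x)"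

definition P_metrics :: "nat \<Rightarrow> real \<Rightarrow> real \<Rightarrow> metric set" where
  "P_metrics m \<alpha> \<delta> =
     {g. asymptotically_flat m \<alpha> \<delta> g \<and> (\<forall>x\<in>M. scalar_curvature g x \<ge> 0)}"

text \<open>
  The field \<open>unit_normal g\<close> is the \<open>g\<close>-normalised \<open>g\<close>-gradient of the function \<open>|x|\<^sup>2/2\<close>. It is defined
  on all of \<open>M\<close>, and on the unit sphere it is the unit normal pointing into \<open>M\<close>.
\<close>

definition unit_normal :: "metric \<Rightarrow> 3 \<Rightarrow> real^3 \<Rightarrow> real" where
  "unit_normal g k x = (\<Sum>l\<in>UNIV. ginv g k l x * x $ l)
     / sqrt (\<Sum>a\<in>UNIV. \<Sum>b\<in>UNIV. ginv g a b x * x $ a * x $ b)"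

text \<open>The components \<open>g(\<nabla>\<^sub>i \<nu>, \<partial>\<^sub>j)\<close> of the second fundamental form with respect to \<open>\<nu>\<close>.\<close>

definition second_ff :: "metric \<Rightarrow> 3 \<Rightarrow> 3 \<Rightarrow> real^3 \<Rightarrow> real" where
  "second_ff g i j x = (\<Sum>k\<in>UNIV. g x $ k $ j *
     (pdiff M i (unit_normal g k) x + (\<Sum>l\<in>UNIV. christoffel g k i l x * unit_normal g l x)))"

text \<open>
  The trace of the second fundamental form over the tangent space of the unit sphere:
  \<open>g\<^sup>i\<^sup>j - \<nu>\<^sup>i \<nu>\<^sup>j\<close> is the inverse of the induced metric, extended by zero to the conormal direction.
  With this sign, the Euclidean metric has boundary mean curvature \<open>2\<close>.
\<close>

definition mean_curvature :: "metric \<Rightarrow> real^3 \<Rightarrow> real" where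
  "mean_curvature g x = (\<Sum>i\<in>UNIV. \<Sum>j\<in>UNIV.
     (ginv g i j x - unit_normal g i x * unit_normal g j x) * second_ff g i j x)"


section \<open>Functions and metrics on the sphere\<close>

text \<open>
  The inverse stereographic projections from the poles \<open>(0,0,1)\<close> (\<open>north = True\<close>) and \<open>(0,0,-1)\<close>;
  together they form an atlas of the unit sphere.
\<close>

definition stereo :: "bool \<Rightarrow> real^2 \<Rightarrow> real^3" where
  "stereo north u = (1 / (1 + (norm u)\<^sup>2)) *\<^sub>R
     vector [2 * u $ 1, 2 * u $ 2, (if north then 1 else -1) * ((norm u)\<^sup>2 - 1)]"

definition stereo_frame :: "bool \<Rightarrow> 2 \<Rightarrow> real^2 \<Rightarrow> real^3" where
  "stereo_frame north a u = frechet_derivative (stereo north) (at u) (axis a 1)"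

definition sphere_function :: "nat \<Rightarrow> real \<Rightarrow> (real^3 \<Rightarrow> real) \<Rightarrow> bool" where
  "sphere_function k \<alpha> f \<longleftrightarrow> (\<forall>north. C_k_alpha_on k \<alpha> UNIV (\<lambda>u. f (stereo north u)))"

definition tangent :: "real^3 \<Rightarrow> (real^3) set" where
  "tangent p = {v. v \<bullet> p = 0}"

text \<open>
  A metric on the sphere assigns \<open>\<gamma> p v w\<close> to a point \<open>p\<close> of the unit sphere and \<open>v\<close>, \<open>w\<close> tangent
  at \<open>p\<close>; its values at other arguments are irrelevant.
\<close>

type_synonym sphere_form = "real^3 \<Rightarrow> real^3 \<Rightarrow> real^3 \<Rightarrow> real"

definition sphere_metric :: "nat \<Rightarrow> real \<Rightarrow> sphere_form \<Rightarrow> bool" where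
  "sphere_metric m \<alpha> \<gamma> \<longleftrightarrow>
     (\<forall>p\<in>S2. \<forall>v\<in>tangent p. \<forall>w\<in>tangent p.
        \<gamma> p v w = \<gamma> p w v \<and>
        (\<forall>v'\<in>tangent p. \<gamma> p (v + v') w = \<gamma> p v w + \<gamma> p v' w) \<and>
        (\<forall>c. \<gamma> p (c *\<^sub>R v) w = c * \<gamma> p v w) \<and>
        (v \<noteq> 0 \<longrightarrow> \<gamma> p v v > 0)) \<and>
     (\<forall>north a b. C_k_alpha_on m \<alpha> UNIV
        (\<lambda>u. \<gamma> (stereo north u) (stereo_frame north a u) (stereo_frame north b u)))"


section \<open>Boundary data and admissible extensions\<close>

definition boundary_data :: "nat \<Rightarrow> real \<Rightarrow> sphere_form \<Rightarrow> (real^3 \<Rightarrow> real) \<Rightarrow> bool" where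
  "boundary_data m \<alpha> \<gamma> H \<longleftrightarrow> sphere_metric m \<alpha> \<gamma> \<and> sphere_function (m - 1) \<alpha> H"

definition induces :: "metric \<Rightarrow> sphere_form \<Rightarrow> bool" where
  "induces g \<gamma> \<longleftrightarrow>
     (\<forall>p\<in>S2. \<forall>v\<in>tangent p. \<forall>w\<in>tangent p. v \<bullet> (g p *v w) = \<gamma> p v w)"

definition admissible_extension ::
    "nat \<Rightarrow> real \<Rightarrow> real \<Rightarrow> metric \<Rightarrow> sphere_form \<Rightarrow> (real^3 \<Rightarrow> real) \<Rightarrow> bool" where
  "admissible_extension m \<alpha> \<delta> g \<gamma> H \<longleftrightarrow>
     g \<in> P_metrics m \<alpha> \<delta> \<and> induces g \<gamma> \<and> (\<forall>p\<in>S2. mean_curvature g p \<le> H p)"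

definition P_data :: "nat \<Rightarrow> real \<Rightarrow> real \<Rightarrow> (sphere_form \<times> (real^3 \<Rightarrow> real)) set" where
  "P_data m \<alpha> \<delta> =
     {(\<gamma>, H). boundary_data m \<alpha> \<gamma> H \<and> (\<exists>g. admissible_extension m \<alpha> \<delta> g \<gamma> H)}"

end

(*
Start from an admissible extension g and multiply it by e^{2 phi} with
phi = exp (-K) - exp (-K r^{-delta}), which vanishes on the unit sphere and decreases outwards. In
dimension three the scalar curvature becomes e^{-2 phi} (R - 4 Lap phi - 2 |d phi|^2). For K large,
2 Lap phi + |d phi|^2 <= 0 on all of M, because the term of order K in phi'' absorbs the deviation of
g from the flat metric; so R stays non-negative. The boundary metric is unchanged, and the boundary
mean curvature changes by twice the normal derivative of phi, which is negative and bounded away from 0.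

The new metric is asymptotic to a multiple of the flat metric, since phi tends to exp (-K) - 1 at
infinity. This is repaired by pulling back along x |-> f(|x|) x, where f tends to exp (1 - exp (-K)) at
infinity and f - 1 vanishes to third order at the unit sphere. The pullback keeps the scalar curvature
non-negative and does not change the 1-jet of the metric on the sphere, hence neither the boundary metric
nor the mean curvature. So mu can be taken constant.
*)
theory Submission
  imports Defs
begin

text \<open>Why the limit at infinity has to move: with u = exp (phi / 2) the conformal factor is
  u^4, and 2 Lap phi + |d phi|^2 \<le> 0 says that u is superharmonic. If u were 1 on the sphere and
  also tended to 1 at infinity, the minimum principle would give u \<ge> 1, so its normal derivative
  at the sphere could not be negative. A limit below 1 is forced, and the coordinates must be
  rescaled at infinity while the sphere stays fixed. Why this phi: far out it differs from its limit
  by about K r^{-delta}, whose flat Laplacian is negative for delta < 1. Relative to the leading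
  terms, the deviation of g from the flat metric and the contribution of the outer exponential to
  phi'' both have size r^{-delta}, but only the latter carries the factor K. So one large K works at
  every radius at once, and no elliptic equation has to be solved. The connections of the two new
  metrics are found by guessing them and testing the guess against the Koszul formula. All curvature
  identities are pointwise, so an immersion of M into itself is enough for the pullback.\<close>

section \<open>Derivatives within the exterior domain\<close>

lemma mem_M: "x \<in> M \<longleftrightarrow> 1 \<le> norm x"
  by (auto simp: M_def)

text \<open>Of two opposite steps along a coordinate axis at least one does not decrease the norm.
  So every point, also one on the sphere, is approached within \<open>M\<close> along each axis by
  arbitrarily short steps, which is what uniqueness of a derivative requires.\<close>

lemma M_derivative_unique:
  assumes "x \<in> M" and "(f has_derivative f') (at x within M)" and "(f has_derivative f'') (at x within M)"
  shows "f' = f''"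
proof (rule frechet_derivative_unique_within[OF assms(2,3)])
  fix i :: "real^3" and e :: real
  assume i: "i \<in> Basis" and e: "e > 0"
  define d where "d = (if x \<bullet> i \<ge> 0 then e / 2 else - e / 2)"
  have d: "d * (x \<bullet> i) \<ge> 0" "0 < \<bar>d\<bar>" "\<bar>d\<bar> < e"
    using e by (auto simp: d_def mult_nonneg_nonneg zero_le_mult_iff)
  have "(norm (x + d *\<^sub>R i))\<^sup>2 = (norm x)\<^sup>2 + 2 * (d * (x \<bullet> i)) + d\<^sup>2"
    using i unfolding power2_norm_eq_inner
    by (simp add: inner_add_left inner_add_right inner_commute power2_eq_square)
  moreover have "(norm x)\<^sup>2 \<ge> 1"
    using assms(1) by (simp add: mem_M)
  ultimately have "(norm (x + d *\<^sub>R i))\<^sup>2 \<ge> 1\<^sup>2"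
    using d(1) zero_le_power2[of d] unfolding one_power2 by linarith
  then have "x + d *\<^sub>R i \<in> M"
    unfolding mem_M by (rule power2_le_imp_le) simp
  then show "\<exists>d. 0 < \<bar>d\<bar> \<and> \<bar>d\<bar> < e \<and> x + d *\<^sub>R i \<in> M"
    using d by blast
qed

lemma frechet_derivative_M:
  assumes "x \<in> M" and "(f has_derivative f') (at x within M)"
  shows "frechet_derivative f (at x within M) = f'"
  by (metis assms M_derivative_unique differentiableI frechet_derivative_works)

lemma pdiff_M:
  assumes "x \<in> M" and "(f has_derivative f') (at x within M)"
  shows "pdiff M i f x = f' (axis i 1)"
  by (simp add: pdiff_def frechet_derivative_M[OF assms])

lemma vec_axis_sum: "(v :: real^'n) = (\<Sum>i\<in>UNIV. v $ i *\<^sub>R axis i 1)"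
  using basis_expansion[of v] by (simp add: scalar_mult_eq_scaleR)

lemma linear_axis_sum:
  fixes L :: "real^'n \<Rightarrow> 'b::real_vector"
  assumes "linear L"
  shows "L v = (\<Sum>i\<in>UNIV. v $ i *\<^sub>R L (axis i 1))"
proof -
  have "L v = L (\<Sum>i\<in>UNIV. v $ i *\<^sub>R axis i 1)"
    using vec_axis_sum[of v] by simp
  then show ?thesis
    by (simp add: linear_sum[OF assms] linear_scale[OF assms])
qed

lemma sum_axis: "(\<Sum>k\<in>UNIV. axis i (1::real) $ k * c k) = c i"
proof -
  have "(\<Sum>k\<in>UNIV. axis i (1::real) $ k * c k) = (\<Sum>k\<in>UNIV. if k = i then c k else 0)"
    by (intro sum.cong) (auto simp: axis_def)
  then show ?thesis by simp
qed

lemma has_derivative_pdiff: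
  assumes "f differentiable (at x within S)"
  shows "(f has_derivative (\<lambda>v. \<Sum>i\<in>UNIV. v $ i * pdiff S i f x)) (at x within S)"
proof -
  have d: "(f has_derivative frechet_derivative f (at x within S)) (at x within S)"
    using assms frechet_derivative_works by blast
  have "frechet_derivative f (at x within S) = (\<lambda>v. \<Sum>i\<in>UNIV. v $ i * pdiff S i f x)"
    by (rule ext, subst linear_axis_sum[OF has_derivative_linear[OF d]]) (simp add: pdiff_def)
  with d show ?thesis by simp
qed

lemma pdiff_cong:
  assumes "\<And>y. y \<in> M \<Longrightarrow> f y = h y" and "x \<in> M" and "f differentiable (at x within M)"
  shows "pdiff M i f x = pdiff M i h x"
proof -
  obtain f' where f': "(f has_derivative f') (at x within M)"
    using assms(3) differentiable_def by blast
  then have "(h has_derivative f') (at x within M)"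
    by (rule has_derivative_transform[rotated 2]) (use assms in auto)
  then show ?thesis
    using pdiff_M[OF assms(2)] f' by metis
qed

lemma pdiff_add:
  assumes "x \<in> M" "f differentiable (at x within M)" "h differentiable (at x within M)"
  shows "pdiff M i (\<lambda>y. f y + h y) x = pdiff M i f x + pdiff M i h x"
  using pdiff_M[OF assms(1) has_derivative_add[OF has_derivative_pdiff[OF assms(2)] has_derivative_pdiff[OF assms(3)]], of i]
  by (simp add: sum_axis)

lemma pdiff_mult:
  assumes "x \<in> M" "f differentiable (at x within M)" "h differentiable (at x within M)"
  shows "pdiff M i (\<lambda>y. f y * h y) x = f x * pdiff M i h x + pdiff M i f x * h x"
  using pdiff_M[OF assms(1) has_derivative_mult[OF has_derivative_pdiff[OF assms(2)] has_derivative_pdiff[OF assms(3)]], of i]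
  by (simp add: sum_axis)

lemma pdiff_const: "x \<in> M \<Longrightarrow> pdiff M i (\<lambda>y. c) x = 0"
  by (drule pdiff_M[OF _ has_derivative_const])

text \<open>The last index of the list is differentiated first. Splitting the list at its end
  therefore reduces order \<open>Suc k\<close> of a function to order \<open>k\<close> of its first
  partial derivatives, which is the induction behind the regularity proofs.\<close>

lemma pdiffs_snoc: "pdiffs S (is @ [i]) f = pdiffs S is (pdiff S i f)"
  by (induction "is") auto

lemma all_lists_Suc_iff:
  "(\<forall>is. P is) \<longleftrightarrow> P [] \<and> (\<forall>i is. P (is @ [i]))"
proof (intro iffI conjI allI)
  fix "is" assume "P [] \<and> (\<forall>i is. P (is @ [i]))"
  then show "P is" by (metis rev_exhaust)
next
  assume a: "\<forall>is. P is"
  show "P []" using a by (rule spec)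
  show "P (is @ [i])" for i "is" using a by (rule spec)
qed

lemma C_k_on_Suc:
  "C_k_on (Suc k) S f \<longleftrightarrow> f differentiable_on S \<and> (\<forall>i. C_k_on k S (pdiff S i f))"
proof
  assume a: "C_k_on (Suc k) S f"
  have "f differentiable_on S"
    using a by (auto simp: C_k_on_def dest: spec[of _ "[]"])
  moreover have "C_k_on k S (pdiff S i f)" for i
    using a unfolding C_k_on_def pdiffs_snoc[symmetric] by simp
  ultimately show "f differentiable_on S \<and> (\<forall>i. C_k_on k S (pdiff S i f))" by blast
next
  assume "f differentiable_on S \<and> (\<forall>i. C_k_on k S (pdiff S i f))"
  then show "C_k_on (Suc k) S f"
    unfolding C_k_on_def by (subst (1 2) all_lists_Suc_iff) (auto simp: pdiffs_snoc differentiable_imp_continuous_on)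
qed

section \<open>Weighted Hoelder spaces\<close>

lemma weighted_holder_0:
  "f \<in> weighted_holder 0 \<alpha> \<delta> \<longleftrightarrow> continuous_on M f \<and>
     (\<exists>C. \<forall>x\<in>M. norm x powr \<delta> * \<bar>f x\<bar> \<le> C) \<and>
     (\<exists>C. \<forall>x\<in>M. \<forall>y\<in>M. min (norm x) (norm y) powr (\<delta> + \<alpha>) * \<bar>f x - f y\<bar> \<le> C * dist x y powr \<alpha>)"
  by (auto simp: weighted_holder_def C_k_on_def)

text \<open>Each derivative costs one power of r, so the partial derivatives are measured at rate
  \<open>\<delta> + 1\<close>. The closure properties below follow by induction on \<open>k\<close>
  with the rate left general.\<close>

lemma weighted_holder_Suc:
  "f \<in> weighted_holder (Suc k) \<alpha> \<delta> \<longleftrightarrow> f differentiable_on M \<and>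
     (\<exists>C. \<forall>x\<in>M. norm x powr \<delta> * \<bar>f x\<bar> \<le> C) \<and> (\<forall>i. pdiff M i f \<in> weighted_holder k \<alpha> (\<delta> + 1))"
proof -
  define B where "B f \<delta> is \<longleftrightarrow> (\<exists>C. \<forall>x\<in>M. norm x powr (\<delta> + real (length is)) * \<bar>pdiffs M is f x\<bar> \<le> C)"
    for f \<delta> "is"
  define H where "H m f \<delta> is \<longleftrightarrow> (\<exists>C. \<forall>x\<in>M. \<forall>y\<in>M.
      min (norm x) (norm y) powr (\<delta> + real m + \<alpha>) * \<bar>pdiffs M is f x - pdiffs M is f y\<bar> \<le> C * dist x y powr \<alpha>)"
    for m f \<delta> "is"
  have wh: "f \<in> weighted_holder m \<alpha> \<delta> \<longleftrightarrow> C_k_on m M f \<and> (\<forall>is. length is \<le> m \<longrightarrow> B f \<delta> is) \<and>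
      (\<forall>is. length is = m \<longrightarrow> H m f \<delta> is)" for m f \<delta>
    by (simp add: weighted_holder_def B_def H_def)
  have B: "B f \<delta> (is @ [i]) \<longleftrightarrow> B (pdiff M i f) (\<delta> + 1) is" for i "is"
    by (simp add: B_def pdiffs_snoc add_ac)
  have H: "H (Suc k) f \<delta> (is @ [i]) \<longleftrightarrow> H k (pdiff M i f) (\<delta> + 1) is" for i "is"
    by (simp add: H_def pdiffs_snoc add_ac)
  have 1: "(\<forall>is. length is \<le> Suc k \<longrightarrow> B f \<delta> is) \<longleftrightarrow> B f \<delta> [] \<and> (\<forall>i is. length is \<le> k \<longrightarrow> B (pdiff M i f) (\<delta> + 1) is)"
    by (subst all_lists_Suc_iff) (simp add: B)
  have 2: "(\<forall>is. length is = Suc k \<longrightarrow> H (Suc k) f \<delta> is) \<longleftrightarrow> (\<forall>i is. length is = k \<longrightarrow> H k (pdiff M i f) (\<delta> + 1) is)"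
    by (subst all_lists_Suc_iff) (simp add: H)
  have 3: "B f \<delta> [] \<longleftrightarrow> (\<exists>C. \<forall>x\<in>M. norm x powr \<delta> * \<bar>f x\<bar> \<le> C)"
    by (simp add: B_def)
  show ?thesis
    unfolding wh C_k_on_Suc 1 2 3 by blast
qed

lemma weighted_holder_pdiff:
  "f \<in> weighted_holder (Suc k) \<alpha> \<delta> \<Longrightarrow> pdiff M i f \<in> weighted_holder k \<alpha> (\<delta> + 1)"
  unfolding weighted_holder_Suc by blast

lemma weighted_holder_differentiable:
  "f \<in> weighted_holder (Suc k) \<alpha> \<delta> \<Longrightarrow> f differentiable_on M"
  unfolding weighted_holder_Suc by blast

lemma weighted_holder_bound:
  "f \<in> weighted_holder k \<alpha> \<delta> \<Longrightarrow> \<exists>C. \<forall>x\<in>M. norm x powr \<delta> * \<bar>f x\<bar> \<le> C"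
  by (cases k) (simp_all only: weighted_holder_0 weighted_holder_Suc)

lemma weighted_holder_SucI:
  assumes "f differentiable_on M" and "\<exists>C. \<forall>x\<in>M. norm x powr \<delta> * \<bar>f x\<bar> \<le> C"
    and "\<And>i. pdiff M i f \<in> weighted_holder k \<alpha> (\<delta> + 1)"
  shows "f \<in> weighted_holder (Suc k) \<alpha> \<delta>"
  using assms unfolding weighted_holder_Suc by blast

lemma weighted_holder_0I:
  assumes "continuous_on M f" and "\<And>x. x \<in> M \<Longrightarrow> norm x powr \<delta> * \<bar>f x\<bar> \<le> C"
    and "\<And>x y. x \<in> M \<Longrightarrow> y \<in> M \<Longrightarrow> min (norm x) (norm y) powr (\<delta> + \<alpha>) * \<bar>f x - f y\<bar> \<le> D * dist x y powr \<alpha>"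
  shows "f \<in> weighted_holder 0 \<alpha> \<delta>"
  using assms unfolding weighted_holder_0 by blast

lemma weighted_holder_0E:
  assumes "f \<in> weighted_holder 0 \<alpha> \<delta>"
  obtains C D where "continuous_on M f" and "\<And>x. x \<in> M \<Longrightarrow> norm x powr \<delta> * \<bar>f x\<bar> \<le> C"
    and "\<And>x y. x \<in> M \<Longrightarrow> y \<in> M \<Longrightarrow> min (norm x) (norm y) powr (\<delta> + \<alpha>) * \<bar>f x - f y\<bar> \<le> D * dist x y powr \<alpha>"
  using assms unfolding weighted_holder_0 by metis

lemma weighted_holder_cong:
  assumes "f \<in> weighted_holder k \<alpha> \<delta>" and "\<And>x. x \<in> M \<Longrightarrow> f x = h x"
  shows "h \<in> weighted_holder k \<alpha> \<delta>"
  using assms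
proof (induction k arbitrary: f h \<delta>)
  case 0
  then show ?case by (simp add: weighted_holder_0 cong: continuous_on_cong ball_cong)
next
  case (Suc k)
  have d: "f differentiable_on M" and p: "pdiff M i f \<in> weighted_holder k \<alpha> (\<delta> + 1)" for i
    using Suc.prems(1) by (auto simp: weighted_holder_Suc)
  have "pdiff M i h \<in> weighted_holder k \<alpha> (\<delta> + 1)" for i
    using Suc.IH[OF p] pdiff_cong[OF Suc.prems(2)] d by (auto simp: differentiable_on_def)
  moreover have "h differentiable_on M"
    using d Suc.prems(2) by (metis differentiable_on_def differentiable_transform_within zero_less_one)
  ultimately show ?case
    using Suc.prems by (simp add: weighted_holder_Suc cong: ball_cong)
qed

text \<open>The mean value inequality on a segment inside \<open>M\<close>; the factor 3 counts the
  partial derivatives. The radius \<open>\<rho>\<close> confines the gradient bound to points far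
  out, where a decay weight makes it small.\<close>

lemma segment_bound:
  assumes f: "f differentiable_on M" and B: "\<And>z i. z \<in> M \<Longrightarrow> \<rho> \<le> norm z \<Longrightarrow> \<bar>pdiff M i f z\<bar> \<le> B"
    and s: "\<And>t. 0 \<le> t \<Longrightarrow> t \<le> 1 \<Longrightarrow> 1 \<le> norm (a + t *\<^sub>R v) \<and> \<rho> \<le> norm (a + t *\<^sub>R v)"
  shows "\<bar>f (a + v) - f a\<bar> \<le> 3 * B * norm v"
proof -
  define S where "S = closed_segment a (a + v)"
  have S: "z \<in> M \<and> \<rho> \<le> norm z" if z: "z \<in> S" for z
  proof -
    obtain t where "0 \<le> t" "t \<le> 1" "z = (1 - t) *\<^sub>R a + t *\<^sub>R (a + v)"
      using z by (auto simp: S_def in_segment)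
    then have "z = a + t *\<^sub>R v" by (simp add: algebra_simps)
    then show ?thesis using s[OF \<open>0 \<le> t\<close> \<open>t \<le> 1\<close>] by (simp add: mem_M)
  qed
  have "norm (f (a + v) - f a) \<le> (3 * B) * norm (a + v - a)"
  proof (rule differentiable_bound)
    show "convex S" by (simp add: S_def)
    show "a + v \<in> S" "a \<in> S" by (auto simp: S_def)
    fix x assume x: "x \<in> S"
    then have xM: "x \<in> M" using S by blast
    have "(f has_derivative (\<lambda>v. \<Sum>i\<in>UNIV. v $ i * pdiff M i f x)) (at x within M)"
      using f xM by (auto intro!: has_derivative_pdiff simp: differentiable_on_def)
    then show "(f has_derivative (\<lambda>v. \<Sum>i\<in>UNIV. v $ i * pdiff M i f x)) (at x within S)"
      by (rule has_derivative_subset) (use S in blast)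
    show "onorm (\<lambda>v. \<Sum>i\<in>UNIV. v $ i * pdiff M i f x) \<le> 3 * B"
    proof (rule onorm_le)
      fix w :: "real^3"
      have "\<bar>w $ i * pdiff M i f x\<bar> \<le> norm w * B" for i
        unfolding abs_mult using B[OF xM] S[OF x] component_le_norm_cart by (intro mult_mono) auto
      then have "norm (\<Sum>i\<in>UNIV. w $ i * pdiff M i f x) \<le> (\<Sum>i\<in>(UNIV::3 set). norm w * B)"
        by (intro sum_norm_le) auto
      then show "norm (\<Sum>i\<in>UNIV. w $ i * pdiff M i f x) \<le> 3 * B * norm w"
        by (simp add: mult_ac)
    qed
  qed
  then show ?thesis by simp
qed

text \<open>The segment from \<open>x\<close> to \<open>y\<close> may leave \<open>M\<close>; the path is therefore first moved outwards by
  \<open>dist x y\<close> in the direction of \<open>x\<close>.\<close>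

lemma path_bound:
  assumes f: "f differentiable_on M" and B: "\<And>z i. z \<in> M \<Longrightarrow> norm x \<le> norm z \<Longrightarrow> \<bar>pdiff M i f z\<bar> \<le> B"
    and x: "x \<in> M" and xy: "norm x \<le> norm y" and d: "dist x y \<le> norm x"
  shows "\<bar>f x - f y\<bar> \<le> 9 * B * dist x y"
proof -
  define u where "u = (dist x y / norm x) *\<^sub>R x"
  have x1: "1 \<le> norm x" using x by (simp add: mem_M)
  then have x0: "norm x > 0" by linarith
  have nu: "norm u = dist x y" using x1 by (auto simp: u_def)
  have xu: "norm (x + t *\<^sub>R u) = norm x + t * dist x y" if "t \<ge> 0" for t
  proof -
    have "x + t *\<^sub>R u = (1 + t * dist x y / norm x) *\<^sub>R x"
      by (simp add: u_def algebra_simps)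
    then have "norm (x + t *\<^sub>R u) = \<bar>1 + t * dist x y / norm x\<bar> * norm x"
      by simp
    moreover have "0 \<le> t * dist x y / norm x" using that by simp
    ultimately have "norm (x + t *\<^sub>R u) = (1 + t * dist x y / norm x) * norm x"
      by simp
    also have "\<dots> = norm x + t * dist x y"
      using x0 by (simp add: field_simps)
    finally show ?thesis .
  qed
  have 1: "\<bar>f (x + u) - f x\<bar> \<le> 3 * B * norm u"
    by (rule segment_bound[OF f B]) (use xu x1 in \<open>auto intro: order_trans\<close>)
  have 2: "\<bar>f (x + u + (y - x)) - f (x + u)\<bar> \<le> 3 * B * norm (y - x)"
  proof (rule segment_bound[OF f B])
    fix t :: real assume t: "0 \<le> t" "t \<le> 1"
    have "norm (x + u) \<le> norm (x + u + t *\<^sub>R (y - x)) + norm (t *\<^sub>R (y - x))"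
      using norm_triangle_ineq4[of "x + u + t *\<^sub>R (y - x)" "t *\<^sub>R (y - x)"] by simp
    moreover have "norm (t *\<^sub>R (y - x)) \<le> 1 * dist x y"
      unfolding norm_scaleR dist_norm norm_minus_commute[of y x] using t by (intro mult_right_mono) auto
    moreover have "norm (x + u) = norm x + dist x y" using xu[of 1] by simp
    ultimately have "norm x \<le> norm (x + u + t *\<^sub>R (y - x))" by linarith
    then show "1 \<le> norm (x + u + t *\<^sub>R (y - x)) \<and> norm x \<le> norm (x + u + t *\<^sub>R (y - x))"
      using x1 by linarith
  qed
  \<comment> \<open>A distance of at most \<open>norm x\<close> keeps y in the half space of x, so
    the return segment between y + u and y never comes closer to the origin than y.\<close>
  have ip: "0 \<le> y \<bullet> u"
  proof -
    have "x \<bullet> x - y \<bullet> x \<le> norm (x - y) * norm x"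
      using norm_cauchy_schwarz[of "x - y" x] by (simp add: inner_diff_left)
    also have "\<dots> \<le> norm x * norm x"
      using d by (intro mult_right_mono) (auto simp: dist_norm)
    finally have "0 \<le> y \<bullet> x" by (simp add: power2_norm_eq_inner[symmetric] power2_eq_square)
    then show ?thesis by (simp add: u_def)
  qed
  have 3: "\<bar>f (y + u) - f y\<bar> \<le> 3 * B * norm u"
  proof (rule segment_bound[OF f B])
    fix t :: real assume t: "0 \<le> t" "t \<le> 1"
    have "(norm (y + t *\<^sub>R u))\<^sup>2 = (norm y)\<^sup>2 + 2 * (t * (y \<bullet> u)) + t\<^sup>2 * (norm u)\<^sup>2"
      by (simp add: power2_norm_eq_inner inner_add_left inner_add_right inner_commute) (simp add: power2_eq_square)
    then have "(norm y)\<^sup>2 \<le> (norm (y + t *\<^sub>R u))\<^sup>2"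
      using ip t by simp
    then have "norm y \<le> norm (y + t *\<^sub>R u)" by (rule power2_le_imp_le) simp
    then show "1 \<le> norm (y + t *\<^sub>R u) \<and> norm x \<le> norm (y + t *\<^sub>R u)"
      using x1 xy by linarith
  qed
  have "norm (y - x) = dist x y" by (simp add: dist_norm norm_minus_commute)
  then show ?thesis using 1 2 3 nu by (simp add: add.commute)
qed

lemma weight_mult_mono:
  fixes r :: real
  assumes "a \<le> b" "1 \<le> r" "r powr b * A \<le> C" "0 \<le> A"
  shows "r powr a * A \<le> C"
proof -
  have "r powr a * A \<le> r powr b * A"
    using assms by (intro mult_right_mono powr_mono) auto
  with assms show ?thesis by linarith
qed

text \<open>Points at distance at most \<open>norm x\<close> are joined by the path of
  \<open>path_bound\<close>, where the gradient is of order
  \<open>norm x powr - (\<delta> + 1)\<close>; the exponents are then balanced by \<open>norm x powr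
  (\<alpha> - 1) * dist x y \<le> dist x y powr \<alpha>\<close>. For more distant points the bounds
  on the two values suffice, since
  \<open>norm x powr \<alpha> \<le> dist x y powr \<alpha>\<close>.\<close>

lemma holder_from_gradient:
  assumes f: "f differentiable_on M" and a: "0 < \<alpha>" "\<alpha> \<le> 1" and \<delta>: "0 \<le> \<delta>"
    and C0: "\<And>x. x \<in> M \<Longrightarrow> norm x powr \<delta> * \<bar>f x\<bar> \<le> C0"
    and C1: "\<And>x i. x \<in> M \<Longrightarrow> norm x powr (\<delta> + 1) * \<bar>pdiff M i f x\<bar> \<le> C1"
    and x: "x \<in> M" and y: "y \<in> M" and xy: "norm x \<le> norm y"
  shows "norm x powr (\<delta> + \<alpha>) * \<bar>f x - f y\<bar> \<le> (9 * C1 + 2 * C0) * dist x y powr \<alpha>"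
proof -
  have x1: "1 \<le> norm x" using x by (simp add: mem_M)
  then have x0: "x \<noteq> 0" by auto
  have nn: "0 \<le> C0" "0 \<le> C1"
    using C0[OF x] C1[OF x] by (meson abs_ge_zero mult_nonneg_nonneg order_trans powr_ge_zero)+
  show ?thesis
  proof (cases "dist x y \<le> norm x")
    case True
    have B: "\<bar>pdiff M i f z\<bar> \<le> C1 * norm x powr - (\<delta> + 1)" if z: "z \<in> M" "norm x \<le> norm z" for z i
    proof -
      have "norm x powr (\<delta> + 1) * \<bar>pdiff M i f z\<bar> \<le> norm z powr (\<delta> + 1) * \<bar>pdiff M i f z\<bar>"
        using z(2) \<delta> by (intro mult_right_mono powr_mono2) auto
      also have "\<dots> \<le> C1" by (rule C1[OF z(1)])
      finally show ?thesis
        using x0 unfolding powr_minus by (simp add: field_simps)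
    qed
    have "\<bar>f x - f y\<bar> \<le> 9 * (C1 * norm x powr - (\<delta> + 1)) * dist x y"
      by (rule path_bound[OF f B x xy True])
    then have "norm x powr (\<delta> + \<alpha>) * \<bar>f x - f y\<bar> \<le> norm x powr (\<delta> + \<alpha>) * (9 * (C1 * norm x powr - (\<delta> + 1)) * dist x y)"
      by (rule mult_left_mono) simp
    also have "\<dots> = 9 * C1 * ((norm x powr (\<delta> + \<alpha>) * norm x powr - (\<delta> + 1)) * dist x y)"
      by (simp add: mult_ac)
    also have "norm x powr (\<delta> + \<alpha>) * norm x powr - (\<delta> + 1) = norm x powr (\<alpha> - 1)"
      by (simp add: powr_add[symmetric])
    also have "norm x powr (\<alpha> - 1) * dist x y \<le> dist x y powr \<alpha>"
    proof (cases "dist x y = 0")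
      case False
      then have "norm x powr (\<alpha> - 1) \<le> dist x y powr (\<alpha> - 1)"
        using True a by (intro powr_mono2') auto
      then have "norm x powr (\<alpha> - 1) * dist x y \<le> dist x y powr (\<alpha> - 1) * dist x y powr 1"
        by (simp add: mult_right_mono)
      then show ?thesis using powr_add[of "dist x y" "\<alpha> - 1" 1] by simp
    qed auto
    finally have "norm x powr (\<delta> + \<alpha>) * \<bar>f x - f y\<bar> \<le> 9 * C1 * dist x y powr \<alpha>"
      using nn by (simp add: mult_left_mono)
    then show ?thesis using nn by (simp add: distrib_right add_increasing2)
  next
    case False
    have "norm x powr \<delta> * \<bar>f y\<bar> \<le> norm y powr \<delta> * \<bar>f y\<bar>"
      using xy \<delta> by (intro mult_right_mono powr_mono2) auto
    then have "norm x powr \<delta> * \<bar>f x - f y\<bar> \<le> 2 * C0"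
      using C0[OF x] C0[OF y] mult_left_mono[OF abs_triangle_ineq4[of "f x" "f y"], of "norm x powr \<delta>"]
      by (simp add: distrib_left)
    moreover have "norm x powr \<alpha> \<le> dist x y powr \<alpha>"
      using False a by (intro powr_mono2) auto
    ultimately have "norm x powr \<alpha> * (norm x powr \<delta> * \<bar>f x - f y\<bar>) \<le> dist x y powr \<alpha> * (2 * C0)"
      by - (rule mult_mono, auto)
    then have "norm x powr (\<delta> + \<alpha>) * \<bar>f x - f y\<bar> \<le> 2 * C0 * dist x y powr \<alpha>"
      by (simp add: powr_add mult_ac)
    then show ?thesis using nn by (simp add: distrib_right add_increasing)
  qed
qed

lemma weighted_holder_0_gradient:
  assumes f: "f differentiable_on M" and a: "0 < \<alpha>" "\<alpha> \<le> 1" and \<delta>: "0 \<le> \<delta>"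
    and C0: "\<exists>C. \<forall>x\<in>M. norm x powr \<delta> * \<bar>f x\<bar> \<le> C"
    and C1: "\<And>i. \<exists>C. \<forall>x\<in>M. norm x powr (\<delta> + 1) * \<bar>pdiff M i f x\<bar> \<le> C"
  shows "f \<in> weighted_holder 0 \<alpha> \<delta>"
proof -
  obtain C0 where C0: "\<And>x. x \<in> M \<Longrightarrow> norm x powr \<delta> * \<bar>f x\<bar> \<le> C0" using assms(5) by blast
  obtain C1 where C1: "\<And>i x. x \<in> M \<Longrightarrow> norm x powr (\<delta> + 1) * \<bar>pdiff M i f x\<bar> \<le> C1 i" using assms(6) by metis
  define c where "c = Max (range C1)"
  have c: "norm x powr (\<delta> + 1) * \<bar>pdiff M i f x\<bar> \<le> c" if "x \<in> M" for x i
  proof -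
    have "C1 i \<le> c" unfolding c_def by (rule Max_ge) auto
    with C1[OF that, of i] show ?thesis by linarith
  qed
  have "min (norm x) (norm y) powr (\<delta> + \<alpha>) * \<bar>f x - f y\<bar> \<le> (9 * c + 2 * C0) * dist x y powr \<alpha>"
    if "x \<in> M" "y \<in> M" for x y
  proof (cases "norm x \<le> norm y")
    case True
    then show ?thesis
      using holder_from_gradient[OF f a \<delta> C0 c that] by (simp add: min_def)
  next
    case False
    then show ?thesis
      using holder_from_gradient[OF f a \<delta> C0 c that(2,1)]
      by (simp add: min_def abs_minus_commute dist_commute)
  qed
  then show ?thesis
    using differentiable_imp_continuous_on[OF f] C0 unfolding weighted_holder_0 by blast
qed

text \<open>The product rule leaves one factor undifferentiated, and the induction for products
  needs that factor at the lower order. Only order 0 is not formal: there the Hoelder quotient has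
  to be obtained from the gradient.\<close>

lemma weighted_holder_Suc_imp:
  assumes "f \<in> weighted_holder (Suc k) \<alpha> \<delta>" and a: "0 < \<alpha>" "\<alpha> \<le> 1" and "0 \<le> \<delta>"
  shows "f \<in> weighted_holder k \<alpha> \<delta>"
  using assms(1,4)
proof (induction k arbitrary: f \<delta>)
  case 0
  show ?case
    using 0 by (intro weighted_holder_0_gradient a weighted_holder_differentiable[OF 0(1)]
        weighted_holder_bound[OF 0(1)] weighted_holder_bound[OF weighted_holder_pdiff[OF 0(1)]])
next
  case (Suc k)
  have "pdiff M i f \<in> weighted_holder k \<alpha> (\<delta> + 1)" for i
    using Suc.prems(2) by (intro Suc.IH weighted_holder_pdiff[OF Suc.prems(1)]) simp
  then show ?case
    by (intro weighted_holder_SucI weighted_holder_differentiable[OF Suc.prems(1)]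
        weighted_holder_bound[OF Suc.prems(1)])
qed

lemma weighted_holder_mono:
  assumes "f \<in> weighted_holder k \<alpha> a" and "b \<le> a" and "0 < \<alpha>"
  shows "f \<in> weighted_holder k \<alpha> b"
  using assms(1,2)
proof (induction k arbitrary: f a b)
  case 0
  obtain C D where f: "continuous_on M f" and C: "\<And>x. x \<in> M \<Longrightarrow> norm x powr a * \<bar>f x\<bar> \<le> C"
    and D: "\<And>x y. x \<in> M \<Longrightarrow> y \<in> M \<Longrightarrow> min (norm x) (norm y) powr (a + \<alpha>) * \<bar>f x - f y\<bar> \<le> D * dist x y powr \<alpha>"
    by (rule weighted_holder_0E[OF 0(1)], rule that)
  show ?case
  proof (rule weighted_holder_0I[OF f])
    show "norm x powr b * \<bar>f x\<bar> \<le> C" if "x \<in> M" for x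
      using weight_mult_mono[OF 0(2) _ C[OF that]] that by (simp add: mem_M)
    show "min (norm x) (norm y) powr (b + \<alpha>) * \<bar>f x - f y\<bar> \<le> D * dist x y powr \<alpha>"
      if "x \<in> M" "y \<in> M" for x y
      using weight_mult_mono[OF _ _ D[OF that], of "b + \<alpha>"] that 0(2) by (simp add: mem_M)
  qed
next
  case (Suc k)
  obtain C where C: "\<And>x. x \<in> M \<Longrightarrow> norm x powr a * \<bar>f x\<bar> \<le> C"
    using weighted_holder_bound[OF Suc.prems(1)] by metis
  have "norm x powr b * \<bar>f x\<bar> \<le> C" if "x \<in> M" for x
    using weight_mult_mono[OF Suc.prems(2) _ C[OF that]] that by (simp add: mem_M)
  then have "\<exists>C. \<forall>x\<in>M. norm x powr b * \<bar>f x\<bar> \<le> C" by blast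
  moreover have "pdiff M i f \<in> weighted_holder k \<alpha> (b + 1)" for i
    using Suc.prems(2) by (intro Suc.IH[OF weighted_holder_pdiff[OF Suc.prems(1)]]) simp
  ultimately show ?case
    by (intro weighted_holder_SucI weighted_holder_differentiable[OF Suc.prems(1)])
qed

lemma weighted_holder_add:
  assumes "f \<in> weighted_holder k \<alpha> a" and "h \<in> weighted_holder k \<alpha> a"
  shows "(\<lambda>x. f x + h x) \<in> weighted_holder k \<alpha> a"
proof -
  have bd: "norm x powr a * \<bar>f x + h x\<bar> \<le> C + D"
    if "norm x powr a * \<bar>f x\<bar> \<le> C" "norm x powr a * \<bar>h x\<bar> \<le> D" for f h :: "real^3 \<Rightarrow> real" and a x C D
    using that mult_left_mono[OF abs_triangle_ineq[of "f x" "h x"], of "norm x powr a"] by (simp add: distrib_left)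
  show ?thesis
    using assms
  proof (induction k arbitrary: f h a)
    case 0
    obtain C C' where f: "continuous_on M f" and C: "\<And>x. x \<in> M \<Longrightarrow> norm x powr a * \<bar>f x\<bar> \<le> C"
      and C': "\<And>x y. x \<in> M \<Longrightarrow> y \<in> M \<Longrightarrow> min (norm x) (norm y) powr (a + \<alpha>) * \<bar>f x - f y\<bar> \<le> C' * dist x y powr \<alpha>"
      by (rule weighted_holder_0E[OF 0(1)], rule that)
    obtain D D' where h: "continuous_on M h" and D: "\<And>x. x \<in> M \<Longrightarrow> norm x powr a * \<bar>h x\<bar> \<le> D"
      and D': "\<And>x y. x \<in> M \<Longrightarrow> y \<in> M \<Longrightarrow> min (norm x) (norm y) powr (a + \<alpha>) * \<bar>h x - h y\<bar> \<le> D' * dist x y powr \<alpha>"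
      by (rule weighted_holder_0E[OF 0(2)], rule that)
    show ?case
    proof (rule weighted_holder_0I)
      show "continuous_on M (\<lambda>x. f x + h x)" using f h by (rule continuous_on_add)
      show "norm x powr a * \<bar>f x + h x\<bar> \<le> C + D" if "x \<in> M" for x
        by (rule bd[where f = f and h = h, OF C[OF that] D[OF that]])
      show "min (norm x) (norm y) powr (a + \<alpha>) * \<bar>f x + h x - (f y + h y)\<bar> \<le> (C' + D') * dist x y powr \<alpha>"
        if "x \<in> M" "y \<in> M" for x y
      proof -
        have "\<bar>f x + h x - (f y + h y)\<bar> \<le> \<bar>f x - f y\<bar> + \<bar>h x - h y\<bar>" by linarith
        from mult_left_mono[OF this, of "min (norm x) (norm y) powr (a + \<alpha>)"] show ?thesis
          using C'[OF that] D'[OF that] by (simp add: distrib_left distrib_right)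
      qed
    qed
  next
    case (Suc k)
    note d = weighted_holder_differentiable[OF Suc.prems(1)] weighted_holder_differentiable[OF Suc.prems(2)]
    have "(\<lambda>x. pdiff M i f x + pdiff M i h x) \<in> weighted_holder k \<alpha> (a + 1)" for i
      by (intro Suc.IH weighted_holder_pdiff Suc.prems)
    then have "pdiff M i (\<lambda>x. f x + h x) \<in> weighted_holder k \<alpha> (a + 1)" for i
      by (rule weighted_holder_cong) (use d in \<open>simp add: pdiff_add differentiable_on_def\<close>)
    moreover have "\<exists>C. \<forall>x\<in>M. norm x powr a * \<bar>f x + h x\<bar> \<le> C"
      using bd[where f = f and h = h] weighted_holder_bound[OF Suc.prems(1)] weighted_holder_bound[OF Suc.prems(2)] by metis
    ultimately show ?case
      by (intro weighted_holder_SucI differentiable_on_add d)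
  qed
qed

lemma weighted_holder_zero: "(\<lambda>x. 0) \<in> weighted_holder k \<alpha> a"
proof (induction k arbitrary: a)
  case 0
  show ?case by (rule weighted_holder_0I[of _ _ 0 _ 0]) auto
next
  case (Suc k)
  have "pdiff M i (\<lambda>x. 0) \<in> weighted_holder k \<alpha> (a + 1)" for i
    by (rule weighted_holder_cong[OF Suc]) (simp add: pdiff_const)
  then show ?case
    by (intro weighted_holder_SucI differentiable_on_const exI[of _ 0]) auto
qed

lemma weighted_holder_const: "(\<lambda>x. c) \<in> weighted_holder k \<alpha> 0"
proof (cases k)
  case 0
  show ?thesis unfolding 0
    by (rule weighted_holder_0I[of _ _ "\<bar>c\<bar>" _ 0]) (auto simp: mem_M)
next
  case (Suc j)
  have "pdiff M i (\<lambda>x. c) \<in> weighted_holder j \<alpha> (0 + 1)" for i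
    by (rule weighted_holder_cong[OF weighted_holder_zero]) (simp add: pdiff_const)
  then show ?thesis unfolding Suc
    by (intro weighted_holder_SucI differentiable_on_const exI[of _ "\<bar>c\<bar>"]) (auto simp: mem_M)
qed

lemma weighted_holder_mult:
  assumes "f \<in> weighted_holder k \<alpha> a" and "h \<in> weighted_holder k \<alpha> b"
    and \<alpha>: "0 < \<alpha>" "\<alpha> \<le> 1" and "0 \<le> a" and "0 \<le> b"
  shows "(\<lambda>x. f x * h x) \<in> weighted_holder k \<alpha> (a + b)"
proof -
  have bd: "norm x powr (a + b) * \<bar>f x * h x\<bar> \<le> \<bar>C\<bar> * \<bar>D\<bar>"
    if C: "norm x powr a * \<bar>f x\<bar> \<le> C" and D: "norm x powr b * \<bar>h x\<bar> \<le> D"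
    for f h :: "real^3 \<Rightarrow> real" and a b x C D
  proof -
    have "norm x powr (a + b) * \<bar>f x * h x\<bar> = (norm x powr a * \<bar>f x\<bar>) * (norm x powr b * \<bar>h x\<bar>)"
      by (simp add: powr_add abs_mult mult_ac)
    also have "\<dots> \<le> \<bar>C\<bar> * \<bar>D\<bar>"
      by (rule mult_mono[OF order_trans[OF C abs_ge_self] order_trans[OF D abs_ge_self]]) auto
    finally show ?thesis .
  qed
  show ?thesis
    using assms(1,2,5,6)
  proof (induction k arbitrary: f h a b)
    case 0
    obtain C0 C where f: "continuous_on M f" and C0: "\<And>x. x \<in> M \<Longrightarrow> norm x powr a * \<bar>f x\<bar> \<le> C0"
      and C: "\<And>x y. x \<in> M \<Longrightarrow> y \<in> M \<Longrightarrow> min (norm x) (norm y) powr (a + \<alpha>) * \<bar>f x - f y\<bar> \<le> C * dist x y powr \<alpha>"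
      by (rule weighted_holder_0E[OF 0(1)], rule that)
    obtain D0 D where h: "continuous_on M h" and D0: "\<And>x. x \<in> M \<Longrightarrow> norm x powr b * \<bar>h x\<bar> \<le> D0"
      and D: "\<And>x y. x \<in> M \<Longrightarrow> y \<in> M \<Longrightarrow> min (norm x) (norm y) powr (b + \<alpha>) * \<bar>h x - h y\<bar> \<le> D * dist x y powr \<alpha>"
      by (rule weighted_holder_0E[OF 0(2)], rule that)
    have hol: "min (norm x) (norm y) powr (a + b + \<alpha>) * \<bar>f x * h x - f y * h y\<bar> \<le> (\<bar>C0\<bar> * \<bar>D\<bar> + \<bar>C\<bar> * \<bar>D0\<bar>) * dist x y powr \<alpha>"
      if xy: "x \<in> M" "y \<in> M" for x y
    proof -
      define m where "m = min (norm x) (norm y)"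
      have m: "m > 0" "m \<le> norm x" "m \<le> norm y" using xy by (auto simp: m_def mem_M)
      have fx: "m powr a * \<bar>f x\<bar> \<le> \<bar>C0\<bar>"
        using C0[OF xy(1)] mult_right_mono[OF powr_mono2[OF 0(3) _ m(2)], of "\<bar>f x\<bar>"] m by linarith
      have hy: "m powr b * \<bar>h y\<bar> \<le> \<bar>D0\<bar>"
        using D0[OF xy(2)] mult_right_mono[OF powr_mono2[OF 0(4) _ m(3)], of "\<bar>h y\<bar>"] m by linarith
      have le: "E * dist x y powr \<alpha> \<le> \<bar>E\<bar> * dist x y powr \<alpha>" for E
        by (intro mult_right_mono) auto
      have D': "m powr (b + \<alpha>) * \<bar>h x - h y\<bar> \<le> \<bar>D\<bar> * dist x y powr \<alpha>"
        using D[OF xy] le[of D] unfolding m_def by linarith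
      have C': "m powr (a + \<alpha>) * \<bar>f x - f y\<bar> \<le> \<bar>C\<bar> * dist x y powr \<alpha>"
        using C[OF xy] le[of C] unfolding m_def by linarith
      have "\<bar>f x * h x - f y * h y\<bar> \<le> \<bar>f x\<bar> * \<bar>h x - h y\<bar> + \<bar>f x - f y\<bar> * \<bar>h y\<bar>"
      proof -
        have "f x * h x - f y * h y = f x * (h x - h y) + (f x - f y) * h y" by (simp add: algebra_simps)
        then show ?thesis by (metis abs_mult abs_triangle_ineq)
      qed
      then have "m powr (a + b + \<alpha>) * \<bar>f x * h x - f y * h y\<bar> \<le>
          m powr (a + b + \<alpha>) * (\<bar>f x\<bar> * \<bar>h x - h y\<bar> + \<bar>f x - f y\<bar> * \<bar>h y\<bar>)"
        by (intro mult_left_mono) auto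
      also have "\<dots> = (m powr a * \<bar>f x\<bar>) * (m powr (b + \<alpha>) * \<bar>h x - h y\<bar>)
          + (m powr (a + \<alpha>) * \<bar>f x - f y\<bar>) * (m powr b * \<bar>h y\<bar>)"
        by (simp add: powr_add algebra_simps)
      also have "\<dots> \<le> \<bar>C0\<bar> * (\<bar>D\<bar> * dist x y powr \<alpha>) + (\<bar>C\<bar> * dist x y powr \<alpha>) * \<bar>D0\<bar>"
        by (rule add_mono[OF mult_mono[OF fx D'] mult_mono[OF C' hy]]) auto
      finally show ?thesis by (simp add: m_def algebra_simps)
    qed
    show ?case
      by (rule weighted_holder_0I[OF continuous_on_mult[OF f h] bd[where f = f and h = h, OF C0 D0] hol])
  next
    case (Suc k)
    note d = weighted_holder_differentiable[OF Suc.prems(1)] weighted_holder_differentiable[OF Suc.prems(2)]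
    note fh = weighted_holder_Suc_imp[OF Suc.prems(1) \<alpha> Suc.prems(3)] weighted_holder_Suc_imp[OF Suc.prems(2) \<alpha> Suc.prems(4)]
    have "(\<lambda>x. f x * pdiff M i h x) \<in> weighted_holder k \<alpha> (a + (b + 1))" for i
      using Suc.prems(3,4) by (intro Suc.IH fh weighted_holder_pdiff Suc.prems(2)) auto
    moreover have "(\<lambda>x. pdiff M i f x * h x) \<in> weighted_holder k \<alpha> ((a + 1) + b)" for i
      using Suc.prems(3,4) by (intro Suc.IH fh weighted_holder_pdiff Suc.prems(1)) auto
    ultimately have "(\<lambda>x. f x * pdiff M i h x + pdiff M i f x * h x) \<in> weighted_holder k \<alpha> (a + b + 1)" for i
      by (intro weighted_holder_add) (simp_all add: add_ac)
    then have "pdiff M i (\<lambda>x. f x * h x) \<in> weighted_holder k \<alpha> (a + b + 1)" for i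
      by (rule weighted_holder_cong) (use d in \<open>simp add: pdiff_mult differentiable_on_def\<close>)
    moreover have "\<exists>C. \<forall>x\<in>M. norm x powr (a + b) * \<bar>f x * h x\<bar> \<le> C"
      using bd[where f = f and h = h] weighted_holder_bound[OF Suc.prems(1)] weighted_holder_bound[OF Suc.prems(2)] by metis
    ultimately show ?case
      by (intro weighted_holder_SucI differentiable_on_mult d)
  qed
qed

lemma weighted_holder_cmult:
  assumes "f \<in> weighted_holder k \<alpha> a" and "0 < \<alpha>" "\<alpha> \<le> 1" and "0 \<le> a"
  shows "(\<lambda>x. c * f x) \<in> weighted_holder k \<alpha> a"
  using weighted_holder_mult[OF weighted_holder_const assms(1-3) order_refl assms(4)] by simp

lemma weighted_holder_sum:
  assumes "\<And>i. i \<in> I \<Longrightarrow> f i \<in> weighted_holder k \<alpha> a"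
  shows "(\<lambda>x. \<Sum>i\<in>I. f i x) \<in> weighted_holder k \<alpha> a"
  using assms
proof (induction I rule: infinite_finite_induct)
  case (insert i I)
  then show ?case by (simp add: weighted_holder_add)
qed (simp_all add: weighted_holder_zero)

text \<open>Since \<open>\<Phi>\<close> does not decrease the norm, the weights at
  \<open>\<Phi> x\<close> dominate those at x and no decay is lost; the Lipschitz bound carries the
  Hoelder quotient over. The chain rule multiplies by entries of \<open>A\<close>, which have rate
  0, so the rate survives every derivative.\<close>

lemma weighted_holder_compose:
  assumes f: "f \<in> weighted_holder k \<alpha> a" and \<alpha>: "0 < \<alpha>" "\<alpha> \<le> 1" and a: "0 \<le> a"
    and \<Phi>: "\<And>x. x \<in> M \<Longrightarrow> norm x \<le> norm (\<Phi> x)"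
    and L: "\<And>x y. x \<in> M \<Longrightarrow> y \<in> M \<Longrightarrow> dist (\<Phi> x) (\<Phi> y) \<le> L * dist x y"
    and d\<Phi>: "\<And>x. x \<in> M \<Longrightarrow> (\<Phi> has_derivative (\<lambda>h. A x *v h)) (at x within M)"
    and A: "\<And>i j. (\<lambda>x. A x $ i $ j) \<in> weighted_holder k \<alpha> 0"
  shows "(\<lambda>x. f (\<Phi> x)) \<in> weighted_holder k \<alpha> a"
proof -
  have \<Phi>M: "\<Phi> x \<in> M" if "x \<in> M" for x
    using \<Phi>[OF that] that by (auto simp: mem_M)
  have bd: "norm x powr b * \<bar>f (\<Phi> x)\<bar> \<le> C"
    if "\<And>x. x \<in> M \<Longrightarrow> norm x powr b * \<bar>f x\<bar> \<le> C" "x \<in> M" "0 \<le> b" for f :: "real^3 \<Rightarrow> real" and b x C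
  proof -
    have "norm x powr b * \<bar>f (\<Phi> x)\<bar> \<le> norm (\<Phi> x) powr b * \<bar>f (\<Phi> x)\<bar>"
      using that(3) \<Phi>[OF that(2)] by (intro mult_right_mono powr_mono2) auto
    with that(1)[OF \<Phi>M[OF that(2)]] show ?thesis by linarith
  qed
  have cont: "continuous_on M \<Phi>"
    using d\<Phi> by (meson continuous_on_eq_continuous_within has_derivative_continuous)
  show ?thesis
    using f a A
  proof (induction k arbitrary: f a)
    case 0
    obtain C D where f: "continuous_on M f" and C: "\<And>x. x \<in> M \<Longrightarrow> norm x powr a * \<bar>f x\<bar> \<le> C"
      and D: "\<And>x y. x \<in> M \<Longrightarrow> y \<in> M \<Longrightarrow> min (norm x) (norm y) powr (a + \<alpha>) * \<bar>f x - f y\<bar> \<le> D * dist x y powr \<alpha>"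
      by (rule weighted_holder_0E[OF 0(1)], rule that)
    show ?case
    proof (rule weighted_holder_0I)
      show "continuous_on M (\<lambda>x. f (\<Phi> x))"
        by (rule continuous_on_compose2[OF f cont]) (use \<Phi>M in blast)
      show "norm x powr a * \<bar>f (\<Phi> x)\<bar> \<le> C" if "x \<in> M" for x
        using bd[of a f C x] C that 0(2) by blast
      show "min (norm x) (norm y) powr (a + \<alpha>) * \<bar>f (\<Phi> x) - f (\<Phi> y)\<bar> \<le> (\<bar>D\<bar> * \<bar>L\<bar> powr \<alpha>) * dist x y powr \<alpha>"
        if xy: "x \<in> M" "y \<in> M" for x y
      proof -
        have "min (norm x) (norm y) powr (a + \<alpha>) * \<bar>f (\<Phi> x) - f (\<Phi> y)\<bar>
            \<le> min (norm (\<Phi> x)) (norm (\<Phi> y)) powr (a + \<alpha>) * \<bar>f (\<Phi> x) - f (\<Phi> y)\<bar>"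
          using \<Phi>[OF xy(1)] \<Phi>[OF xy(2)] \<alpha> 0(2) by (intro mult_right_mono powr_mono2) auto
        also have "\<dots> \<le> D * dist (\<Phi> x) (\<Phi> y) powr \<alpha>"
          using D \<Phi>M xy by blast
        also have "\<dots> \<le> \<bar>D\<bar> * dist (\<Phi> x) (\<Phi> y) powr \<alpha>"
          by (intro mult_right_mono) auto
        also have "\<dots> \<le> \<bar>D\<bar> * (\<bar>L\<bar> * dist x y) powr \<alpha>"
          using L[OF xy] mult_right_mono[OF abs_ge_self[of L], of "dist x y"] \<alpha>
          by (intro mult_left_mono powr_mono2) auto
        finally show ?thesis by (simp add: powr_mult)
      qed
    qed
  next
    case (Suc k)
    have fd: "(f has_derivative (\<lambda>v. \<Sum>j\<in>UNIV. v $ j * pdiff M j f y)) (at y within M)" if "y \<in> M" for y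
      using weighted_holder_differentiable[OF Suc.prems(1)] that
      by (auto intro!: has_derivative_pdiff simp: differentiable_on_def)
    have chain: "((\<lambda>x. f (\<Phi> x)) has_derivative (\<lambda>h. \<Sum>j\<in>UNIV. (A x *v h) $ j * pdiff M j f (\<Phi> x))) (at x within M)"
      if "x \<in> M" for x
      by (rule has_derivative_in_compose2[OF fd _ that d\<Phi>[OF that]]) (use \<Phi>M in auto)
    have A': "(\<lambda>x. A x $ i $ j) \<in> weighted_holder k \<alpha> 0" for i j
      by (rule weighted_holder_Suc_imp[OF Suc.prems(3) \<alpha>]) simp
    have "(\<lambda>x. pdiff M j f (\<Phi> x)) \<in> weighted_holder k \<alpha> (a + 1)" for j
      using Suc.prems(2) by (intro Suc.IH weighted_holder_pdiff Suc.prems(1) A') auto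
    then have "(\<lambda>x. A x $ j $ i * pdiff M j f (\<Phi> x)) \<in> weighted_holder k \<alpha> (0 + (a + 1))" for i j
      using Suc.prems(2) by (intro weighted_holder_mult A' \<alpha>) auto
    then have "(\<lambda>x. \<Sum>j\<in>UNIV. A x $ j $ i * pdiff M j f (\<Phi> x)) \<in> weighted_holder k \<alpha> (a + 1)" for i
      by (intro weighted_holder_sum) simp
    then have "pdiff M i (\<lambda>x. f (\<Phi> x)) \<in> weighted_holder k \<alpha> (a + 1)" for i
      by (rule weighted_holder_cong)
        (simp add: pdiff_M[OF _ chain] matrix_vector_mult_basis column_def)
    moreover have "(\<lambda>x. f (\<Phi> x)) differentiable_on M"
      using chain differentiableI differentiable_on_def by blast
    moreover have "\<exists>C. \<forall>x\<in>M. norm x powr a * \<bar>f (\<Phi> x)\<bar> \<le> C"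
      using bd[where f = f and b = a] weighted_holder_bound[OF Suc.prems(1)] Suc.prems(2) by metis
    ultimately show ?case by (intro weighted_holder_SucI)
  qed
qed

section \<open>Exponentials and powers of the radius in weighted spaces\<close>

lemma has_derivative_pdiff_M:
  assumes "f differentiable_on M" "x \<in> M"
  shows "(f has_derivative (\<lambda>v. \<Sum>i\<in>UNIV. v $ i * pdiff M i f x)) (at x within M)"
  using assms by (auto intro!: has_derivative_pdiff simp: differentiable_on_def)

lemma abs_exp_minus_one_le:
  fixes t :: real
  shows "\<bar>exp t - 1\<bar> \<le> \<bar>t\<bar> * exp \<bar>t\<bar>"
proof (cases "t \<ge> 0")
  case True
  have "exp t - 1 = exp t * (1 - exp (- t))" by (simp add: algebra_simps exp_minus)
  also have "\<dots> \<le> exp t * t"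
    using exp_ge_add_one_self[of "- t"] by (intro mult_left_mono) auto
  finally show ?thesis using True by (simp add: mult_ac)
next
  case False
  have "1 - exp t \<le> \<bar>t\<bar> * 1" using exp_ge_add_one_self[of t] False by linarith
  also have "\<dots> \<le> \<bar>t\<bar> * exp \<bar>t\<bar>" by (intro mult_left_mono) auto
  finally show ?thesis using False by simp
qed

text \<open>The gradient of exp h is exp h times the gradient of h, so membership of the exponential
  at order \<open>k\<close> yields order \<open>Suc k\<close>. The exponential itself does not
  decay, hence rate 0.\<close>

lemma weighted_holder_exp:
  assumes \<alpha>: "0 < \<alpha>" "\<alpha> \<le> 1" and h: "\<And>k. h \<in> weighted_holder k \<alpha> 0"
  shows "(\<lambda>x. exp (h x)) \<in> weighted_holder k \<alpha> 0"
proof -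
  note dh = has_derivative_pdiff_M[OF weighted_holder_differentiable[OF h]]
  have de: "((\<lambda>x. exp (h x)) has_derivative (\<lambda>v. exp (h x) * (\<Sum>i\<in>UNIV. v $ i * pdiff M i h x))) (at x within M)"
    if "x \<in> M" for x
    using has_derivative_exp[OF dh[OF that]] by (simp add: mult_ac)
  have pe: "pdiff M i (\<lambda>x. exp (h x)) x = exp (h x) * pdiff M i h x" if "x \<in> M" for x i
    by (simp add: pdiff_M[OF that de[OF that]] sum_axis)
  have d: "(\<lambda>x. exp (h x)) differentiable_on M"
    using de differentiableI differentiable_on_def by blast
  obtain C where C: "\<And>x. x \<in> M \<Longrightarrow> norm x powr 0 * \<bar>h x\<bar> \<le> C"
    using weighted_holder_bound[OF h] by metis
  have eC: "exp (h x) \<le> exp C" if "x \<in> M" for x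
  proof -
    have "x \<noteq> 0" using that by (auto simp: mem_M)
    then have "h x \<le> C" using C[OF that] by simp
    then show ?thesis by simp
  qed
  then have bd: "\<exists>C. \<forall>x\<in>M. norm x powr 0 * \<bar>exp (h x)\<bar> \<le> C"
    by (intro exI[of _ "exp C"]) (auto simp: mem_M)
  show ?thesis
  proof (induction k)
    case 0
    show ?case
    proof (rule weighted_holder_0_gradient[OF d \<alpha> _ bd])
      fix i
      obtain D where D: "\<And>x. x \<in> M \<Longrightarrow> norm x powr (0 + 1) * \<bar>pdiff M i h x\<bar> \<le> D"
        using weighted_holder_bound[OF weighted_holder_pdiff[OF h]] by metis
      have "norm x powr (0 + 1) * \<bar>pdiff M i (\<lambda>x. exp (h x)) x\<bar> \<le> exp C * \<bar>D\<bar>" if "x \<in> M" for x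
      proof -
        have "norm x powr (0 + 1) * \<bar>pdiff M i (\<lambda>x. exp (h x)) x\<bar> = exp (h x) * (norm x powr (0 + 1) * \<bar>pdiff M i h x\<bar>)"
          by (simp add: pe[OF that] abs_mult)
        also have "\<dots> \<le> exp C * \<bar>D\<bar>"
          by (rule mult_mono[OF eC[OF that] order_trans[OF D[OF that] abs_ge_self]]) auto
        finally show ?thesis .
      qed
      then show "\<exists>C. \<forall>x\<in>M. norm x powr (0 + 1) * \<bar>pdiff M i (\<lambda>x. exp (h x)) x\<bar> \<le> C" by blast
    qed simp
  next
    case (Suc k)
    have "(\<lambda>x. exp (h x) * pdiff M i h x) \<in> weighted_holder k \<alpha> (0 + (0 + 1))" for i
      by (intro weighted_holder_mult Suc weighted_holder_pdiff h \<alpha>) auto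
    then have "pdiff M i (\<lambda>x. exp (h x)) \<in> weighted_holder k \<alpha> (0 + 1)" for i
      by (simp add: weighted_holder_cong[OF _ pe[symmetric]])
    then show ?case by (intro weighted_holder_SucI d bd)
  qed
qed

text \<open>Subtracting 1 restores the rate of h: \<open>abs_exp_minus_one_le\<close> gives it for
  the function, and the derivatives inherit it from the factor \<open>pdiff M i h\<close>.\<close>

lemma weighted_holder_exp_minus_one:
  assumes \<alpha>: "0 < \<alpha>" "\<alpha> \<le> 1" and a: "0 \<le> a" and h: "\<And>k. h \<in> weighted_holder k \<alpha> a"
  shows "(\<lambda>x. exp (h x) - 1) \<in> weighted_holder k \<alpha> a"
proof -
  have h0: "h \<in> weighted_holder k \<alpha> 0" for k
    by (rule weighted_holder_mono[OF h a \<alpha>(1)])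
  note e = weighted_holder_exp[OF \<alpha> h0]
  note dh = has_derivative_pdiff_M[OF weighted_holder_differentiable[OF h]]
  have de: "((\<lambda>x. exp (h x) - 1) has_derivative (\<lambda>v. exp (h x) * (\<Sum>i\<in>UNIV. v $ i * pdiff M i h x) - 0)) (at x within M)"
    if "x \<in> M" for x
    using has_derivative_diff[OF has_derivative_exp[OF dh[OF that]] has_derivative_const] by (simp add: mult_ac)
  have pe: "pdiff M i (\<lambda>x. exp (h x) - 1) x = exp (h x) * pdiff M i h x" if "x \<in> M" for x i
    by (simp add: pdiff_M[OF that de[OF that]] sum_axis)
  have d: "(\<lambda>x. exp (h x) - 1) differentiable_on M"
    using de differentiableI differentiable_on_def by blast
  obtain C where C: "\<And>x. x \<in> M \<Longrightarrow> norm x powr a * \<bar>h x\<bar> \<le> C"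
    using weighted_holder_bound[OF h] by metis
  have "norm x powr a * \<bar>exp (h x) - 1\<bar> \<le> \<bar>C\<bar> * exp C" if x: "x \<in> M" for x
  proof -
    have "1 * \<bar>h x\<bar> \<le> norm x powr a * \<bar>h x\<bar>"
      using x a by (intro mult_right_mono) (auto simp: mem_M ge_one_powr_ge_zero)
    then have hC: "\<bar>h x\<bar> \<le> C" using C[OF x] by linarith
    have "norm x powr a * \<bar>exp (h x) - 1\<bar> \<le> norm x powr a * (\<bar>h x\<bar> * exp \<bar>h x\<bar>)"
      by (intro mult_left_mono abs_exp_minus_one_le) simp
    also have "\<dots> = (norm x powr a * \<bar>h x\<bar>) * exp \<bar>h x\<bar>" by simp
    also have "\<dots> \<le> \<bar>C\<bar> * exp C"
      by (rule mult_mono[OF order_trans[OF C[OF x] abs_ge_self]]) (use hC in auto)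
    finally show ?thesis .
  qed
  then have bd: "\<exists>C. \<forall>x\<in>M. norm x powr a * \<bar>exp (h x) - 1\<bar> \<le> C" by blast
  have "(\<lambda>x. exp (h x) * pdiff M i h x) \<in> weighted_holder j \<alpha> (0 + (a + 1))" for i j
    using a by (intro weighted_holder_mult e weighted_holder_pdiff h \<alpha>) auto
  then have "pdiff M i (\<lambda>x. exp (h x) - 1) \<in> weighted_holder j \<alpha> (a + 1)" for i j
    by (simp add: weighted_holder_cong[OF _ pe[symmetric]])
  \<comment> \<open>Order \<open>Suc k\<close> comes straight from the gradient; dropping one order
    then covers every order including 0, without an induction.\<close>
  then have "(\<lambda>x. exp (h x) - 1) \<in> weighted_holder (Suc k) \<alpha> a"
    by (intro weighted_holder_SucI d bd)
  then show ?thesis by (rule weighted_holder_Suc_imp[OF _ \<alpha> a])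
qed

lemma has_derivative_norm_powr:
  fixes x :: "real^3"
  assumes "x \<noteq> 0"
  shows "((\<lambda>y. norm y powr b) has_derivative (\<lambda>h. b * norm x powr (b - 2) * (x \<bullet> h))) (at x within S)"
proof -
  have n: "(norm has_derivative (\<lambda>h. x \<bullet> h / norm x)) (at x within S)"
    using has_derivative_at_withinI[OF has_derivative_norm[OF assms]] by (simp add: sgn_div_norm divide_inverse mult.commute inner_commute)
  have "((\<lambda>y. norm y powr b) has_derivative (\<lambda>h. norm x powr b * (0 * ln (norm x) + x \<bullet> h / norm x * b / norm x))) (at x within insert x S)"
    using assms n by (intro has_derivative_powr has_derivative_const) (auto intro: has_derivative_at_withinI simp: at_within_def)
  then have "((\<lambda>y. norm y powr b) has_derivative (\<lambda>h. norm x powr b * (0 * ln (norm x) + x \<bullet> h / norm x * b / norm x))) (at x within S)"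
    by (rule has_derivative_subset) auto
  moreover have "norm x powr b * (0 * ln (norm x) + x \<bullet> h / norm x * b / norm x) = b * norm x powr (b - 2) * (x \<bullet> h)" for h
  proof -
    have "norm x powr (b - 2) = norm x powr b / (norm x)\<^sup>2"
      using assms by (simp add: powr_diff powr_numeral)
    then show ?thesis by (simp add: power2_eq_square)
  qed
  ultimately show ?thesis by simp
qed

text \<open>Powers of the norm (\<open>p\<close>) and direction cosines (\<open>q\<close>) form a
  system closed under differentiation: a derivative of \<open>p a\<close> is a multiple of
  \<open>p (a + 1)\<close> times a cosine, and one of \<open>q j\<close> is \<open>p 1\<close> times
  a polynomial in cosines. Hence both are treated in one induction.\<close>

lemma weighted_holder_radial:
  assumes \<alpha>: "0 < \<alpha>" "\<alpha> \<le> 1"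
  shows "0 \<le> a \<Longrightarrow> (\<lambda>x. norm x powr - a) \<in> weighted_holder k \<alpha> a"
    and "(\<lambda>x. norm x powr - 1 * x $ i) \<in> weighted_holder k \<alpha> 0"
proof -
  define p where "p a x = norm (x :: real^3) powr - a" for a x
  define q where "q i x = norm x powr - 1 * x $ i" for i and x :: "real^3"
  have x0: "x \<noteq> 0" if "x \<in> M" for x using that by (auto simp: mem_M)
  have dp: "(p a has_derivative (\<lambda>h. - a * norm x powr (- a - 2) * (x \<bullet> h))) (at x within M)" if "x \<in> M" for a x
    unfolding p_def by (rule has_derivative_norm_powr[OF x0[OF that]])
  have dq: "(q i has_derivative (\<lambda>h. norm x powr - 1 * h $ i + - 1 * norm x powr (- 1 - 2) * (x \<bullet> h) * x $ i)) (at x within M)"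
    if "x \<in> M" for i x
    unfolding q_def
    by (intro has_derivative_mult has_derivative_norm_powr x0 that bounded_linear_imp_has_derivative bounded_linear_vec_nth)
  have pp: "pdiff M i (p a) x = (- a) * (p (a + 1) x * q i x)" if "x \<in> M" for i a x
  proof -
    have "norm x powr (- a - 2) = norm x powr - (a + 1) * norm x powr - 1"
      unfolding powr_add[symmetric] by (rule arg_cong[of _ _ "\<lambda>t. norm x powr t"]) simp
    then show ?thesis by (simp add: pdiff_M[OF that dp[OF that]] p_def q_def inner_axis)
  qed
  have pq: "pdiff M i (q j) x = (if i = j then 1 else 0) * p 1 x + (- 1) * (p 1 x * (q i x * q j x))" if "x \<in> M" for i j x
  proof -
    have "norm x powr (- 3) = p 1 x * (p 1 x * p 1 x)"
      unfolding p_def powr_add[symmetric] by simp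
    then show ?thesis
      by (simp add: pdiff_M[OF that dq[OF that]] q_def inner_axis p_def) (simp add: axis_def)
  qed
  have dp': "p a differentiable_on M" and dq': "q i differentiable_on M" for a i
    using dp dq differentiableI differentiable_on_def by blast+
  have q1: "\<bar>q i x\<bar> \<le> 1" if "x \<in> M" for i x
    using x0[OF that] component_le_norm_cart[of x i] by (simp add: q_def abs_mult powr_minus field_simps)
  have pb: "norm x powr a * p a x = 1" if "x \<in> M" for a x
    using x0[OF that] by (simp add: p_def powr_add[symmetric])
  have p0: "p a x \<ge> 0" for a x by (simp add: p_def)
  have bp: "\<exists>C. \<forall>x\<in>M. norm x powr a * \<bar>p a x\<bar> \<le> C" for a
    by (intro exI[of _ 1]) (auto simp: pb p0)
  have bq: "\<exists>C. \<forall>x\<in>M. norm x powr 0 * \<bar>q i x\<bar> \<le> C" for i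
    by (intro exI[of _ 1]) (auto simp: q1 x0)
  have "(0 \<le> a \<longrightarrow> p a \<in> weighted_holder k \<alpha> a) \<and> q i \<in> weighted_holder k \<alpha> 0" for a i
  proof (induction k arbitrary: a i)
    case 0
    have "p a \<in> weighted_holder 0 \<alpha> a" if "0 \<le> a"
    proof (rule weighted_holder_0_gradient[OF dp' \<alpha> that bp])
      fix i
      have "norm x powr (a + 1) * \<bar>pdiff M i (p a) x\<bar> \<le> \<bar>a\<bar>" if x: "x \<in> M" for x
      proof -
        have "norm x powr (a + 1) * \<bar>pdiff M i (p a) x\<bar> = (norm x powr (a + 1) * p (a + 1) x) * (\<bar>a\<bar> * \<bar>q i x\<bar>)"
          by (simp add: pp[OF x] abs_mult p0)
        also have "\<dots> \<le> \<bar>a\<bar>" using q1[OF x] by (simp add: pb[OF x] mult_left_le)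
        finally show ?thesis .
      qed
      then show "\<exists>C. \<forall>x\<in>M. norm x powr (a + 1) * \<bar>pdiff M i (p a) x\<bar> \<le> C" by blast
    qed
    moreover have "q i \<in> weighted_holder 0 \<alpha> 0"
    proof (rule weighted_holder_0_gradient[OF dq' \<alpha> order_refl bq])
      fix j
      have "norm x powr (0 + 1) * \<bar>pdiff M j (q i) x\<bar> \<le> 2" if x: "x \<in> M" for x
      proof -
        have "pdiff M j (q i) x = p 1 x * ((if j = i then 1 else 0) - q j x * q i x)"
          by (simp add: pq[OF x] algebra_simps)
        then have "norm x powr (0 + 1) * \<bar>pdiff M j (q i) x\<bar> = (norm x powr 1 * p 1 x) * \<bar>(if j = i then 1 else 0) - q j x * q i x\<bar>"
          by (simp add: abs_mult p0)
        also have "\<dots> = \<bar>(if j = i then 1 else 0) - q j x * q i x\<bar>" by (simp only: pb[OF x] mult_1)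
        also have "\<dots> \<le> 1 + \<bar>q j x\<bar> * \<bar>q i x\<bar>" 
          using abs_triangle_ineq4[of "if j = i then 1 else 0" "q j x * q i x"] by (auto simp: abs_mult)
        also have "\<dots> \<le> 1 + 1 * 1" using q1[OF x] by (intro add_mono mult_mono) auto
        finally show ?thesis by simp
      qed
      then show "\<exists>C. \<forall>x\<in>M. norm x powr (0 + 1) * \<bar>pdiff M j (q i) x\<bar> \<le> C" by blast
    qed
    ultimately show ?case by blast
  next
    case (Suc k)
    have P: "p a \<in> weighted_holder k \<alpha> a" if "0 \<le> a" for a using Suc that by blast
    have Q: "q i \<in> weighted_holder k \<alpha> 0" for i using Suc by blast
    have "p a \<in> weighted_holder (Suc k) \<alpha> a" if a: "0 \<le> a"
    proof (rule weighted_holder_SucI[OF dp' bp])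
      fix i
      have "(\<lambda>x. (- a) * (p (a + 1) x * q i x)) \<in> weighted_holder k \<alpha> ((a + 1) + 0)"
        using a by (intro weighted_holder_cmult weighted_holder_mult P Q \<alpha>) auto
      then show "pdiff M i (p a) \<in> weighted_holder k \<alpha> (a + 1)"
        by (simp add: weighted_holder_cong[OF _ pp[symmetric]])
    qed
    moreover have "q i \<in> weighted_holder (Suc k) \<alpha> 0"
    proof (rule weighted_holder_SucI[OF dq' bq])
      fix j
      have "(\<lambda>x. (if j = i then 1 else 0) * p 1 x + (- 1) * (p 1 x * (q j x * q i x))) \<in> weighted_holder k \<alpha> 1"
      proof (rule weighted_holder_add)
        show "(\<lambda>x. (if j = i then 1 else 0) * p 1 x) \<in> weighted_holder k \<alpha> 1"
          by (intro weighted_holder_cmult P \<alpha>) auto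
        have "(\<lambda>x. (- 1) * (p 1 x * (q j x * q i x))) \<in> weighted_holder k \<alpha> (1 + (0 + 0))"
          by (intro weighted_holder_cmult weighted_holder_mult P Q \<alpha>) auto
        then show "(\<lambda>x. (- 1) * (p 1 x * (q j x * q i x))) \<in> weighted_holder k \<alpha> 1" by simp
      qed
      then show "pdiff M j (q i) \<in> weighted_holder k \<alpha> (0 + 1)"
        by (intro weighted_holder_cong[OF _ pq[symmetric]]) auto
    qed
    ultimately show ?case by blast
  qed
  then show "0 \<le> a \<Longrightarrow> (\<lambda>x. norm x powr - a) \<in> weighted_holder k \<alpha> a"
    and "(\<lambda>x. norm x powr - 1 * x $ i) \<in> weighted_holder k \<alpha> 0"
    unfolding p_def q_def by blast+
qed

section \<open>Derivatives of vector and matrix fields\<close>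

lemma has_derivative_vec:
  fixes f :: "'a::real_normed_vector \<Rightarrow> 'b::euclidean_space^'n"
  assumes "\<And>i. ((\<lambda>x. f x $ i) has_derivative (\<lambda>h. f' h $ i)) (at x within S)"
  shows "(f has_derivative f') (at x within S)"
proof (subst has_derivative_componentwise_within, safe)
  fix b :: "'b^'n" assume "b \<in> Basis"
  then obtain i u where b: "b = axis i u" "u \<in> Basis" by (auto simp: Basis_vec_def)
  have "((\<lambda>x. f x $ i \<bullet> u) has_derivative (\<lambda>h. f' h $ i \<bullet> u)) (at x within S)"
    by (rule has_derivative_inner_left[OF assms])
  then show "((\<lambda>x. f x \<bullet> b) has_derivative (\<lambda>h. f' h \<bullet> b)) (at x within S)"
    by (simp add: b inner_axis)
qed

lemma has_derivative_vec_nth: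
  "(f has_derivative f') (at x within S) \<Longrightarrow> ((\<lambda>x. f x $ i) has_derivative (\<lambda>h. f' h $ i)) (at x within S)"
  by (rule bounded_linear.has_derivative[OF bounded_linear_vec_nth])

lemma bounded_bilinear_matrix_vector_mult:
  "bounded_bilinear (\<lambda>(A :: real^'n^'m) (v :: real^'n). A *v v)"
  unfolding bilinear_conv_bounded_bilinear[symmetric] bilinear_def
  by (auto intro!: linearI simp: matrix_vector_mult_add_rdistrib matrix_vector_right_distrib
      matrix_vector_mult_scaleR scaleR_matrix_vector_assoc)

lemmas has_derivative_matrix_vector_mult =
  bounded_bilinear.FDERIV[OF bounded_bilinear_matrix_vector_mult]

lemma matrix_entry_inner: "(A :: real^'n^'m) $ i $ j = axis i 1 \<bullet> (A *v axis j 1)"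
  by (simp add: inner_axis' matrix_vector_mult_basis column_def)

lemma symmetric_inner:
  fixes A :: "real^'n^'n"
  assumes "transpose A = A"
  shows "v \<bullet> (A *v w) = w \<bullet> (A *v v)"
proof -
  have "v \<bullet> (A *v w) = (transpose A *v v) \<bullet> w" by (simp add: dot_lmul_matrix)
  also have "\<dots> = w \<bullet> (A *v v)" by (simp only: assms inner_commute)
  finally show ?thesis .
qed

section \<open>Curvature in coordinate-free form\<close>

locale C2_metric =
  fixes g :: metric
  assumes riem: "riemannian g"
    and d1: "\<And>i j. (\<lambda>x. g x $ i $ j) differentiable_on M"
    and d2: "\<And>i j k. pdiff M k (\<lambda>x. g x $ i $ j) differentiable_on M"

definition dmet :: "metric \<Rightarrow> real^3 \<Rightarrow> real^3 \<Rightarrow> real^3^3" where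
  "dmet g x u = (\<chi> i j. \<Sum>k\<in>UNIV. u $ k * pdiff M k (\<lambda>y. g y $ i $ j) x)"

text \<open>Inserting vectors into the Christoffel symbols turns index identities into vector
  identities, where bilinearity takes care of the sums.\<close>

definition Gam :: "metric \<Rightarrow> real^3 \<Rightarrow> real^3 \<Rightarrow> real^3 \<Rightarrow> real^3" where
  "Gam g x v w = (\<chi> k. \<Sum>i\<in>UNIV. \<Sum>j\<in>UNIV. v $ i * w $ j * christoffel g k i j x)"

definition dGam :: "metric \<Rightarrow> real^3 \<Rightarrow> real^3 \<Rightarrow> real^3 \<Rightarrow> real^3 \<Rightarrow> real^3" where
  "dGam g x u v w = (\<chi> k. \<Sum>i\<in>UNIV. \<Sum>j\<in>UNIV. v $ i * w $ j *
     (\<Sum>l\<in>UNIV. u $ l * pdiff M l (christoffel g k i j) x))"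

text \<open>The curvature operator R(u,v)w. The order of the arguments copies the index order in
  \<open>ricci\<close>, so that \<open>ricci_eq_Ric\<close> holds at every point without using
  symmetry of the Christoffel symbols; \<open>Riem_eq\<close> restores the usual order on
  \<open>M\<close>.\<close>

definition Riem :: "metric \<Rightarrow> real^3 \<Rightarrow> real^3 \<Rightarrow> real^3 \<Rightarrow> real^3 \<Rightarrow> real^3" where
  "Riem g x u v w = dGam g x u w v - dGam g x v w u + Gam g x u (Gam g x w v) - Gam g x v (Gam g x w u)"

definition Ric :: "metric \<Rightarrow> real^3 \<Rightarrow> real^3 \<Rightarrow> real^3 \<Rightarrow> real" where
  "Ric g x v w = (\<Sum>k\<in>UNIV. Riem g x (axis k 1) v w $ k)"

lemma linear_Gam: "linear (\<lambda>v. Gam g x v w)" "linear (Gam g x v)"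
  by (auto intro!: linearI simp: Gam_def vec_eq_iff algebra_simps sum.distrib sum_distrib_left)

lemma linear_dGam: "linear (\<lambda>u. dGam g x u v w)" "linear (\<lambda>v. dGam g x u v w)" "linear (dGam g x u v)"
  by (auto intro!: linearI simp: dGam_def vec_eq_iff algebra_simps sum.distrib sum_distrib_left)

lemmas Gam_simps = linear_add[OF linear_Gam(1)] linear_add[OF linear_Gam(2)]
  linear_diff[OF linear_Gam(1)] linear_diff[OF linear_Gam(2)]
  linear_scale[OF linear_Gam(1)] linear_scale[OF linear_Gam(2)]

lemmas dGam_simps = linear_add[OF linear_dGam(1)] linear_add[OF linear_dGam(2)] linear_add[OF linear_dGam(3)]
  linear_scale[OF linear_dGam(1)] linear_scale[OF linear_dGam(2)] linear_scale[OF linear_dGam(3)]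

lemma linear_Riem:
  "linear (\<lambda>u. Riem g x u v w)" "linear (\<lambda>v. Riem g x u v w)" "linear (Riem g x u v)"
  by (auto intro!: linearI simp: Riem_def dGam_simps Gam_simps algebra_simps)

lemma linear_Ric: "linear (\<lambda>v. Ric g x v w)" "linear (Ric g x v)"
  by (auto intro!: linearI simp: Ric_def linear_add[OF linear_Riem(2)] linear_add[OF linear_Riem(3)]
      linear_scale[OF linear_Riem(2)] linear_scale[OF linear_Riem(3)] sum.distrib sum_distrib_left)

lemma dGam_axis: "dGam g x (axis l 1) (axis i 1) (axis j 1) $ k = pdiff M l (christoffel g k i j) x"
  by (simp add: dGam_def mult.assoc sum_distrib_left[symmetric] sum_axis)

lemma Gam_axis1: "Gam g x (axis i 1) w $ k = (\<Sum>l\<in>UNIV. w $ l * christoffel g k i l x)"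
  by (simp add: Gam_def mult.assoc sum_distrib_left[symmetric] sum_axis)

lemma ricci_eq_Ric: "ricci g i j x = Ric g x (axis j 1) (axis i 1)"
  by (simp add: ricci_def Ric_def Riem_def dGam_axis Gam_axis1 sum_axis sum.distrib sum_subtractf mult.commute)

lemma scalar_curvature_eq_Ric:
  "scalar_curvature g x = (\<Sum>i\<in>UNIV. \<Sum>j\<in>UNIV. matrix_inv (g x) $ i $ j * Ric g x (axis j 1) (axis i 1))"
  by (simp add: scalar_curvature_def ricci_eq_Ric ginv_def)

section \<open>Inverse matrices\<close>

lemma matrix_inv_mult:
  assumes "invertible A"
  shows "A ** matrix_inv A = mat 1" "matrix_inv A ** A = mat 1"
proof -
  have "A ** matrix_inv A = mat 1 \<and> matrix_inv A ** A = mat 1"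
    unfolding matrix_inv_def by (rule someI_ex[OF assms[unfolded invertible_def]])
  then show "A ** matrix_inv A = mat 1" "matrix_inv A ** A = mat 1" by (rule conjunct1, rule conjunct2)
qed

lemma matrix_inv_unique:
  fixes A :: "real^'n^'n"
  assumes "A ** B = mat 1"
  shows "B ** A = mat 1" "matrix_inv A = B"
proof -
  show BA: "B ** A = mat 1" using assms matrix_left_right_inverse by blast
  then have "invertible A" using assms invertible_def by blast
  then have "matrix_inv A ** A = mat 1" by (rule matrix_inv_mult)
  then have "(matrix_inv A ** A) ** B = B" by simp
  then show "matrix_inv A = B" by (simp add: matrix_mul_assoc[symmetric] assms)
qed

definition adjugate3 :: "real^3^3 \<Rightarrow> real^3^3" where
  "adjugate3 A = vector [
    vector [A$2$2 * A$3$3 - A$2$3 * A$3$2, A$1$3 * A$3$2 - A$1$2 * A$3$3, A$1$2 * A$2$3 - A$1$3 * A$2$2],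
    vector [A$2$3 * A$3$1 - A$2$1 * A$3$3, A$1$1 * A$3$3 - A$1$3 * A$3$1, A$1$3 * A$2$1 - A$1$1 * A$2$3],
    vector [A$2$1 * A$3$2 - A$2$2 * A$3$1, A$1$2 * A$3$1 - A$1$1 * A$3$2, A$1$1 * A$2$2 - A$1$2 * A$2$1]]"

text \<open>The cofactor formula shows the entries of the inverse to be rational in those of
  \<open>A\<close>; this is how the inverse metric, and with it the Christoffel symbols, are seen to
  be differentiable.\<close>

lemma matrix_inv_3:
  assumes "det A \<noteq> 0"
  shows "matrix_inv A = (1 / det A) *\<^sub>R adjugate3 A"
proof -
  have "A ** adjugate3 A = det A *\<^sub>R mat 1"
    by (simp add: adjugate3_def vec_eq_iff forall_3 matrix_matrix_mult_def sum_3 det_3 mat_def algebra_simps)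
  then have "A ** ((1 / det A) *\<^sub>R adjugate3 A) = mat 1"
    using assms by (simp add: matrix_scalar_ac scalar_matrix_assoc[symmetric])
  then show ?thesis by (rule matrix_inv_unique)
qed

section \<open>The Levi-Civita connection of a twice differentiable metric\<close>

context C2_metric begin

lemma sym: "x \<in> M \<Longrightarrow> transpose (g x) = g x"
  using riem by (auto simp: riemannian_def)

lemma pos: "x \<in> M \<Longrightarrow> v \<noteq> 0 \<Longrightarrow> v \<bullet> (g x *v v) > 0"
  using riem by (auto simp: riemannian_def)

lemma inner_g_commute: "x \<in> M \<Longrightarrow> v \<bullet> (g x *v w) = w \<bullet> (g x *v v)"
  using symmetric_inner[OF sym] .

lemma g_entry_commute: "x \<in> M \<Longrightarrow> g x $ i $ j = g x $ j $ i"
  by (simp only: matrix_entry_inner inner_g_commute)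

lemma inv_g: "x \<in> M \<Longrightarrow> invertible (g x)"
proof -
  assume x: "x \<in> M"
  have "v = 0" if "g x *v v = 0" for v
    using pos[OF x, of v] that by auto
  then have "\<exists>B. B ** g x = mat 1" by (simp add: matrix_left_invertible_ker)
  then show "invertible (g x)" by (simp add: invertible_left_inverse)
qed

lemma g_ginv: "x \<in> M \<Longrightarrow> g x ** matrix_inv (g x) = mat 1"
  and ginv_g: "x \<in> M \<Longrightarrow> matrix_inv (g x) ** g x = mat 1"
  using inv_g by (auto simp: matrix_inv_mult)

lemma g_ginv_v: "x \<in> M \<Longrightarrow> g x *v (matrix_inv (g x) *v v) = v"
  and ginv_g_v: "x \<in> M \<Longrightarrow> matrix_inv (g x) *v (g x *v v) = v"
  by (simp_all add: matrix_vector_mul_assoc g_ginv ginv_g)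

lemma ginv_inner_commute: "x \<in> M \<Longrightarrow> v \<bullet> (matrix_inv (g x) *v w) = w \<bullet> (matrix_inv (g x) *v v)"
  using inner_g_commute[of x "matrix_inv (g x) *v v" "matrix_inv (g x) *v w"]
  by (simp add: g_ginv_v inner_commute)

lemma ginv_commute: "x \<in> M \<Longrightarrow> matrix_inv (g x) $ i $ j = matrix_inv (g x) $ j $ i"
  by (simp only: matrix_entry_inner ginv_inner_commute)

lemma g_eqI:
  assumes "x \<in> M" "\<And>z. v \<bullet> (g x *v z) = w \<bullet> (g x *v z)"
  shows "v = w"
  using pos[OF assms(1), of "v - w"] assms(2)[of "v - w"] by (auto simp: inner_diff_left)

lemma g_derivative: "x \<in> M \<Longrightarrow> (g has_derivative dmet g x) (at x within M)"
  using has_derivative_pdiff_M[OF d1] by (intro has_derivative_vec) (simp add: dmet_def)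

lemma dmet_unique:
  assumes "x \<in> M" "((\<lambda>y. v \<bullet> (g y *v w)) has_derivative F) (at x within M)"
  shows "F u = v \<bullet> (dmet g x u *v w)"
proof -
  have "((\<lambda>y. v \<bullet> (g y *v w)) has_derivative (\<lambda>u. v \<bullet> (dmet g x u *v w))) (at x within M)"
    using has_derivative_inner_right[OF has_derivative_matrix_vector_mult[OF g_derivative[OF assms(1)] has_derivative_const]]
    by simp
  then show ?thesis using M_derivative_unique[OF assms] by metis
qed

lemma dmet_commute:
  assumes "x \<in> M"
  shows "v \<bullet> (dmet g x u *v w) = w \<bullet> (dmet g x u *v v)"
proof -
  have "dmet g x u $ i $ j = dmet g x u $ j $ i" for i j
    using pdiff_cong[of "\<lambda>y. g y $ i $ j" "\<lambda>y. g y $ j $ i"] assms d1[of i j] g_entry_commute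
    by (simp add: dmet_def differentiable_on_def)
  then have "transpose (dmet g x u) = dmet g x u" by (simp add: vec_eq_iff transpose_def)
  then show ?thesis by (rule symmetric_inner)
qed

text \<open>Pairing with z through g removes the inverse metric from the definition of the
  Christoffel symbols, so connections can be compared without inverting matrices.\<close>

lemma koszul:
  assumes x: "x \<in> M"
  shows "2 * (z \<bullet> (g x *v Gam g x v w)) =
    w \<bullet> (dmet g x v *v z) + v \<bullet> (dmet g x w *v z) - v \<bullet> (dmet g x z *v w)"
proof -
  define c where "c i j l = pdiff M i (\<lambda>y. g y $ j $ l) x + pdiff M j (\<lambda>y. g y $ i $ l) x - pdiff M l (\<lambda>y. g y $ i $ j) x" for i j l
  define a :: "real^3" where "a = (\<chi> l. \<Sum>i\<in>UNIV. \<Sum>j\<in>UNIV. v $ i * w $ j * c i j l)"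
  have "2 *\<^sub>R Gam g x v w = matrix_inv (g x) *v a"
  proof (subst vec_eq_iff, rule allI)
    fix k
    have chr: "2 * christoffel g k i j x = (\<Sum>l\<in>UNIV. matrix_inv (g x) $ k $ l * c i j l)" for i j
      by (simp add: christoffel_def ginv_def c_def)
    have "(2 *\<^sub>R Gam g x v w) $ k = (\<Sum>i\<in>UNIV. \<Sum>j\<in>UNIV. v $ i * w $ j * (2 * christoffel g k i j x))"
      by (simp add: Gam_def sum_distrib_left mult_ac)
    also have "\<dots> = (matrix_inv (g x) *v a) $ k"
      by (simp add: chr a_def matrix_vector_mult_def sum_3 algebra_simps)
    finally show "(2 *\<^sub>R Gam g x v w) $ k = (matrix_inv (g x) *v a) $ k" .
  qed
  then have "g x *v (2 *\<^sub>R Gam g x v w) = a" by (simp add: g_ginv_v[OF x])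
  then have "2 * (z \<bullet> (g x *v Gam g x v w)) = z \<bullet> a"
    by (simp add: matrix_vector_mult_scaleR flip: inner_scaleR_right)
  also have "\<dots> = w \<bullet> (dmet g x v *v z) + v \<bullet> (dmet g x w *v z) - v \<bullet> (dmet g x z *v w)"
    by (simp add: a_def c_def inner_vec_def matrix_vector_mult_def dmet_def sum_3 algebra_simps)
  finally show ?thesis .
qed

text \<open>The way in which connections of modified metrics are found: a candidate \<open>V\<close>
  only has to satisfy the Koszul formula, because g is positive definite.\<close>

lemma Gam_unique:
  assumes x: "x \<in> M"
    and "\<And>z. 2 * (z \<bullet> (g x *v V)) = w \<bullet> (dmet g x v *v z) + v \<bullet> (dmet g x w *v z) - v \<bullet> (dmet g x z *v w)"
  shows "Gam g x v w = V"
proof (rule g_eqI[OF x])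
  fix z
  have "2 * (z \<bullet> (g x *v Gam g x v w)) = 2 * (z \<bullet> (g x *v V))"
    by (simp only: koszul[OF x] assms(2))
  then show "Gam g x v w \<bullet> (g x *v z) = V \<bullet> (g x *v z)"
    by (simp add: inner_g_commute[OF x, of _ z])
qed

lemma Gam_commute: "x \<in> M \<Longrightarrow> Gam g x v w = Gam g x w v"
  by (rule Gam_unique) (auto simp: koszul dmet_commute)

text \<open>In the sum of the Koszul formulas for (u, v) tested with w and for (u, w) tested with v,
  all derivatives in directions v and w cancel.\<close>

lemma metric_compatible:
  assumes x: "x \<in> M"
  shows "v \<bullet> (dmet g x u *v w) = w \<bullet> (g x *v Gam g x u v) + v \<bullet> (g x *v Gam g x u w)"
  using koszul[OF x, of w u v] koszul[OF x, of v u w] dmet_commute[OF x, of v u w]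
    dmet_commute[OF x, of u v w] dmet_commute[OF x, of u w v] by linarith

lemma det_g_nonzero: "x \<in> M \<Longrightarrow> det (g x) \<noteq> 0"
  using inv_g invertible_det_nz by blast

lemma differentiable_ginv: "(\<lambda>x. matrix_inv (g x) $ i $ j) differentiable_on M"
proof -
  have d: "(\<lambda>x. det (g x)) differentiable_on M"
    unfolding det_3 by (intro differentiable_on_add differentiable_on_diff differentiable_on_mult d1)
  have "\<forall>i j. (\<lambda>x. adjugate3 (g x) $ i $ j) differentiable_on M"
    by (simp add: adjugate3_def forall_3) (intro conjI differentiable_on_diff differentiable_on_mult d1)
  then have "(\<lambda>x. adjugate3 (g x) $ i $ j / det (g x)) differentiable_on M"
    using d det_g_nonzero by (auto simp: differentiable_on_def intro!: differentiable_divide)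
  moreover have "adjugate3 (g x) $ i $ j / det (g x) = matrix_inv (g x) $ i $ j" if "x \<in> M" for x
    by (simp add: matrix_inv_3 det_g_nonzero that)
  ultimately show ?thesis
    unfolding differentiable_on_def by (auto intro: differentiable_transform_within[OF _ zero_less_one])
qed

lemma differentiable_christoffel: "christoffel g k i j differentiable_on M"
  unfolding christoffel_def ginv_def divide_inverse sum_3
  by (intro differentiable_on_mult differentiable_on_add differentiable_on_diff
      differentiable_ginv d2 differentiable_on_const)

text \<open>The base point moves along \<open>\<Phi>\<close> so that the same rule serves a metric
  at its own points, with \<open>\<Phi>\<close> the identity, and a metric that is pulled
  back.\<close>

lemma Gam_derivative:
  assumes x: "x \<in> M" and \<Phi>: "(\<Phi> has_derivative \<Phi>') (at x within M)" "\<Phi> ` M \<subseteq> M"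
    and V: "(V has_derivative V') (at x within M)" and W: "(W has_derivative W') (at x within M)"
  shows "((\<lambda>y. Gam g (\<Phi> y) (V y) (W y)) has_derivative
     (\<lambda>u. dGam g (\<Phi> x) (\<Phi>' u) (V x) (W x) + Gam g (\<Phi> x) (V' u) (W x) + Gam g (\<Phi> x) (V x) (W' u))) (at x within M)"
proof (rule has_derivative_vec)
  fix k
  have c: "((\<lambda>y. christoffel g k i j (\<Phi> y)) has_derivative
      (\<lambda>u. \<Sum>l\<in>UNIV. \<Phi>' u $ l * pdiff M l (christoffel g k i j) (\<Phi> x))) (at x within M)" for i j
    by (rule has_derivative_in_compose2[OF has_derivative_pdiff_M[OF differentiable_christoffel] \<Phi>(2) x \<Phi>(1)])
  show "((\<lambda>y. Gam g (\<Phi> y) (V y) (W y) $ k) has_derivative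
     (\<lambda>u. (dGam g (\<Phi> x) (\<Phi>' u) (V x) (W x) + Gam g (\<Phi> x) (V' u) (W x) + Gam g (\<Phi> x) (V x) (W' u)) $ k)) (at x within M)"
  proof (rule has_derivative_eq_rhs)
    have "((\<lambda>y. V y $ i * W y $ j * christoffel g k i j (\<Phi> y)) has_derivative
      (\<lambda>u. V x $ i * W x $ j * (\<Sum>l\<in>UNIV. \<Phi>' u $ l * pdiff M l (christoffel g k i j) (\<Phi> x))
        + (V x $ i * W' u $ j + V' u $ i * W x $ j) * christoffel g k i j (\<Phi> x))) (at x within M)" for i j
      by (rule has_derivative_mult[OF has_derivative_mult[OF has_derivative_vec_nth[OF V] has_derivative_vec_nth[OF W]] c])
    then show "((\<lambda>y. Gam g (\<Phi> y) (V y) (W y) $ k) has_derivative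
      (\<lambda>u. \<Sum>i\<in>UNIV. \<Sum>j\<in>UNIV. V x $ i * W x $ j * (\<Sum>l\<in>UNIV. \<Phi>' u $ l * pdiff M l (christoffel g k i j) (\<Phi> x))
        + (V x $ i * W' u $ j + V' u $ i * W x $ j) * christoffel g k i j (\<Phi> x))) (at x within M)"
      unfolding Gam_def vec_lambda_beta by (intro has_derivative_sum)
  qed (simp add: Gam_def dGam_def sum.distrib algebra_simps fun_eq_iff)
qed

lemma dGam_commute:
  assumes x: "x \<in> M"
  shows "dGam g x u v w = dGam g x u w v"
proof -
  have d: "((\<lambda>y. Gam g y v w) has_derivative (\<lambda>u. dGam g x u v w)) (at x within M)" for v w
    using Gam_derivative[OF x has_derivative_ident _ has_derivative_const has_derivative_const]
    by (simp add: linear_0[OF linear_Gam(1)] linear_0[OF linear_Gam(2)])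
  have "((\<lambda>y. Gam g y w v) has_derivative (\<lambda>u. dGam g x u v w)) (at x within M)"
    by (rule has_derivative_transform[OF x _ d]) (rule Gam_commute)
  then show ?thesis using M_derivative_unique[OF x d] by metis
qed

lemma Riem_eq:
  assumes "x \<in> M"
  shows "Riem g x u v w = dGam g x u v w - dGam g x v u w + Gam g x u (Gam g x v w) - Gam g x v (Gam g x u w)"
  unfolding Riem_def by (simp only: dGam_commute[OF assms, of _ w] Gam_commute[OF assms, of w])

end

lemma sum_axis_linear:
  fixes L :: "real^'n \<Rightarrow> real"
  assumes "linear L"
  shows "(\<Sum>k\<in>UNIV. L (axis k 1) * v $ k) = L v"
  using linear_axis_sum[OF assms, of v] by (simp add: mult.commute)

section \<open>Conformal change\<close>

text \<open>The Koszul formula at x sees only the value and the first derivative of a metric there,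
  so conformality is demanded of the 1-jet at a single point. This matters on the sphere, where the
  final metric agrees with a conformal one only to first order.\<close>

lemma (in C2_metric) Gam_conformal_jet:
  assumes h: "C2_metric h" and x: "x \<in> M" and hx: "h x = c *\<^sub>R g x"
    and dh: "\<And>u. dmet h x u = c *\<^sub>R (dmet g x u + (2 * (p \<bullet> u)) *\<^sub>R g x)" and P: "g x *v P = p"
  shows "Gam h x v w = Gam g x v w + (p \<bullet> v) *\<^sub>R w + (p \<bullet> w) *\<^sub>R v - (v \<bullet> (g x *v w)) *\<^sub>R P"
proof (rule C2_metric.Gam_unique[OF h x])
  fix z
  have [simp]: "w \<bullet> (g x *v z) = z \<bullet> (g x *v w)" "v \<bullet> (g x *v z) = z \<bullet> (g x *v v)" "z \<bullet> p = p \<bullet> z"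
    using inner_g_commute[OF x] inner_commute by auto
  define r where "r = 2 * (p \<bullet> v) * (z \<bullet> (g x *v w)) + 2 * (p \<bullet> w) * (z \<bullet> (g x *v v))
      - 2 * (v \<bullet> (g x *v w)) * (p \<bullet> z)"
  have "2 * (z \<bullet> (h x *v (Gam g x v w + (p \<bullet> v) *\<^sub>R w + (p \<bullet> w) *\<^sub>R v - (v \<bullet> (g x *v w)) *\<^sub>R P)))
      = c * (2 * (z \<bullet> (g x *v Gam g x v w)) + r)"
    by (simp add: hx r_def scaleR_matrix_vector_assoc[symmetric] matrix_vector_right_distrib
        matrix_vector_mult_diff_distrib matrix_vector_mult_scaleR P
        inner_add_right inner_diff_right algebra_simps)
  also have "\<dots> = w \<bullet> (dmet h x v *v z) + v \<bullet> (dmet h x w *v z) - v \<bullet> (dmet h x z *v w)"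
    unfolding koszul[OF x] dh r_def
    by (simp add: scaleR_matrix_vector_assoc[symmetric] matrix_vector_mult_add_rdistrib
        inner_add_right inner_diff_right algebra_simps)
  finally show "2 * (z \<bullet> (h x *v (Gam g x v w + (p \<bullet> v) *\<^sub>R w + (p \<bullet> w) *\<^sub>R v - (v \<bullet> (g x *v w)) *\<^sub>R P))) =
      w \<bullet> (dmet h x v *v z) + v \<bullet> (dmet h x w *v z) - v \<bullet> (dmet h x z *v w)" .
qed

text \<open>The differential \<open>p\<close> and the coordinate Hessian \<open>hess\<close> are
  parameters because both uses supply them explicitly: the conformal factor, and |x|^2/2 in the
  computation of the unit normal.\<close>

locale conformal_change = C2_metric +
  fixes \<phi> :: "real^3 \<Rightarrow> real" and p :: "real^3 \<Rightarrow> real^3" and hess :: "real^3 \<Rightarrow> real^3^3"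
  assumes \<phi>_derivative: "\<And>x. x \<in> M \<Longrightarrow> (\<phi> has_derivative (\<lambda>u. p x \<bullet> u)) (at x within M)"
    and p_derivative: "\<And>x. x \<in> M \<Longrightarrow> (p has_derivative (\<lambda>u. hess x *v u)) (at x within M)"
    and hess_symmetric: "\<And>x. x \<in> M \<Longrightarrow> transpose (hess x) = hess x"
begin

abbreviation gc :: metric where "gc \<equiv> \<lambda>x. exp (2 * \<phi> x) *\<^sub>R g x"

text \<open>The g-gradient of \<open>\<phi>\<close>, that is, \<open>p\<close> with its index
  raised.\<close>

definition P :: "real^3 \<Rightarrow> real^3" where "P x = matrix_inv (g x) *v p x"

lemma g_P: "x \<in> M \<Longrightarrow> g x *v P x = p x"
  by (simp add: P_def g_ginv_v)

lemma exp_derivative: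
  "x \<in> M \<Longrightarrow> ((\<lambda>y. exp (2 * \<phi> y)) has_derivative (\<lambda>u. exp (2 * \<phi> x) * (2 * (p x \<bullet> u)))) (at x within M)"
  using has_derivative_exp[OF has_derivative_mult_right[OF \<phi>_derivative, of _ 2]] by (simp add: mult_ac)

lemma gc_entry_derivative:
  assumes x: "x \<in> M"
  shows "((\<lambda>y. gc y $ i $ j) has_derivative
    (\<lambda>u. exp (2 * \<phi> x) * (\<Sum>k\<in>UNIV. u $ k * pdiff M k (\<lambda>y. g y $ i $ j) x)
      + exp (2 * \<phi> x) * (2 * (p x \<bullet> u)) * g x $ i $ j)) (at x within M)"
  using has_derivative_mult[OF exp_derivative[OF x] has_derivative_pdiff_M[OF d1 x]] by simp

lemma C2_metric_gc: "C2_metric gc"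
proof
  show "riemannian gc"
    using riem unfolding riemannian_def
    by (auto simp: scaleR_matrix_vector_assoc[symmetric] vec_eq_iff transpose_def)
  show "(\<lambda>x. gc x $ i $ j) differentiable_on M" for i j
    using gc_entry_derivative differentiableI differentiable_on_def by blast
  fix i j k
  have eq: "exp (2 * \<phi> x) * pdiff M k (\<lambda>y. g y $ i $ j) x + exp (2 * \<phi> x) * (2 * p x $ k) * g x $ i $ j
      = pdiff M k (\<lambda>y. gc y $ i $ j) x" if "x \<in> M" for x
    by (subst pdiff_M[OF that gc_entry_derivative[OF that]]) (simp add: sum_axis inner_axis)
  have dp: "(\<lambda>x. p x $ k) differentiable_on M"
    using has_derivative_vec_nth[OF p_derivative] differentiableI differentiable_on_def by blast
  have de: "(\<lambda>x. exp (2 * \<phi> x)) differentiable_on M"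
    using exp_derivative differentiableI differentiable_on_def by blast
  have "(\<lambda>x. exp (2 * \<phi> x) * pdiff M k (\<lambda>y. g y $ i $ j) x + exp (2 * \<phi> x) * (2 * p x $ k) * g x $ i $ j) differentiable_on M"
    by (intro differentiable_on_add differentiable_on_mult differentiable_on_const dp de d1 d2)
  then show "pdiff M k (\<lambda>x. gc x $ i $ j) differentiable_on M"
    using eq unfolding differentiable_on_def
    by (metis (mono_tags, lifting) differentiable_transform_within zero_less_one)
qed

interpretation gc: C2_metric gc by (rule C2_metric_gc)

lemma dmet_gc:
  assumes x: "x \<in> M"
  shows "dmet gc x u = exp (2 * \<phi> x) *\<^sub>R (dmet g x u + (2 * (p x \<bullet> u)) *\<^sub>R g x)"
proof -
  have "(gc has_derivative (\<lambda>u. exp (2 * \<phi> x) *\<^sub>R dmet g x u + (exp (2 * \<phi> x) * (2 * (p x \<bullet> u))) *\<^sub>R g x)) (at x within M)"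
    by (rule has_derivative_scaleR[OF exp_derivative[OF x] g_derivative[OF x]])
  from M_derivative_unique[OF x gc.g_derivative[OF x] this]
  show ?thesis by (simp add: scaleR_add_right fun_eq_iff)
qed

lemma Gam_gc:
  assumes x: "x \<in> M"
  shows "Gam gc x v w = Gam g x v w + (p x \<bullet> v) *\<^sub>R w + (p x \<bullet> w) *\<^sub>R v - (v \<bullet> (g x *v w)) *\<^sub>R P x"
  by (rule Gam_conformal_jet[OF C2_metric_gc x refl dmet_gc[OF x] g_P[OF x]])

definition Q :: "real^3 \<Rightarrow> real^3 \<Rightarrow> real^3" where
  "Q x = frechet_derivative P (at x within M)"

lemma P_derivative: "x \<in> M \<Longrightarrow> (P has_derivative Q x) (at x within M)"
proof -
  assume x: "x \<in> M"
  have dp: "((\<lambda>x. p x $ k) has_derivative (\<lambda>u. (hess x *v u) $ k)) (at x within M)" for k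
    by (rule has_derivative_vec_nth[OF p_derivative[OF x]])
  define P' where "P' u = (\<chi> k. \<Sum>l\<in>UNIV. matrix_inv (g x) $ k $ l * (hess x *v u) $ l
      + (\<Sum>m\<in>UNIV. u $ m * pdiff M m (\<lambda>y. matrix_inv (g y) $ k $ l) x) * p x $ l)" for u
  have "(P has_derivative P') (at x within M)"
  proof (rule has_derivative_vec)
    fix k
    have "((\<lambda>y. \<Sum>l\<in>UNIV. matrix_inv (g y) $ k $ l * p y $ l) has_derivative
      (\<lambda>u. \<Sum>l\<in>UNIV. matrix_inv (g x) $ k $ l * (hess x *v u) $ l
      + (\<Sum>m\<in>UNIV. u $ m * pdiff M m (\<lambda>y. matrix_inv (g y) $ k $ l) x) * p x $ l)) (at x within M)"
      by (intro has_derivative_sum has_derivative_mult dp has_derivative_pdiff_M[OF differentiable_ginv x])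
    then show "((\<lambda>y. P y $ k) has_derivative (\<lambda>u. P' u $ k)) (at x within M)"
      by (simp add: P_def P'_def matrix_vector_mult_def)
  qed
  then have "P differentiable (at x within M)" by (rule differentiableI)
  then show ?thesis
    unfolding Q_def by (simp add: frechet_derivative_works)
qed

text \<open>Differentiating \<open>g x *v P x = p x\<close> determines the derivative of the
  gradient without a formula for the derivative of the inverse metric.\<close>

lemma g_Q:
  assumes x: "x \<in> M"
  shows "g x *v Q x u = hess x *v u - dmet g x u *v P x"
proof -
  have "((\<lambda>y. g y *v P y) has_derivative (\<lambda>u. g x *v Q x u + dmet g x u *v P x)) (at x within M)"
    by (rule has_derivative_matrix_vector_mult[OF g_derivative[OF x] P_derivative[OF x]])
  then have "(p has_derivative (\<lambda>u. g x *v Q x u + dmet g x u *v P x)) (at x within M)"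
    by (rule has_derivative_transform[OF x, rotated]) (simp add: g_P)
  from M_derivative_unique[OF x this p_derivative[OF x]]
  have "g x *v Q x u + dmet g x u *v P x = hess x *v u" by (simp add: fun_eq_iff)
  then show ?thesis by (simp add: algebra_simps)
qed

lemma dGam_gc:
  assumes x: "x \<in> M"
  shows "dGam gc x u v w = dGam g x u v w + ((hess x *v u) \<bullet> v) *\<^sub>R w + ((hess x *v u) \<bullet> w) *\<^sub>R v
    - (v \<bullet> (dmet g x u *v w)) *\<^sub>R P x - (v \<bullet> (g x *v w)) *\<^sub>R Q x u"
proof -
  have G: "((\<lambda>y. Gam h y v w) has_derivative (\<lambda>u. dGam h x u v w)) (at x within M)" if "C2_metric h" for h
    using C2_metric.Gam_derivative[OF that x has_derivative_ident _ has_derivative_const has_derivative_const]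
    by (simp add: linear_0[OF linear_Gam(1)] linear_0[OF linear_Gam(2)])
  have "((\<lambda>y. Gam g y v w + (p y \<bullet> v) *\<^sub>R w + (p y \<bullet> w) *\<^sub>R v - (v \<bullet> (g y *v w)) *\<^sub>R P y) has_derivative
     (\<lambda>u. dGam g x u v w + ((hess x *v u) \<bullet> v) *\<^sub>R w + ((hess x *v u) \<bullet> w) *\<^sub>R v
       - ((v \<bullet> (g x *v w)) *\<^sub>R Q x u + (v \<bullet> (g x *v 0 + dmet g x u *v w)) *\<^sub>R P x))) (at x within M)"
    by (intro has_derivative_diff has_derivative_add G C2_metric_axioms has_derivative_scaleR_left
        has_derivative_inner_left has_derivative_inner_right p_derivative[OF x] has_derivative_scaleR
        has_derivative_matrix_vector_mult g_derivative[OF x] has_derivative_const P_derivative[OF x])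
  then have "((\<lambda>y. Gam gc y v w) has_derivative
     (\<lambda>u. dGam g x u v w + ((hess x *v u) \<bullet> v) *\<^sub>R w + ((hess x *v u) \<bullet> w) *\<^sub>R v
       - ((v \<bullet> (g x *v w)) *\<^sub>R Q x u + (v \<bullet> (g x *v 0 + dmet g x u *v w)) *\<^sub>R P x))) (at x within M)"
    by (rule has_derivative_transform[OF x, rotated]) (simp add: Gam_gc)
  from M_derivative_unique[OF x G[OF C2_metric_gc] this]
  show ?thesis by (simp add: fun_eq_iff algebra_simps)
qed

text \<open>The covariant Hessian of \<open>\<phi>\<close> with respect to g.\<close>

definition hs :: "real^3 \<Rightarrow> real^3 \<Rightarrow> real^3 \<Rightarrow> real" where
  "hs x u v = (hess x *v u) \<bullet> v - p x \<bullet> Gam g x u v"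

text \<open>The covariant derivative of the gradient \<open>P\<close>; by \<open>g_N\<close> it is
  the covariant Hessian with one index raised.\<close>

definition N :: "real^3 \<Rightarrow> real^3 \<Rightarrow> real^3" where
  "N x u = Q x u + Gam g x u (P x)"

lemma linear_hs: "linear (\<lambda>u. hs x u v)" "linear (hs x u)"
  by (auto intro!: linearI simp: hs_def Gam_simps algebra_simps inner_add_left inner_add_right)

lemma hess_commute: "x \<in> M \<Longrightarrow> (hess x *v u) \<bullet> v = (hess x *v v) \<bullet> u"
  using symmetric_inner[OF hess_symmetric, of x u v] by (simp add: inner_commute)

lemma g_N:
  assumes x: "x \<in> M"
  shows "v \<bullet> (g x *v N x u) = hs x u v"
proof -
  have "v \<bullet> (g x *v N x u) = v \<bullet> (hess x *v u) - v \<bullet> (dmet g x u *v P x) + v \<bullet> (g x *v Gam g x u (P x))"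
    by (simp add: N_def matrix_vector_right_distrib g_Q[OF x] inner_add_right inner_diff_right)
  also have "v \<bullet> (dmet g x u *v P x) = P x \<bullet> (g x *v Gam g x u v) + v \<bullet> (g x *v Gam g x u (P x))"
    by (rule metric_compatible[OF x])
  also have "P x \<bullet> (g x *v Gam g x u v) = p x \<bullet> Gam g x u v"
    by (simp add: inner_g_commute[OF x, of "P x"] g_P[OF x] inner_commute)
  finally show ?thesis by (simp add: hs_def inner_commute)
qed

lemma Riem_gc:
  assumes x: "x \<in> M"
  shows "Riem gc x u v w = Riem g x u v w + hs x u w *\<^sub>R v - hs x v w *\<^sub>R u
    - (v \<bullet> (g x *v w)) *\<^sub>R N x u + (u \<bullet> (g x *v w)) *\<^sub>R N x v
    + ((p x \<bullet> v) * (p x \<bullet> w)) *\<^sub>R u - ((p x \<bullet> u) * (p x \<bullet> w)) *\<^sub>R v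
    - ((p x \<bullet> P x) * (v \<bullet> (g x *v w))) *\<^sub>R u + ((p x \<bullet> P x) * (u \<bullet> (g x *v w))) *\<^sub>R v
    + ((p x \<bullet> u) * (v \<bullet> (g x *v w))) *\<^sub>R P x - ((p x \<bullet> v) * (u \<bullet> (g x *v w))) *\<^sub>R P x"
proof -
  \<comment> \<open>\<open>T\<close> is the curvature before antisymmetrisation. Its terms symmetric
    in u and v drop out of \<open>T u v - T v u\<close>, and the remaining derivatives of
    \<open>p\<close> and \<open>P\<close> join Christoffel terms to form \<open>hs\<close> and
    \<open>N\<close>.\<close>
  define T where "T u v = dGam gc x u v w + Gam gc x u (Gam gc x v w)" for u v
  have T: "T u v = dGam g x u v w + Gam g x u (Gam g x v w)
     + ((hess x *v u) \<bullet> v) *\<^sub>R w + ((hess x *v u) \<bullet> w) *\<^sub>R v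
     - (w \<bullet> (g x *v Gam g x u v) + v \<bullet> (g x *v Gam g x u w)) *\<^sub>R P x - (v \<bullet> (g x *v w)) *\<^sub>R Q x u
     + (p x \<bullet> v) *\<^sub>R Gam g x u w + (p x \<bullet> w) *\<^sub>R Gam g x u v - (v \<bullet> (g x *v w)) *\<^sub>R Gam g x u (P x)
     + (p x \<bullet> u) *\<^sub>R (Gam g x v w + (p x \<bullet> v) *\<^sub>R w + (p x \<bullet> w) *\<^sub>R v - (v \<bullet> (g x *v w)) *\<^sub>R P x)
     + (p x \<bullet> Gam g x v w + 2 * (p x \<bullet> v) * (p x \<bullet> w) - (v \<bullet> (g x *v w)) * (p x \<bullet> P x)) *\<^sub>R u
     - (u \<bullet> (g x *v Gam g x v w) + (p x \<bullet> v) * (u \<bullet> (g x *v w)) + (p x \<bullet> w) * (u \<bullet> (g x *v v))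
         - (v \<bullet> (g x *v w)) * (p x \<bullet> u)) *\<^sub>R P x" for u v
    unfolding T_def dGam_gc[OF x] Gam_gc[OF x] metric_compatible[OF x]
    by (simp add: Gam_simps matrix_vector_right_distrib matrix_vector_mult_diff_distrib matrix_vector_mult_scaleR
        g_P[OF x] inner_add_right inner_diff_right inner_commute[of u "p x"] vec_eq_iff algebra_simps)
  have "Riem gc x u v w = T u v - T v u"
    by (simp add: gc.Riem_eq[OF x] T_def)
  also have "\<dots> = Riem g x u v w + hs x u w *\<^sub>R v - hs x v w *\<^sub>R u
    - (v \<bullet> (g x *v w)) *\<^sub>R N x u + (u \<bullet> (g x *v w)) *\<^sub>R N x v
    + ((p x \<bullet> v) * (p x \<bullet> w)) *\<^sub>R u - ((p x \<bullet> u) * (p x \<bullet> w)) *\<^sub>R v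
    - ((p x \<bullet> P x) * (v \<bullet> (g x *v w))) *\<^sub>R u + ((p x \<bullet> P x) * (u \<bullet> (g x *v w))) *\<^sub>R v
    + ((p x \<bullet> u) * (v \<bullet> (g x *v w))) *\<^sub>R P x - ((p x \<bullet> v) * (u \<bullet> (g x *v w))) *\<^sub>R P x"
    unfolding T Riem_eq[OF x] hs_def N_def hess_commute[OF x, of v u] Gam_commute[OF x, of v u]
      inner_g_commute[OF x, of v u]
    by (simp add: vec_eq_iff algebra_simps)
  finally show ?thesis .
qed

lemma Ric_gc:
  assumes x: "x \<in> M"
  shows "Ric gc x v w = Ric g x v w - hs x v w - (\<Sum>k\<in>UNIV. N x (axis k 1) $ k) * (v \<bullet> (g x *v w))
    + (p x \<bullet> v) * (p x \<bullet> w) - (p x \<bullet> P x) * (v \<bullet> (g x *v w))"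
proof -
  have lg: "linear (\<lambda>u. u \<bullet> (g x *v w))"
    by (auto intro!: linearI simp: inner_add_left)
  have lp: "linear (\<lambda>u. p x \<bullet> u)"
    by (auto intro!: linearI simp: inner_add_right)
  have 1: "(\<Sum>k\<in>UNIV. v $ k * hs x (axis k 1) w) = hs x v w"
    using sum_axis_linear[OF linear_hs(1)] by (simp add: mult.commute)
  have 2: "(\<Sum>k\<in>UNIV. (axis k 1 \<bullet> (g x *v w)) * y $ k) = y \<bullet> (g x *v w)" for y
    by (rule sum_axis_linear[OF lg])
  have 3: "(\<Sum>k\<in>UNIV. (p x \<bullet> axis k 1) * y $ k) = p x \<bullet> y" for y
    by (rule sum_axis_linear[OF lp])
  have a: "axis k (1::real) $ k = 1" for k :: 3 by simp
  have "Ric gc x v w = (\<Sum>k\<in>UNIV. Riem g x (axis k 1) v w $ k + v $ k * hs x (axis k 1) w - hs x v w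
      - (v \<bullet> (g x *v w)) * N x (axis k 1) $ k + (axis k 1 \<bullet> (g x *v w)) * N x v $ k
      + (p x \<bullet> v) * (p x \<bullet> w) - (p x \<bullet> w) * ((p x \<bullet> axis k 1) * v $ k)
      - (p x \<bullet> P x) * (v \<bullet> (g x *v w)) + (p x \<bullet> P x) * ((axis k 1 \<bullet> (g x *v w)) * v $ k)
      + (v \<bullet> (g x *v w)) * ((p x \<bullet> axis k 1) * P x $ k) - (p x \<bullet> v) * ((axis k 1 \<bullet> (g x *v w)) * P x $ k))"
    unfolding Ric_def Riem_gc[OF x] by (intro sum.cong refl) (simp add: mult_ac)
  \<comment> \<open>The factors 3 are traces of the identity. The Hessian gets the coefficient 1 - 3
    + 1 = -1, the last summand coming from \<open>N x v\<close>.\<close>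
  also have "\<dots> = Ric g x v w + hs x v w - 3 * hs x v w - (v \<bullet> (g x *v w)) * (\<Sum>k\<in>UNIV. N x (axis k 1) $ k)
      + N x v \<bullet> (g x *v w) + 3 * ((p x \<bullet> v) * (p x \<bullet> w)) - (p x \<bullet> w) * (p x \<bullet> v)
      - 3 * ((p x \<bullet> P x) * (v \<bullet> (g x *v w))) + (p x \<bullet> P x) * (v \<bullet> (g x *v w))
      + (v \<bullet> (g x *v w)) * (p x \<bullet> P x) - (p x \<bullet> v) * (P x \<bullet> (g x *v w))"
    by (simp add: Ric_def sum.distrib sum_subtractf 1 2 3 flip: sum_distrib_left)
  also have "N x v \<bullet> (g x *v w) = hs x v w"
    by (simp add: inner_g_commute[OF x, of _ w] g_N[OF x])
  also have "P x \<bullet> (g x *v w) = p x \<bullet> w"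
    by (simp only: inner_g_commute[OF x, of "P x" w] g_P[OF x] inner_commute[of w])
  finally show ?thesis by (simp add: algebra_simps)
qed

definition lap :: "real^3 \<Rightarrow> real" where
  "lap x = (\<Sum>i\<in>UNIV. \<Sum>j\<in>UNIV. matrix_inv (g x) $ i $ j * hs x (axis j 1) (axis i 1))"

lemma trace_N:
  assumes x: "x \<in> M"
  shows "(\<Sum>k\<in>UNIV. N x (axis k 1) $ k) = lap x"
proof -
  have "hs x (axis j 1) (axis i 1) = (g x *v N x (axis j 1)) $ i" for i j
    using g_N[OF x, of "axis i 1" "axis j 1"] by (simp add: inner_axis')
  then have "lap x = (\<Sum>i\<in>UNIV. \<Sum>j\<in>UNIV. matrix_inv (g x) $ j $ i * (g x *v N x (axis j 1)) $ i)"
    by (simp add: lap_def ginv_commute[OF x])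
  also have "\<dots> = (\<Sum>j\<in>UNIV. (matrix_inv (g x) *v (g x *v N x (axis j 1))) $ j)"
    by (subst sum.swap) (simp add: matrix_vector_mult_def)
  finally show ?thesis by (simp add: ginv_g_v[OF x])
qed

text \<open>Tracing \<open>Ric_gc\<close> in dimension three gives -1 - 3 for the Laplacian and 1 -
  3 for the squared gradient. With u = exp (\<open>\<phi>\<close> / 2), so that \<open>gc\<close> is
  u^4 g, the bracket is the classical R - 8 (Lap u) / u.\<close>

theorem scalar_curvature_gc:
  assumes x: "x \<in> M"
  shows "scalar_curvature gc x = exp (- 2 * \<phi> x) * (scalar_curvature g x - 4 * lap x - 2 * (p x \<bullet> P x))"
proof -
  have "gc x ** (exp (- 2 * \<phi> x) *\<^sub>R matrix_inv (g x)) = mat 1"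
    by (simp add: matrix_scalar_ac scalar_matrix_assoc[symmetric] g_ginv[OF x] exp_add[symmetric])
  then have inv: "matrix_inv (gc x) = exp (- 2 * \<phi> x) *\<^sub>R matrix_inv (g x)"
    by (rule matrix_inv_unique)
  have gg: "(\<Sum>i\<in>UNIV. \<Sum>j\<in>UNIV. matrix_inv (g x) $ i $ j * (axis j 1 \<bullet> (g x *v axis i 1))) = 3"
  proof -
    have "(\<Sum>j\<in>UNIV. matrix_inv (g x) $ i $ j * (axis j 1 \<bullet> (g x *v axis i 1))) = (matrix_inv (g x) ** g x) $ i $ i" for i
      by (simp add: matrix_entry_inner[symmetric] matrix_matrix_mult_def)
    then show ?thesis by (simp add: ginv_g[OF x] mat_def)
  qed
  have pp: "(\<Sum>i\<in>UNIV. \<Sum>j\<in>UNIV. matrix_inv (g x) $ i $ j * ((p x \<bullet> axis j 1) * (p x \<bullet> axis i 1))) = p x \<bullet> P x"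
    by (simp add: P_def inner_axis) (simp add: inner_vec_def matrix_vector_mult_def sum_distrib_left mult_ac)
  have "scalar_curvature gc x = exp (- 2 * \<phi> x) * (\<Sum>i\<in>UNIV. \<Sum>j\<in>UNIV. matrix_inv (g x) $ i $ j * Ric gc x (axis j 1) (axis i 1))"
    unfolding scalar_curvature_eq_Ric inv by (simp add: sum_distrib_left mult.assoc)
  also have "(\<Sum>i\<in>UNIV. \<Sum>j\<in>UNIV. matrix_inv (g x) $ i $ j * Ric gc x (axis j 1) (axis i 1)) =
      (\<Sum>i\<in>UNIV. \<Sum>j\<in>UNIV. matrix_inv (g x) $ i $ j * Ric g x (axis j 1) (axis i 1)
        - matrix_inv (g x) $ i $ j * hs x (axis j 1) (axis i 1)
        - (lap x + p x \<bullet> P x) * (matrix_inv (g x) $ i $ j * (axis j 1 \<bullet> (g x *v axis i 1)))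
        + matrix_inv (g x) $ i $ j * ((p x \<bullet> axis j 1) * (p x \<bullet> axis i 1)))"
    unfolding Ric_gc[OF x] trace_N[OF x] by (intro sum.cong refl) (simp add: algebra_simps)
  also have "\<dots> = scalar_curvature g x - lap x - (lap x + p x \<bullet> P x) * 3 + p x \<bullet> P x"
    unfolding sum.distrib sum_subtractf sum_distrib_left[symmetric] gg pp
    by (simp add: scalar_curvature_eq_Ric lap_def)
  finally show ?thesis by (simp add: algebra_simps)
qed

end

section \<open>Invariance under immersions\<close>

lemma inner_transpose: "v \<bullet> (transpose (A :: real^'n^'m) *v w) = (A *v v) \<bullet> w"
proof -
  have "(transpose A *v w) \<bullet> v = w \<bullet> (A *v v)" by (simp add: dot_lmul_matrix)
  then show ?thesis by (simp only: inner_commute)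
qed

text \<open>\<open>A\<close>, \<open>A2\<close>, \<open>A3\<close> are the first three derivatives
  of \<open>\<Phi>\<close>, the last ones as multilinear maps whose first argument is the newest
  direction; the third enters because curvature takes two derivatives of the pulled back metric.
  Invertible derivatives suffice since curvatures are compared point by point.\<close>

locale immersion = gt: C2_metric gt + C2_metric g for g gt +
  fixes \<Phi> :: "real^3 \<Rightarrow> real^3" and A :: "real^3 \<Rightarrow> real^3^3"
    and A2 :: "real^3 \<Rightarrow> real^3 \<Rightarrow> real^3 \<Rightarrow> real^3"
    and A3 :: "real^3 \<Rightarrow> real^3 \<Rightarrow> real^3 \<Rightarrow> real^3 \<Rightarrow> real^3"
  assumes \<Phi>_M: "\<Phi> ` M \<subseteq> M"
    and \<Phi>_derivative: "\<And>x. x \<in> M \<Longrightarrow> (\<Phi> has_derivative (\<lambda>u. A x *v u)) (at x within M)"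
    and A_derivative: "\<And>x v. x \<in> M \<Longrightarrow> ((\<lambda>y. A y *v v) has_derivative (\<lambda>u. A2 x u v)) (at x within M)"
    and A2_derivative: "\<And>x u v. x \<in> M \<Longrightarrow> ((\<lambda>y. A2 y u v) has_derivative (\<lambda>w. A3 x w u v)) (at x within M)"
    and A2_commute: "\<And>x u v. x \<in> M \<Longrightarrow> A2 x u v = A2 x v u"
    and A3_commute: "\<And>x u v w. x \<in> M \<Longrightarrow> A3 x u v w = A3 x v u w"
    and A_invertible: "\<And>x. x \<in> M \<Longrightarrow> invertible (A x)"
    and pullback: "\<And>x. x \<in> M \<Longrightarrow> gt x = transpose (A x) ** g (\<Phi> x) ** A x"
begin

lemma \<Phi>_mem: "x \<in> M \<Longrightarrow> \<Phi> x \<in> M"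
  using \<Phi>_M by blast

lemma pullback_inner: "x \<in> M \<Longrightarrow> v \<bullet> (gt x *v w) = (A x *v v) \<bullet> (g (\<Phi> x) *v (A x *v w))"
  by (simp only: pullback matrix_vector_mul_assoc[symmetric] inner_transpose)

lemma linear_A2: "x \<in> M \<Longrightarrow> linear (A2 x u)"
proof -
  assume x: "x \<in> M"
  have "A2 x u = (\<lambda>v. A2 x v u)" using A2_commute[OF x] by auto
  then show "linear (A2 x u)" using has_derivative_linear[OF A_derivative[OF x]] by simp
qed

lemma dmet_gt:
  assumes x: "x \<in> M"
  shows "v \<bullet> (dmet gt x u *v w) = (A x *v v) \<bullet> (dmet g (\<Phi> x) (A x *v u) *v (A x *v w))
    + A2 x u v \<bullet> (g (\<Phi> x) *v (A x *v w)) + A2 x u w \<bullet> (g (\<Phi> x) *v (A x *v v))"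
proof -
  have g: "((\<lambda>y. g (\<Phi> y)) has_derivative (\<lambda>u. dmet g (\<Phi> x) (A x *v u))) (at x within M)"
    by (rule has_derivative_in_compose2[OF g_derivative \<Phi>_M x \<Phi>_derivative[OF x]])
  have "((\<lambda>y. (A y *v v) \<bullet> (g (\<Phi> y) *v (A y *v w))) has_derivative
    (\<lambda>u. (A x *v v) \<bullet> (g (\<Phi> x) *v A2 x u w + dmet g (\<Phi> x) (A x *v u) *v (A x *v w))
      + A2 x u v \<bullet> (g (\<Phi> x) *v (A x *v w)))) (at x within M)"
    by (rule has_derivative_inner[OF A_derivative[OF x] has_derivative_matrix_vector_mult[OF g A_derivative[OF x]]])
  then have "((\<lambda>y. v \<bullet> (gt y *v w)) has_derivative
    (\<lambda>u. (A x *v v) \<bullet> (g (\<Phi> x) *v A2 x u w + dmet g (\<Phi> x) (A x *v u) *v (A x *v w))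
      + A2 x u v \<bullet> (g (\<Phi> x) *v (A x *v w)))) (at x within M)"
    by (rule has_derivative_transform[OF x, rotated]) (simp add: pullback_inner)
  from gt.dmet_unique[OF x this, of u] show ?thesis
    by (simp add: inner_add_right inner_g_commute[OF \<Phi>_mem[OF x], of "A x *v v"])
qed

lemma A_onto: "x \<in> M \<Longrightarrow> A x *v (matrix_inv (A x) *v v) = v"
  by (simp add: matrix_vector_mul_assoc matrix_inv_mult A_invertible)

lemma A_inv: "x \<in> M \<Longrightarrow> matrix_inv (A x) *v (A x *v v) = v"
  by (simp add: matrix_vector_mul_assoc matrix_inv_mult A_invertible)

text \<open>The transformation law of a connection, with the second derivative of the map as
  inhomogeneous term. Keeping \<open>A x\<close> on the left allows the law to be differentiated
  without the inverse of \<open>A\<close>.\<close>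

lemma Gam_gt:
  assumes x: "x \<in> M"
  shows "A x *v Gam gt x v w = A2 x v w + Gam g (\<Phi> x) (A x *v v) (A x *v w)"
proof -
  let ?R = "A2 x v w + Gam g (\<Phi> x) (A x *v v) (A x *v w)"
  have "Gam gt x v w = matrix_inv (A x) *v ?R"
  proof (rule gt.Gam_unique[OF x])
    fix z
    have "2 * (z \<bullet> (gt x *v (matrix_inv (A x) *v ?R))) = 2 * ((A x *v z) \<bullet> (g (\<Phi> x) *v ?R))"
      by (simp add: pullback_inner[OF x] A_onto[OF x])
    also have "\<dots> = 2 * (A2 x v w \<bullet> (g (\<Phi> x) *v (A x *v z)))
        + 2 * ((A x *v z) \<bullet> (g (\<Phi> x) *v Gam g (\<Phi> x) (A x *v v) (A x *v w)))"
      by (simp add: matrix_vector_right_distrib inner_add_right inner_g_commute[OF \<Phi>_mem[OF x], of "A2 x v w"])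
    also have "\<dots> = w \<bullet> (dmet gt x v *v z) + v \<bullet> (dmet gt x w *v z) - v \<bullet> (dmet gt x z *v w)"
      unfolding koszul[OF \<Phi>_mem[OF x]] dmet_gt[OF x] A2_commute[OF x, of w v] A2_commute[OF x, of z]
      by simp
    finally show "2 * (z \<bullet> (gt x *v (matrix_inv (A x) *v ?R))) =
      w \<bullet> (dmet gt x v *v z) + v \<bullet> (dmet gt x w *v z) - v \<bullet> (dmet gt x z *v w)" .
  qed
  then show ?thesis by (simp add: A_onto[OF x])
qed

lemma dGam_gt:
  assumes x: "x \<in> M"
  shows "A x *v dGam gt x u v w + A2 x u (Gam gt x v w) = A3 x u v w
    + dGam g (\<Phi> x) (A x *v u) (A x *v v) (A x *v w)
    + Gam g (\<Phi> x) (A2 x u v) (A x *v w) + Gam g (\<Phi> x) (A x *v v) (A2 x u w)"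
proof -
  have R: "((\<lambda>y. A2 y v w + Gam g (\<Phi> y) (A y *v v) (A y *v w)) has_derivative
    (\<lambda>u. A3 x u v w + (dGam g (\<Phi> x) (A x *v u) (A x *v v) (A x *v w)
    + Gam g (\<Phi> x) (A2 x u v) (A x *v w) + Gam g (\<Phi> x) (A x *v v) (A2 x u w)))) (at x within M)"
    by (intro has_derivative_add A2_derivative[OF x] Gam_derivative[OF x \<Phi>_derivative[OF x] \<Phi>_M]
        A_derivative[OF x])
  have dG: "((\<lambda>y. Gam gt y v w) has_derivative (\<lambda>u. dGam gt x u v w)) (at x within M)"
    using gt.Gam_derivative[OF x has_derivative_ident _ has_derivative_const has_derivative_const]
    by (simp add: linear_0[OF linear_Gam(1)] linear_0[OF linear_Gam(2)])
  have dA: "(A has_derivative (\<lambda>u. \<chi> i j. A2 x u (axis j 1) $ i)) (at x within M)"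
  proof (rule has_derivative_vec, rule has_derivative_vec)
    fix i j
    show "((\<lambda>y. A y $ i $ j) has_derivative (\<lambda>h. (\<chi> i j. A2 x h (axis j 1) $ i) $ i $ j)) (at x within M)"
      using has_derivative_vec_nth[OF A_derivative[OF x, of "axis j 1"], of i]
      by (simp add: matrix_vector_mult_basis column_def)
  qed
  have A2m: "(\<chi> i j. A2 x u (axis j 1) $ i) *v z = A2 x u z" for u z
    by (subst (2) linear_axis_sum[OF linear_A2[OF x]])
      (simp add: vec_eq_iff matrix_vector_mult_def mult.commute)
  have "((\<lambda>y. A y *v Gam gt y v w) has_derivative
     (\<lambda>u. A x *v dGam gt x u v w + A2 x u (Gam gt x v w))) (at x within M)"
    using has_derivative_matrix_vector_mult[OF dA dG] by (simp add: A2m)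
  then have "((\<lambda>y. A2 y v w + Gam g (\<Phi> y) (A y *v v) (A y *v w)) has_derivative
     (\<lambda>u. A x *v dGam gt x u v w + A2 x u (Gam gt x v w))) (at x within M)"
    by (rule has_derivative_transform[OF x, rotated]) (simp add: Gam_gt)
  from M_derivative_unique[OF x this R] show ?thesis by (simp add: fun_eq_iff add.assoc)
qed

text \<open>The terms by which the connection fails to be a tensor contain \<open>A2\<close> and
  \<open>A3\<close>. They are symmetric under exchange of u and v, singly or in pairs, and cancel in
  the antisymmetrisation.\<close>

lemma Riem_gt:
  assumes x: "x \<in> M"
  shows "A x *v Riem gt x u v w = Riem g (\<Phi> x) (A x *v u) (A x *v v) (A x *v w)"
proof -
  define T where "T u v = A x *v dGam gt x u v w + A x *v Gam gt x u (Gam gt x v w)" for u v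
  have T: "T u v = A3 x u v w + dGam g (\<Phi> x) (A x *v u) (A x *v v) (A x *v w)
    + Gam g (\<Phi> x) (A2 x u v) (A x *v w) + Gam g (\<Phi> x) (A x *v v) (A2 x u w)
    + Gam g (\<Phi> x) (A x *v u) (A2 x v w)
    + Gam g (\<Phi> x) (A x *v u) (Gam g (\<Phi> x) (A x *v v) (A x *v w))" for u v
    using dGam_gt[OF x, of u v w] unfolding T_def Gam_gt[OF x] Gam_simps
    by (simp add: algebra_simps)
  have "A x *v Riem gt x u v w = T u v - T v u"
    by (simp add: T_def gt.Riem_eq[OF x] matrix_vector_right_distrib matrix_vector_mult_diff_distrib)
  also have "\<dots> = Riem g (\<Phi> x) (A x *v u) (A x *v v) (A x *v w)"
    unfolding T Riem_eq[OF \<Phi>_mem[OF x]] A3_commute[OF x, of v u] A2_commute[OF x, of v u]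
    by (simp add: algebra_simps)
  finally show ?thesis .
qed

text \<open>Ricci curvature is the trace of an endomorphism, and by \<open>Riem_gt\<close> the two
  endomorphisms are conjugate under \<open>A x\<close>.\<close>

lemma Ric_gt:
  assumes x: "x \<in> M"
  shows "Ric gt x v w = Ric g (\<Phi> x) (A x *v v) (A x *v w)"
proof -
  define L where "L = matrix (\<lambda>u. Riem g (\<Phi> x) u (A x *v v) (A x *v w))"
  have L: "L *v u = Riem g (\<Phi> x) u (A x *v v) (A x *v w)" for u
    using fun_cong[OF matrix_vector_mul(2)[OF linear_Riem(1)[of g "\<Phi> x" "A x *v v" "A x *v w"]], of u]
    unfolding L_def .
  have "Riem gt x u v w = (matrix_inv (A x) ** L ** A x) *v u" for u
    by (simp add: matrix_vector_mul_assoc[symmetric] L Riem_gt[OF x, symmetric] A_inv[OF x])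
  then have "Ric gt x v w = trace (matrix_inv (A x) ** L ** A x)"
    by (simp add: Ric_def trace_def matrix_vector_mult_basis column_def)
  also have "\<dots> = trace (A x ** (matrix_inv (A x) ** L))"
    by (rule trace_mul_sym)
  also have "\<dots> = trace L"
    by (simp add: matrix_mul_assoc matrix_inv_mult A_invertible[OF x])
  also have "\<dots> = Ric g (\<Phi> x) (A x *v v) (A x *v w)"
    by (simp add: Ric_def trace_def L[symmetric] matrix_vector_mult_basis column_def)
  finally show ?thesis .
qed

theorem scalar_curvature_gt:
  assumes x: "x \<in> M"
  shows "scalar_curvature gt x = scalar_curvature g (\<Phi> x)"
proof -
  \<comment> \<open>As a matrix, the Ricci form is pulled back by \<open>A x\<close> in the same way
    as the metric, so the trace of inverse metric times Ricci matrix changes again only by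
    conjugation.\<close>
  define R where "R h y = (\<chi> j i. Ric h y (axis j 1) (axis i 1))" for h y
  have R: "v \<bullet> (R h y *v w) = Ric h y v w" for h y v w
    unfolding inner_vec_def matrix_vector_mult_def R_def
    by (subst linear_axis_sum[OF linear_Ric(1)], subst linear_axis_sum[OF linear_Ric(2)]) (simp add: mult.commute)
  have sc: "scalar_curvature h y = trace (matrix_inv (h y) ** R h y)" for h y
    by (simp add: scalar_curvature_eq_Ric trace_def matrix_matrix_mult_def R_def)
  have "R gt x = transpose (A x) ** R g (\<Phi> x) ** A x"
  proof (subst vec_eq_iff, subst vec_eq_iff, intro allI)
    fix i j
    have "R gt x $ i $ j = (A x *v axis i 1) \<bullet> (R g (\<Phi> x) *v (A x *v axis j 1))"
      unfolding R by (simp add: Ric_gt[OF x] R_def)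
    also have "\<dots> = axis i 1 \<bullet> ((transpose (A x) ** R g (\<Phi> x) ** A x) *v axis j 1)"
      by (simp only: matrix_vector_mul_assoc[symmetric] inner_transpose)
    finally show "R gt x $ i $ j = (transpose (A x) ** R g (\<Phi> x) ** A x) $ i $ j"
      by (simp only: matrix_entry_inner)
  qed
  moreover have "matrix_inv (gt x) = matrix_inv (A x) ** matrix_inv (g (\<Phi> x)) ** matrix_inv (transpose (A x))"
  proof (rule matrix_inv_unique)
    have At: "invertible (transpose (A x))" using A_invertible[OF x] by (rule transpose_invertible)
    have "gt x ** (matrix_inv (A x) ** matrix_inv (g (\<Phi> x)) ** matrix_inv (transpose (A x)))
        = transpose (A x) ** (g (\<Phi> x) ** ((A x ** matrix_inv (A x)) ** matrix_inv (g (\<Phi> x)))) ** matrix_inv (transpose (A x))"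
      by (simp add: pullback[OF x] matrix_mul_assoc)
    also have "\<dots> = mat 1"
      by (simp add: matrix_inv_mult A_invertible[OF x] At g_ginv[OF \<Phi>_mem[OF x]])
    finally show "gt x ** (matrix_inv (A x) ** matrix_inv (g (\<Phi> x)) ** matrix_inv (transpose (A x))) = mat 1" .
  qed
  moreover have "matrix_inv (transpose (A x)) ** transpose (A x) = mat 1"
    by (intro matrix_inv_mult transpose_invertible A_invertible[OF x])
  ultimately have "matrix_inv (gt x) ** R gt x = matrix_inv (A x) ** ((matrix_inv (g (\<Phi> x)) ** R g (\<Phi> x)) ** A x)"
    by (metis (no_types) matrix_mul_assoc matrix_mul_lid)
  then have "scalar_curvature gt x = trace (((matrix_inv (g (\<Phi> x)) ** R g (\<Phi> x)) ** A x) ** matrix_inv (A x))"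
    by (simp only: sc trace_mul_sym[of "matrix_inv (A x)"])
  also have "\<dots> = scalar_curvature g (\<Phi> x)"
    by (simp add: sc matrix_mul_assoc[symmetric] matrix_inv_mult A_invertible[OF x])
  finally show ?thesis .
qed

end

section \<open>Mean curvature under a conformal change of the 1-jet\<close>

context C2_metric begin

lemma ginv_x_pos:
  assumes "x \<in> M"
  shows "x \<bullet> (matrix_inv (g x) *v x) > 0"
proof -
  have "x \<noteq> 0" using assms by (auto simp: mem_M)
  then have "matrix_inv (g x) *v x \<noteq> 0"
    using g_ginv_v[OF assms, of x] by auto
  from pos[OF assms this] show ?thesis
    by (simp add: g_ginv_v[OF assms] inner_commute)
qed

text \<open>The field \<open>matrix_inv (g y) *v y\<close> is the gradient of \<open>|y|\<^sup>2/2\<close>, so its derivative is known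
  from the treatment of the gradient of a conformal factor.\<close>

lemma radial_gradient_derivative:
  assumes x: "x \<in> M"
  obtains n' where "((\<lambda>y. matrix_inv (g y) *v y) has_derivative n') (at x within M)"
    and "\<And>u. n' u = matrix_inv (g x) *v (u - dmet g x u *v (matrix_inv (g x) *v x))"
proof -
  interpret r: conformal_change g "\<lambda>x. (x \<bullet> x) / 2" "\<lambda>x. x" "\<lambda>_. mat 1"
  proof
    show "((\<lambda>x. x \<bullet> x / 2) has_derivative (\<bullet>) x) (at x within M)" for x :: "real^3"
      by (auto intro!: derivative_eq_intros simp: inner_commute)
    have "(\<lambda>u :: real^3. mat 1 *v u) = (\<lambda>u. u)" by (rule ext) simp
    then show "((\<lambda>x. x) has_derivative (\<lambda>u. mat 1 *v u)) (at x within M)" for x :: "real^3"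
      by (simp only: has_derivative_ident)
  qed simp
  have "(r.P has_derivative r.Q x) (at x within M)" by (rule r.P_derivative[OF x])
  moreover have "r.Q x u = matrix_inv (g x) *v (u - dmet g x u *v (matrix_inv (g x) *v x))" for u
    using arg_cong[OF r.g_Q[OF x, of u], of "\<lambda>v. matrix_inv (g x) *v v"]
    by (simp add: ginv_g_v[OF x] r.P_def)
  moreover have "r.P = (\<lambda>y. matrix_inv (g y) *v y)" by (simp add: r.P_def fun_eq_iff)
  ultimately show thesis using that by simp
qed

lemma unit_normal_eq:
  "unit_normal g k x = (matrix_inv (g x) *v x) $ k / sqrt (x \<bullet> (matrix_inv (g x) *v x))"
proof -
  have "(\<Sum>a\<in>UNIV. \<Sum>b\<in>UNIV. ginv g a b x * x $ a * x $ b) = x \<bullet> (matrix_inv (g x) *v x)"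
    by (simp add: inner_vec_def matrix_vector_mult_def ginv_def sum_distrib_left mult_ac)
  then show ?thesis
    by (simp add: unit_normal_def matrix_vector_mult_def ginv_def)
qed

definition nu :: "real^3 \<Rightarrow> real^3" where
  "nu x = (1 / sqrt (x \<bullet> (matrix_inv (g x) *v x))) *\<^sub>R (matrix_inv (g x) *v x)"

lemma unit_normal_nu: "unit_normal g k = (\<lambda>x. nu x $ k)"
  by (rule ext) (simp add: unit_normal_eq nu_def)

lemma nu_unit: "x \<in> M \<Longrightarrow> nu x \<bullet> (g x *v nu x) = 1"
  using ginv_x_pos[of x]
  by (simp add: nu_def matrix_vector_mult_scaleR g_ginv_v inner_commute[of _ x] real_sqrt_mult[symmetric])

lemma nu_derivative:
  assumes x: "x \<in> M"
  defines "n \<equiv> matrix_inv (g x) *v x"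
  defines "n' \<equiv> \<lambda>u. matrix_inv (g x) *v (u - dmet g x u *v n)"
  shows "(nu has_derivative (\<lambda>u. (1 / sqrt (x \<bullet> n)) *\<^sub>R n' u
     - ((u \<bullet> n + x \<bullet> n' u) / (2 * (x \<bullet> n) * sqrt (x \<bullet> n))) *\<^sub>R n)) (at x within M)"
proof -
  have s: "x \<bullet> n > 0" unfolding n_def by (rule ginv_x_pos[OF x])
  have dn: "((\<lambda>y. matrix_inv (g y) *v y) has_derivative n') (at x within M)"
    by (rule radial_gradient_derivative[OF x]) (metis (no_types, lifting) ext n'_def n_def)
  have ds: "((\<lambda>y. y \<bullet> (matrix_inv (g y) *v y)) has_derivative (\<lambda>u. x \<bullet> n' u + u \<bullet> n)) (at x within M)"
    unfolding n_def by (rule has_derivative_inner[OF has_derivative_ident dn])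
  have dq: "((\<lambda>y. sqrt (y \<bullet> (matrix_inv (g y) *v y))) has_derivative (\<lambda>u. (x \<bullet> n' u + u \<bullet> n) * (inverse (sqrt (x \<bullet> n)) / 2))) (at x within M)"
    using DERIV_compose_FDERIV[where f = sqrt, OF DERIV_real_sqrt ds] s
    by (simp add: n_def)
  have s0: "sqrt (x \<bullet> (matrix_inv (g x) *v x)) \<noteq> 0"
    using s by (simp add: n_def)
  have "((\<lambda>y. inverse (sqrt (y \<bullet> (matrix_inv (g y) *v y))) *\<^sub>R (matrix_inv (g y) *v y)) has_derivative
     (\<lambda>u. inverse (sqrt (x \<bullet> n)) *\<^sub>R n' u
      + (- (inverse (sqrt (x \<bullet> n)) * ((x \<bullet> n' u + u \<bullet> n) * (inverse (sqrt (x \<bullet> n)) / 2)) * inverse (sqrt (x \<bullet> n)))) *\<^sub>R n)) (at x within M)"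
    using has_derivative_scaleR[OF Deriv.has_derivative_inverse[OF s0 dq] dn] by (simp add: n_def)
  moreover have "inverse (sqrt (x \<bullet> n)) * (t * (inverse (sqrt (x \<bullet> n)) / 2)) * inverse (sqrt (x \<bullet> n)) = t / (2 * (x \<bullet> n) * sqrt (x \<bullet> n))" for t
    using s by (simp add: field_simps power2_eq_square[symmetric])
  ultimately have "(nu has_derivative
     (\<lambda>u. inverse (sqrt (x \<bullet> n)) *\<^sub>R n' u + (- ((x \<bullet> n' u + u \<bullet> n) / (2 * (x \<bullet> n) * sqrt (x \<bullet> n)))) *\<^sub>R n)) (at x within M)"
    unfolding nu_def[abs_def] inverse_eq_divide[symmetric, of "sqrt (_ \<bullet> (matrix_inv (g _) *v _))"] by (simp only:)
  then show ?thesis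
    by (simp add: inverse_eq_divide add.commute)
qed

lemma second_ff_eq:
  assumes x: "x \<in> M" and nu': "(nu has_derivative nu') (at x within M)"
  shows "second_ff g i j x = axis j 1 \<bullet> (g x *v (nu' (axis i 1) + Gam g x (axis i 1) (nu x)))"
proof -
  have "pdiff M i (unit_normal g k) x = nu' (axis i 1) $ k" for k
    unfolding unit_normal_nu by (rule pdiff_M[OF x has_derivative_vec_nth[OF nu']])
  then show ?thesis
    by (simp add: second_ff_def unit_normal_nu Gam_axis1[symmetric] mult.commute[of _ "nu x $ _"]
        inner_axis' matrix_vector_mult_def g_entry_commute[OF x, of j])
qed

text \<open>The rescaling of the normal cancels the term of the new connection that points along it.
  What the second fundamental form gains is (p . nu) times the metric and a term with the conormal
  as a factor, which the trace over the tangent plane kills. That plane has dimension two, hence the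
  factor 2.\<close>

lemma mean_curvature_conformal_jet:
  assumes h: "C2_metric h" and x: "x \<in> M" and hx: "h x = g x"
    and dh: "\<And>u. dmet h x u = dmet g x u + (2 * (p \<bullet> u)) *\<^sub>R g x"
  shows "mean_curvature h x = mean_curvature g x + 2 * (p \<bullet> nu x)"
proof -
  interpret h: C2_metric h by (rule h)
  define n where "n = matrix_inv (g x) *v x"
  define n' where "n' u = matrix_inv (g x) *v (u - dmet g x u *v n)" for u
  define P where "P = matrix_inv (g x) *v p"
  have gP: "g x *v P = p" by (simp add: P_def g_ginv_v[OF x])
  define nu' where "nu' u = (1 / sqrt (x \<bullet> n)) *\<^sub>R n' u
     - ((u \<bullet> n + x \<bullet> n' u) / (2 * (x \<bullet> n) * sqrt (x \<bullet> n))) *\<^sub>R n" for u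
  have s: "x \<bullet> n > 0" unfolding n_def by (rule ginv_x_pos[OF x])
  have dnu: "(nu has_derivative nu') (at x within M)"
    using nu_derivative[OF x] by (simp add: nu'_def[abs_def] n'_def n_def)
  have hnu: "h.nu x = nu x" by (simp add: h.nu_def nu_def hx)
  have hn': "matrix_inv (h x) *v (u - dmet h x u *v n) = n' u - (2 * (p \<bullet> u)) *\<^sub>R n" for u
  proof -
    have "u - dmet h x u *v n = (u - dmet g x u *v n) - (2 * (p \<bullet> u)) *\<^sub>R (g x *v n)"
      by (simp add: dh matrix_vector_mult_add_rdistrib scaleR_matrix_vector_assoc[symmetric])
    then show ?thesis
      by (simp only: hx n'_def matrix_vector_mult_diff_distrib matrix_vector_mult_scaleR ginv_g_v[OF x])
  qed
  \<comment> \<open>To first order at x the metric \<open>h\<close> is g times exp (2 q), where q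
    vanishes at x with differential p. Its unit normal is thus exp (- q) times that of g, which
    accounts for the loss of \<open>(p \<bullet> u) *\<^sub>R nu x\<close>.\<close>
  have dhnu: "(h.nu has_derivative (\<lambda>u. nu' u - (p \<bullet> u) *\<^sub>R nu x)) (at x within M)"
  proof (rule has_derivative_eq_rhs[OF h.nu_derivative[OF x]], rule ext)
    fix u
    define s where "s = x \<bullet> n"
    have sp: "s > 0" "sqrt s > 0" using \<open>x \<bullet> n > 0\<close> by (simp_all add: s_def)
    have "(1 / sqrt s) *\<^sub>R (n' u - (2 * (p \<bullet> u)) *\<^sub>R n)
       - ((u \<bullet> n + x \<bullet> (n' u - (2 * (p \<bullet> u)) *\<^sub>R n)) / (2 * s * sqrt s)) *\<^sub>R n
      = (1 / sqrt s) *\<^sub>R n' u - ((u \<bullet> n + x \<bullet> n' u) / (2 * s * sqrt s)) *\<^sub>R n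
       + ((2 * (p \<bullet> u) * s) / (2 * s * sqrt s) - 2 * (p \<bullet> u) / sqrt s) *\<^sub>R n"
      by (simp add: s_def[symmetric] inner_diff_right algebra_simps diff_divide_distrib add_divide_distrib)
    also have "(2 * (p \<bullet> u) * s) / (2 * s * sqrt s) - 2 * (p \<bullet> u) / sqrt s = - ((p \<bullet> u) * (1 / sqrt s))"
      using sp by (simp add: field_simps)
    finally show "(1 / sqrt (x \<bullet> (matrix_inv (h x) *v x))) *\<^sub>R (matrix_inv (h x) *v (u - dmet h x u *v (matrix_inv (h x) *v x)))
       - ((u \<bullet> (matrix_inv (h x) *v x) + x \<bullet> (matrix_inv (h x) *v (u - dmet h x u *v (matrix_inv (h x) *v x))))
          / (2 * (x \<bullet> (matrix_inv (h x) *v x)) * sqrt (x \<bullet> (matrix_inv (h x) *v x)))) *\<^sub>R (matrix_inv (h x) *v x)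
       = nu' u - (p \<bullet> u) *\<^sub>R nu x"
      using hn'[of u] unfolding hx n_def[symmetric] s_def[symmetric]
      by (simp add: nu'_def nu_def n_def[symmetric] s_def[symmetric])
  qed
  have GG: "Gam h x v w = Gam g x v w + (p \<bullet> v) *\<^sub>R w + (p \<bullet> w) *\<^sub>R v - (v \<bullet> (g x *v w)) *\<^sub>R P" for v w
    by (rule Gam_conformal_jet[OF h x _ _ gP, of 1]) (simp_all add: hx dh)
  have II: "second_ff h i j x = second_ff g i j x + (p \<bullet> nu x) * (axis j 1 \<bullet> (g x *v axis i 1))
      - (axis i 1 \<bullet> (g x *v nu x)) * p $ j" for i j
    by (simp add: GG hx h.second_ff_eq[OF x dhnu] second_ff_eq[OF x dnu] hnu matrix_vector_right_distrib
        matrix_vector_mult_diff_distrib matrix_vector_mult_scaleR inner_add_right inner_diff_right gP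
        inner_axis' algebra_simps)
  define G where "G i j = matrix_inv (g x) $ i $ j" for i j
  have gv: "axis j 1 \<bullet> (g x *v axis i 1) = g x $ j $ i" for i j
    by (simp only: matrix_entry_inner)
  have 1: "(\<Sum>i\<in>UNIV. \<Sum>j\<in>UNIV. G i j * g x $ j $ i) = 3"
  proof -
    have "(\<Sum>j\<in>UNIV. G i j * g x $ j $ i) = (matrix_inv (g x) ** g x) $ i $ i" for i
      by (simp add: G_def matrix_matrix_mult_def)
    then show ?thesis by (simp add: ginv_g[OF x] mat_def)
  qed
  have 2: "(\<Sum>i\<in>UNIV. \<Sum>j\<in>UNIV. nu x $ i * nu x $ j * g x $ j $ i) = 1"
    using nu_unit[OF x] by (simp add: inner_vec_def matrix_vector_mult_def sum_distrib_left g_entry_commute[OF x] mult_ac)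
  have 3: "(\<Sum>i\<in>UNIV. \<Sum>j\<in>UNIV. G i j * (g x *v nu x) $ i * p $ j) = p \<bullet> nu x"
  proof -
    have "(\<Sum>i\<in>UNIV. \<Sum>j\<in>UNIV. G i j * (g x *v nu x) $ i * p $ j) = (g x *v nu x) \<bullet> (matrix_inv (g x) *v p)"
      by (simp add: inner_vec_def matrix_vector_mult_def[of "matrix_inv (g x)"] sum_distrib_left G_def mult_ac)
    also have "\<dots> = p \<bullet> nu x"
      by (simp only: ginv_inner_commute[OF x, of "g x *v nu x"] ginv_g_v[OF x])
    finally show ?thesis .
  qed
  have 4: "(\<Sum>i\<in>UNIV. \<Sum>j\<in>UNIV. nu x $ i * nu x $ j * (g x *v nu x) $ i * p $ j) = p \<bullet> nu x"
  proof -
    have "(\<Sum>i\<in>UNIV. \<Sum>j\<in>UNIV. nu x $ i * nu x $ j * (g x *v nu x) $ i * p $ j) = (nu x \<bullet> (g x *v nu x)) * (p \<bullet> nu x)"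
      by (subst sum.swap) (simp add: inner_vec_def sum_product mult_ac)
    then show ?thesis by (simp add: nu_unit[OF x])
  qed
  have "mean_curvature h x = (\<Sum>i\<in>UNIV. \<Sum>j\<in>UNIV. (G i j - nu x $ i * nu x $ j) *
      (second_ff g i j x + (p \<bullet> nu x) * g x $ j $ i - (g x *v nu x) $ i * p $ j))"
    unfolding mean_curvature_def ginv_def hx h.unit_normal_nu hnu II gv G_def by (simp add: inner_axis')
  also have "\<dots> = (\<Sum>i\<in>UNIV. \<Sum>j\<in>UNIV. (G i j - nu x $ i * nu x $ j) * second_ff g i j x
      + (p \<bullet> nu x) * (G i j * g x $ j $ i) - (p \<bullet> nu x) * (nu x $ i * nu x $ j * g x $ j $ i)
      - G i j * (g x *v nu x) $ i * p $ j + nu x $ i * nu x $ j * (g x *v nu x) $ i * p $ j)"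
    by (intro sum.cong refl) (simp add: algebra_simps)
  \<comment> \<open>The trace of g over the whole space is 3 and the normal direction removes 1; the
    last two summands come from the conormal and cancel.\<close>
  also have "\<dots> = mean_curvature g x + (p \<bullet> nu x) * 3 - (p \<bullet> nu x) * 1 - p \<bullet> nu x + p \<bullet> nu x"
    unfolding sum.distrib sum_subtractf sum_distrib_left[symmetric] 1 2 3 4
    by (simp add: mean_curvature_def ginv_def unit_normal_nu G_def)
  finally show ?thesis by simp
qed

end

section \<open>Asymptotically flat metrics\<close>

lemma C2_metricI:
  assumes "riemannian g" and "\<And>i j. (\<lambda>x. g x $ i $ j) \<in> weighted_holder (Suc (Suc k)) \<alpha> a"
  shows "C2_metric g"
proof
  show "riemannian g" by (rule assms(1))
  show "(\<lambda>x. g x $ i $ j) differentiable_on M" for i j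
    by (rule weighted_holder_differentiable[OF assms(2)])
  show "pdiff M k (\<lambda>x. g x $ i $ j) differentiable_on M" for i j k
    by (rule weighted_holder_differentiable[OF weighted_holder_pdiff[OF assms(2)]])
qed

lemma asymptotically_flat_entry:
  assumes "asymptotically_flat m \<alpha> \<delta> g" and "0 < \<alpha>" and "0 \<le> \<delta>"
  shows "(\<lambda>x. g x $ i $ j) \<in> weighted_holder m \<alpha> 0"
proof -
  have "(\<lambda>x. g x $ i $ j - (if i = j then 1 else 0)) \<in> weighted_holder m \<alpha> 0"
    by (rule weighted_holder_mono[of _ _ _ \<delta>]) (use assms in \<open>simp_all add: asymptotically_flat_def\<close>)
  from weighted_holder_add[OF this weighted_holder_const[of "if i = j then 1 else 0"]]
  show ?thesis by simp
qed

lemma asymptotically_flat_C2: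
  assumes "asymptotically_flat m \<alpha> \<delta> g" and "2 \<le> m" and "0 < \<alpha>" and "0 \<le> \<delta>"
  shows "C2_metric g"
proof -
  obtain k where k: "m = Suc (Suc k)" using assms(2) by (metis Suc_le_D numeral_2_eq_2 Suc_le_mono)
  show ?thesis
    using assms(1) asymptotically_flat_entry[OF assms(1,3,4)]
    by (intro C2_metricI[of g k \<alpha> 0]) (simp_all add: asymptotically_flat_def k)
qed

lemma finite_uniform_bound:
  fixes F :: "'i::finite \<Rightarrow> 'a \<Rightarrow> real"
  assumes "\<And>i. \<exists>C. \<forall>x\<in>S. F i x \<le> C"
  shows "\<exists>C. \<forall>i. \<forall>x\<in>S. F i x \<le> C"
proof -
  obtain C where C: "\<And>i x. x \<in> S \<Longrightarrow> F i x \<le> C i" using assms by metis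
  have "F i x \<le> Max (range C)" if "x \<in> S" for i x
    by (rule order_trans[OF C[OF that]]) (rule Max_ge, auto)
  then show ?thesis by blast
qed

lemma norm_powr_bound:
  "x \<in> M \<Longrightarrow> norm x powr a * t \<le> C \<Longrightarrow> t \<le> C * norm x powr - a"
proof -
  assume "x \<in> M" and t: "norm x powr a * t \<le> C"
  then have "norm x powr a > 0" by (auto simp: mem_M)
  then show ?thesis using t by (simp add: powr_minus_divide pos_le_divide_eq mult.commute)
qed

lemma matrix_vector_norm_le:
  fixes A :: "real^3^3"
  assumes "\<And>i j. \<bar>A $ i $ j\<bar> \<le> e"
  shows "norm (A *v v) \<le> 9 * e * norm v"
proof -
  have "\<bar>(A *v v) $ i\<bar> \<le> 3 * e * norm v" for i
  proof -
    have "\<bar>(A *v v) $ i\<bar> \<le> (\<Sum>j\<in>UNIV. \<bar>A $ i $ j * v $ j\<bar>)"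
      unfolding matrix_vector_mult_def vec_lambda_beta by (rule sum_abs)
    also have "\<dots> \<le> (\<Sum>j\<in>(UNIV :: 3 set). e * norm v)"
    proof (rule sum_mono)
      fix j
      show "\<bar>A $ i $ j * v $ j\<bar> \<le> e * norm v"
        unfolding abs_mult
        by (rule mult_mono[OF assms component_le_norm_cart]) (use order_trans[OF abs_ge_zero assms] in auto)
    qed
    finally show ?thesis by simp
  qed
  then have "(\<Sum>i\<in>(UNIV :: 3 set). \<bar>(A *v v) $ i\<bar>) \<le> (\<Sum>i\<in>(UNIV :: 3 set). 3 * e * norm v)"
    by (rule sum_mono)
  then show ?thesis
    using norm_le_l1_cart[of "A *v v"] by simp
qed

text \<open>The pointwise form of asymptotic flatness on which the choice of the conformal factor
  rests: \<open>c\<close> and \<open>L\<close> express uniform ellipticity, \<open>C\<close> the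
  decay of the deviation from the flat metric and of its first derivatives, at the rate
  \<open>d\<close>.\<close>

locale flat_metric = C2_metric +
  fixes c L C d :: real
  assumes c_pos: "c > 0" and L_pos: "L > 0" and C_nonneg: "C \<ge> 0" and d_pos: "0 < d" and d_le: "d \<le> 1"
    and lower: "\<And>x v. x \<in> M \<Longrightarrow> c * (norm v)\<^sup>2 \<le> v \<bullet> (g x *v v)"
    and upper: "\<And>x v. x \<in> M \<Longrightarrow> norm (g x *v v) \<le> L * norm v"
    and decay: "\<And>x v. x \<in> M \<Longrightarrow> norm (g x *v v - v) \<le> C * norm x powr - d * norm v"
    and decay1: "\<And>x u v w. x \<in> M \<Longrightarrow> \<bar>v \<bullet> (dmet g x u *v w)\<bar> \<le> C * norm x powr - (d + 1) * norm u * norm v * norm w"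

lemma asymptotically_flat_metric:
  assumes af: "asymptotically_flat m \<alpha> \<delta> g" and m: "2 \<le> m" and \<alpha>: "0 < \<alpha>" and \<delta>: "0 < \<delta>" "\<delta> \<le> 1"
  obtains c L C where "flat_metric g c L C \<delta>"
proof -
  interpret C2_metric g by (rule asymptotically_flat_C2[OF af m \<alpha>]) (use \<delta> in simp)
  define e where "e i j x = g x $ i $ j - (if i = j then 1 else 0)" for i j x
  have wh: "e i j \<in> weighted_holder m \<alpha> \<delta>" for i j
    using af unfolding asymptotically_flat_def e_def by auto
  obtain m' where m': "m = Suc m'" using m by (cases m) auto
  have pe: "pdiff M k (e i j) x = pdiff M k (\<lambda>y. g y $ i $ j) x" if x: "x \<in> M" for i j k x
    using pdiff_M[OF x has_derivative_diff[OF has_derivative_pdiff_M[OF d1 x] has_derivative_const], of k i j "if i = j then 1 else 0"]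
    by (simp add: e_def[abs_def] sum_axis)
  have "\<exists>C. \<forall>x\<in>M. norm x powr \<delta> * \<bar>e (fst ij) (snd ij) x\<bar> \<le> C" for ij
    by (rule weighted_holder_bound[OF wh])
  from finite_uniform_bound[where F = "\<lambda>ij x. norm x powr \<delta> * \<bar>e (fst ij) (snd ij) x\<bar>", OF this]
  obtain C0 where "\<And>ij x. x \<in> M \<Longrightarrow> norm x powr \<delta> * \<bar>e (fst ij) (snd ij) x\<bar> \<le> C0" by blast
  then have C0: "norm x powr \<delta> * \<bar>e i j x\<bar> \<le> C0" if "x \<in> M" for i j x
    using that by (metis fst_conv snd_conv)
  have "\<exists>C. \<forall>x\<in>M. norm x powr (\<delta> + 1) * \<bar>pdiff M (fst (snd ij)) (e (fst ij) (snd (snd ij))) x\<bar> \<le> C" for ij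
    by (rule weighted_holder_bound[OF weighted_holder_pdiff[OF wh[unfolded m']]])
  from finite_uniform_bound[where F = "\<lambda>ij x. norm x powr (\<delta> + 1) * \<bar>pdiff M (fst (snd ij)) (e (fst ij) (snd (snd ij))) x\<bar>", OF this]
  obtain C1 where "\<And>ij x. x \<in> M \<Longrightarrow> norm x powr (\<delta> + 1) * \<bar>pdiff M (fst (snd ij)) (e (fst ij) (snd (snd ij))) x\<bar> \<le> C1"
    by blast
  then have C1: "norm x powr (\<delta> + 1) * \<bar>pdiff M k (e i j) x\<bar> \<le> C1" if "x \<in> M" for i j k x
    using that by (metis fst_conv snd_conv)
  \<comment> \<open>One constant for both decay conditions: \<open>matrix_vector_norm_le\<close>
    turns a bound on entries into 9 times that bound for the operator, and the three directions of
    differentiation give another factor 3.\<close>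
  define C where "C = max (9 * C0) (27 * C1)"
  have one: "(axis 1 1 :: real^3) \<in> M" by (simp add: mem_M)
  have C0_nn: "C0 \<ge> 0" using C0[OF one, of 1 1] by (simp add: order_trans[OF abs_ge_zero])
  then have C_nn: "C \<ge> 0" by (simp add: C_def)
  have dec: "norm (g x *v v - v) \<le> C * norm x powr - \<delta> * norm v" if x: "x \<in> M" for x v
  proof -
    have "\<bar>(g x - mat 1) $ i $ j\<bar> \<le> C0 * norm x powr - \<delta>" for i j
      using norm_powr_bound[OF x C0[OF x, of i j]] by (simp add: e_def mat_def)
    from matrix_vector_norm_le[OF this, of v]
    have "norm (g x *v v - v) \<le> (9 * C0) * (norm x powr - \<delta> * norm v)"
      by (simp add: matrix_vector_mult_diff_rdistrib mult_ac)
    also have "\<dots> \<le> C * (norm x powr - \<delta> * norm v)"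
      by (rule mult_right_mono) (auto simp: C_def)
    finally show ?thesis by (simp add: mult_ac)
  qed
  have dec1: "\<bar>v \<bullet> (dmet g x u *v w)\<bar> \<le> C * norm x powr - (\<delta> + 1) * norm u * norm v * norm w" if x: "x \<in> M" for x u v w
  proof -
    have "\<bar>dmet g x u $ i $ j\<bar> \<le> 3 * (C1 * norm x powr - (\<delta> + 1) * norm u)" for i j
    proof -
      have "\<bar>dmet g x u $ i $ j\<bar> \<le> (\<Sum>k\<in>UNIV. \<bar>u $ k * pdiff M k (e i j) x\<bar>)"
        unfolding dmet_def vec_lambda_beta pe[OF x] by (rule sum_abs)
      also have "\<dots> \<le> (\<Sum>k\<in>(UNIV :: 3 set). norm u * (C1 * norm x powr - (\<delta> + 1)))"
        unfolding abs_mult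
        by (intro sum_mono mult_mono component_le_norm_cart norm_powr_bound[OF x C1[OF x]]) auto
      finally show ?thesis by (simp add: mult_ac)
    qed
    from matrix_vector_norm_le[OF this, of w]
    have "norm (dmet g x u *v w) \<le> (27 * C1) * (norm x powr - (\<delta> + 1) * norm u * norm w)"
      by (simp add: mult_ac)
    also have "\<dots> \<le> C * (norm x powr - (\<delta> + 1) * norm u * norm w)"
      by (rule mult_right_mono) (auto simp: C_def)
    finally have "norm v * norm (dmet g x u *v w) \<le> norm v * (C * (norm x powr - (\<delta> + 1) * norm u * norm w))"
      by (rule mult_left_mono) simp
    then show ?thesis
      using Cauchy_Schwarz_ineq2[of v "dmet g x u *v w"] by (simp add: mult_ac)
  qed
  have up: "norm (g x *v v) \<le> (1 + C) * norm v" if x: "x \<in> M" for x v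
  proof -
    have "norm x powr - \<delta> \<le> norm x powr 0" using x \<delta> by (intro powr_mono) (auto simp: mem_M)
    then have "norm x powr - \<delta> \<le> 1" using x by (auto simp: mem_M split: if_splits)
    then have "C * norm x powr - \<delta> * norm v \<le> C * 1 * norm v"
      using C_nn by (intro mult_right_mono mult_left_mono) auto
    with dec[OF x, of v] norm_triangle_ineq2[of "g x *v v" v] show ?thesis by (simp add: algebra_simps)
  qed
  \<comment> \<open>Beyond this radius \<open>C * norm x powr - \<delta>\<close> is at most 1/2, so
    that decay alone gives the lower bound 1/2 for the quadratic form. The maximum with 1 makes the
    remaining annulus nonempty.\<close>
  define R where "R = max 1 ((2 * C + 1) powr (1 / \<delta>))"
  \<comment> \<open>On the compact set of pairs of a point of the annulus and a unit vector the
    quadratic form attains its minimum, which is therefore positive.\<close>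
  define K where "K = (cball (0 :: real^3) R - ball 0 1) \<times> sphere (0 :: real^3) 1"
  have KM: "fst z \<in> M" "norm (snd z) = 1" if "z \<in> K" for z
    using that by (auto simp: K_def mem_M)
  have cK: "compact K" unfolding K_def by (intro compact_Times compact_diff compact_cball compact_sphere open_ball)
  have neK: "K \<noteq> {}"
  proof -
    have "(axis 1 1, axis 1 1) \<in> K" by (simp add: K_def R_def)
    then show ?thesis by blast
  qed
  have ctK: "continuous_on K (\<lambda>z. snd z \<bullet> (g (fst z) *v snd z))"
  proof -
    have "continuous_on M (\<lambda>x. g x $ i $ j)" for i j
      by (rule differentiable_imp_continuous_on[OF d1])
    then have cg: "continuous_on K (\<lambda>z. g (fst z) $ i $ j)" for i j
      by (rule continuous_on_compose2) (auto intro!: continuous_on_fst continuous_on_id KM)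
    have cs: "continuous_on K (\<lambda>z. snd z $ i)" for i
      by (intro continuous_on_component continuous_on_snd continuous_on_id)
    show ?thesis
      unfolding inner_vec_def matrix_vector_mult_def vec_lambda_beta inner_real_def
      by (intro continuous_on_sum continuous_on_mult cg cs)
  qed
  obtain z where z: "z \<in> K" and zmin: "\<And>y. y \<in> K \<Longrightarrow> snd z \<bullet> (g (fst z) *v snd z) \<le> snd y \<bullet> (g (fst y) *v snd y)"
    using continuous_attains_inf[OF cK neK ctK] by blast
  define c where "c = min (snd z \<bullet> (g (fst z) *v snd z)) (1 / 2)"
  have "snd z \<noteq> 0" using KM(2)[OF z] by (metis norm_zero zero_neq_one)
  from pos[OF KM(1)[OF z] this] have c: "c > 0" unfolding c_def by simp
  have low: "c * (norm v)\<^sup>2 \<le> v \<bullet> (g x *v v)" if x: "x \<in> M" for x v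
  proof (cases "norm x \<le> R")
    case True
    show ?thesis
    proof (cases "v = 0")
      case False
      have "(x, (1 / norm v) *\<^sub>R v) \<in> K"
        using True x False by (simp add: K_def mem_M)
      from zmin[OF this] have "c \<le> ((1 / norm v) *\<^sub>R v) \<bullet> (g x *v ((1 / norm v) *\<^sub>R v))"
        by (simp add: c_def)
      also have "\<dots> = (v \<bullet> (g x *v v)) / (norm v)\<^sup>2"
        by (simp add: matrix_vector_mult_scaleR power2_eq_square)
      finally show ?thesis using False by (simp add: field_simps)
    qed simp
  next
    case False
    then have "(2 * C + 1) powr (1 / \<delta>) \<le> norm x" by (simp add: R_def)
    then have "((2 * C + 1) powr (1 / \<delta>)) powr \<delta> \<le> norm x powr \<delta>"
      using \<delta> by (intro powr_mono2) auto
    then have "2 * C + 1 \<le> norm x powr \<delta>"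
      using \<delta> C_nn by (simp add: powr_powr)
    then have "C * norm x powr - \<delta> \<le> 1 / 2"
    proof -
      assume le: "2 * C + 1 \<le> norm x powr \<delta>"
      then have "norm x powr \<delta> > 0" using C_nn by linarith
      then show ?thesis using le by (simp add: powr_minus_divide pos_divide_le_eq)
    qed
    then have "norm (g x *v v - v) \<le> 1 / 2 * norm v"
      using order_trans[OF dec[OF x, of v] mult_right_mono[of "C * norm x powr - \<delta>" "1 / 2" "norm v"]] by simp
    then have "norm v * norm (g x *v v - v) \<le> norm v * (1 / 2 * norm v)"
      by (rule mult_left_mono) simp
    moreover have "\<bar>v \<bullet> (g x *v v - v)\<bar> \<le> norm v * norm (g x *v v - v)"
      by (rule Cauchy_Schwarz_ineq2)
    moreover have "v \<bullet> (g x *v v - v) = v \<bullet> (g x *v v) - (norm v)\<^sup>2"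
      by (simp add: inner_diff_right power2_norm_eq_inner)
    ultimately have "1 / 2 * (norm v)\<^sup>2 \<le> v \<bullet> (g x *v v)"
      by (simp add: power2_eq_square)
    moreover have "c * (norm v)\<^sup>2 \<le> 1 / 2 * (norm v)\<^sup>2"
      by (rule mult_right_mono) (auto simp: c_def)
    ultimately show ?thesis by linarith
  qed
  have "flat_metric g c (1 + C) C \<delta>"
    by unfold_locales (use c C_nn \<delta> low up dec dec1 in auto)
  then show thesis by (rule that)
qed

section \<open>Estimates for the inverse metric and the connection\<close>

context flat_metric begin

lemma ginv_norm_le: 
  assumes x: "x \<in> M"
  shows "norm (matrix_inv (g x) *v v) \<le> norm v / c"
proof -
  let ?w = "matrix_inv (g x) *v v"
  have "c * (norm ?w)\<^sup>2 \<le> ?w \<bullet> v" using lower[OF x, of ?w] by (simp add: g_ginv_v[OF x])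
  also have "\<dots> \<le> norm ?w * norm v" by (rule norm_cauchy_schwarz)
  finally have "norm ?w * (c * norm ?w) \<le> norm ?w * norm v" by (simp add: power2_eq_square mult_ac)
  then have "c * norm ?w \<le> norm v \<or> norm ?w = 0" by (simp add: mult_le_cancel_left)  (metis norm_eq_zero norm_le_zero_iff not_less)
  then show ?thesis using c_pos by (auto simp: field_simps)
qed

lemma ginv_decay:
  assumes x: "x \<in> M"
  shows "norm (matrix_inv (g x) *v v - v) \<le> C / c * norm x powr - d * norm v"
proof -
  have "matrix_inv (g x) *v v - v = - (matrix_inv (g x) *v (g x *v v - v))"
    by (simp add: matrix_vector_mult_diff_distrib ginv_g_v[OF x])
  then have "norm (matrix_inv (g x) *v v - v) \<le> norm (g x *v v - v) / c"
    using ginv_norm_le[OF x] by simp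
  also have "\<dots> \<le> (C * norm x powr - d * norm v) / c"
    using decay[OF x] c_pos by (intro divide_right_mono) auto
  finally show ?thesis by simp
qed

lemma ginv_lower:
  assumes x: "x \<in> M"
  shows "c / L\<^sup>2 * (norm v)\<^sup>2 \<le> v \<bullet> (matrix_inv (g x) *v v)"
proof -
  let ?w = "matrix_inv (g x) *v v"
  have "(norm v)\<^sup>2 \<le> (L * norm ?w)\<^sup>2"
    using upper[OF x, of ?w] by (intro power_mono) (auto simp: g_ginv_v[OF x])
  then have "c / L\<^sup>2 * (norm v)\<^sup>2 \<le> c / L\<^sup>2 * (L * norm ?w)\<^sup>2"
    using c_pos by (intro mult_left_mono) auto
  also have "\<dots> = c * (norm ?w)\<^sup>2" using L_pos by (simp add: power_mult_distrib)
  also have "\<dots> \<le> ?w \<bullet> v" using lower[OF x, of ?w] by (simp add: g_ginv_v[OF x])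
  finally show ?thesis by (simp add: inner_commute)
qed

text \<open>The Koszul formula is tested with the vector \<open>Gam g x v w\<close> itself:
  ellipticity bounds the left side below by its squared norm, and each of the three derivative terms
  on the right is linear in it.\<close>

lemma Gam_norm_le:
  assumes x: "x \<in> M"
  shows "norm (Gam g x v w) \<le> 3 * C / (2 * c) * norm x powr - (d + 1) * norm v * norm w"
proof -
  let ?G = "Gam g x v w"
  have "2 * (c * (norm ?G)\<^sup>2) \<le> 2 * (?G \<bullet> (g x *v ?G))" using lower[OF x, of ?G] by simp
  also have "\<dots> \<le> 3 * (C * norm x powr - (d + 1) * norm v * norm w * norm ?G)"
    unfolding koszul[OF x]
    using decay1[OF x, of w v ?G] decay1[OF x, of v w ?G] decay1[OF x, of v ?G w]
    by (simp add: mult_ac)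
  finally have "norm ?G * (2 * c * norm ?G) \<le> norm ?G * (3 * (C * norm x powr - (d + 1) * norm v * norm w))"
    by (simp add: power2_eq_square mult_ac)
  moreover have "0 \<le> 3 * (C * norm x powr - (d + 1) * norm v * norm w)" using C_nonneg by simp
  ultimately have "2 * c * norm ?G \<le> 3 * (C * norm x powr - (d + 1) * norm v * norm w)"
    by (cases "?G = 0") auto
  then show ?thesis using c_pos by (simp add: field_simps)
qed

end

section \<open>The superharmonic conformal factor\<close>

definition cfactor :: "real \<Rightarrow> real \<Rightarrow> real^3 \<Rightarrow> real" where
  "cfactor K d x = exp (- K) - exp (- K * norm x powr - d)"

text \<open>The derivative of the radial profile divided by r, so that the coordinate gradient is
  \<open>cfactor' K d x *\<^sub>R x\<close>. The same operation applied once more gives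
  \<open>cfactor''\<close>, the coefficient of the outer product in the Hessian.\<close>

definition cfactor' :: "real \<Rightarrow> real \<Rightarrow> real^3 \<Rightarrow> real" where
  "cfactor' K d x = - (K * d) * norm x powr (- d - 2) * exp (- K * norm x powr - d)"

definition cfactor'' :: "real \<Rightarrow> real \<Rightarrow> real^3 \<Rightarrow> real" where
  "cfactor'' K d x = cfactor' K d x * (K * d * norm x powr (- d - 2) - (d + 2) * norm x powr - 2)"

definition outer :: "real^'n \<Rightarrow> real^'n^'n" where
  "outer x = (\<chi> i j. x $ i * x $ j)"

lemma outer_mult: "outer x *v u = (x \<bullet> u) *\<^sub>R x"
  by (simp add: outer_def vec_eq_iff matrix_vector_mult_def inner_vec_def sum_distrib_left mult_ac)

lemma exp_norm_powr_derivative: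
  assumes "x \<noteq> 0"
  shows "((\<lambda>y :: real^3. exp (- K * norm y powr - d)) has_derivative
    (\<lambda>u. exp (- K * norm x powr - d) * (K * d * norm x powr (- d - 2)) * (x \<bullet> u))) (at x within S)"
  using has_derivative_exp[OF has_derivative_mult_right[OF has_derivative_norm_powr[OF assms], of "- K" "- d"]]
  by (simp add: mult_ac)

lemma cfactor_derivative:
  assumes "x \<noteq> 0"
  shows "(cfactor K d has_derivative (\<lambda>u. (cfactor' K d x *\<^sub>R x) \<bullet> u)) (at x within S)"
  using has_derivative_diff[OF has_derivative_const exp_norm_powr_derivative[OF assms], of "exp (- K)" K d]
  by (simp add: cfactor_def[abs_def] cfactor'_def mult_ac)

lemma cfactor'_derivative:
  assumes "x \<noteq> 0"
  shows "(cfactor' K d has_derivative (\<lambda>u. cfactor'' K d x * (x \<bullet> u))) (at x within S)"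
proof -
  have p: "norm x powr (- d - 2 - 2) = norm x powr (- d - 2) * norm x powr - 2"
    by (simp add: powr_add[symmetric])
  have "(cfactor' K d has_derivative (\<lambda>u. - (K * d) * norm x powr (- d - 2) *
      (exp (- K * norm x powr - d) * (K * d * norm x powr (- d - 2)) * (x \<bullet> u))
      + (- (K * d) * ((- d - 2) * norm x powr (- d - 2 - 2) * (x \<bullet> u))) * exp (- K * norm x powr - d))) (at x within S)"
    unfolding cfactor'_def[abs_def]
    by (intro has_derivative_mult exp_norm_powr_derivative has_derivative_mult_right has_derivative_norm_powr assms)
  then show ?thesis
    by (rule has_derivative_eq_rhs) (simp only: cfactor''_def cfactor'_def p, simp add: fun_eq_iff algebra_simps)
qed

context flat_metric begin

lemma cfactor_conformal_change:
  "conformal_change g (cfactor K d) (\<lambda>x. cfactor' K d x *\<^sub>R x)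
     (\<lambda>x. cfactor' K d x *\<^sub>R mat 1 + cfactor'' K d x *\<^sub>R outer x)"
proof
  fix x assume "x \<in> M"
  then have x: "x \<noteq> 0" by (auto simp: mem_M)
  show "(cfactor K d has_derivative (\<bullet>) (cfactor' K d x *\<^sub>R x)) (at x within M)"
    by (rule cfactor_derivative[OF x])
  have "((\<lambda>x. cfactor' K d x *\<^sub>R x) has_derivative (\<lambda>u. cfactor' K d x *\<^sub>R u + (cfactor'' K d x * (x \<bullet> u)) *\<^sub>R x)) (at x within M)"
    by (rule has_derivative_scaleR[OF cfactor'_derivative[OF x] has_derivative_ident])
  then show "((\<lambda>x. cfactor' K d x *\<^sub>R x) has_derivative
      (\<lambda>u. (cfactor' K d x *\<^sub>R mat 1 + cfactor'' K d x *\<^sub>R outer x) *v u)) (at x within M)"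
    by (rule has_derivative_eq_rhs)
      (simp add: matrix_vector_mult_add_rdistrib scaleR_matrix_vector_assoc[symmetric] outer_mult)
  show "transpose (cfactor' K d x *\<^sub>R mat 1 + cfactor'' K d x *\<^sub>R outer x)
      = cfactor' K d x *\<^sub>R mat 1 + cfactor'' K d x *\<^sub>R outer x"
    by (simp add: vec_eq_iff transpose_def mat_def outer_def mult.commute)
qed

text \<open>A function with coordinate gradient a x and Hessian a I + b x x^T has g-Laplacian a
  (\<open>tr\<close> - \<open>trGam\<close>) + b (x . g^-1 x). In the flat case the three quantities
  are 3, 0 and |x|^2, and the bounds below measure the deviation.\<close>

definition tr :: "real^3 \<Rightarrow> real" where
  "tr x = (\<Sum>i\<in>UNIV. matrix_inv (g x) $ i $ i)"

definition trGam :: "real^3 \<Rightarrow> real" where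
  "trGam x = (\<Sum>i\<in>UNIV. \<Sum>j\<in>UNIV. matrix_inv (g x) $ i $ j * (x \<bullet> Gam g x (axis j 1) (axis i 1)))"

lemma tr_bound:
  assumes x: "x \<in> M"
  shows "\<bar>tr x - 3\<bar> \<le> 3 * (C / c) * norm x powr - d"
proof -
  have "tr x - 3 = (\<Sum>i\<in>(UNIV :: 3 set). matrix_inv (g x) $ i $ i - 1)"
    by (simp add: tr_def sum_subtractf)
  also have "\<bar>\<dots>\<bar> \<le> (\<Sum>i\<in>(UNIV :: 3 set). C / c * norm x powr - d)"
  proof (rule order_trans[OF sum_abs sum_mono])
    fix i :: 3
    have "matrix_inv (g x) $ i $ i - 1 = (matrix_inv (g x) *v axis i 1 - axis i 1) $ i"
      by (simp add: matrix_vector_mult_basis column_def)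
    then show "\<bar>matrix_inv (g x) $ i $ i - 1\<bar> \<le> C / c * norm x powr - d"
      using order_trans[OF component_le_norm_cart ginv_decay[OF x, of "axis i 1"], of i] by simp
  qed
  finally show ?thesis by simp
qed

lemma radial_bound:
  assumes x: "x \<in> M"
  shows "\<bar>x \<bullet> (matrix_inv (g x) *v x) / (norm x)\<^sup>2 - 1\<bar> \<le> C / c * norm x powr - d"
proof -
  have n0: "norm x > 0" using x by (auto simp: mem_M)
  have "x \<bullet> (matrix_inv (g x) *v x - x) = x \<bullet> (matrix_inv (g x) *v x) - (norm x)\<^sup>2"
    by (simp add: inner_diff_right power2_norm_eq_inner)
  moreover have "\<bar>x \<bullet> (matrix_inv (g x) *v x - x)\<bar> \<le> norm x * (C / c * norm x powr - d * norm x)"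
    using order_trans[OF Cauchy_Schwarz_ineq2 mult_left_mono[OF ginv_decay[OF x, of x], of "norm x"]] by simp
  ultimately have "\<bar>x \<bullet> (matrix_inv (g x) *v x) - (norm x)\<^sup>2\<bar> \<le> C / c * norm x powr - d * (norm x)\<^sup>2"
    by (simp add: power2_eq_square mult_ac)
  then have "\<bar>x \<bullet> (matrix_inv (g x) *v x) - (norm x)\<^sup>2\<bar> / (norm x)\<^sup>2 \<le> C / c * norm x powr - d"
    using n0 by (simp add: pos_divide_le_eq)
  moreover have "x \<bullet> (matrix_inv (g x) *v x) / (norm x)\<^sup>2 - 1 = (x \<bullet> (matrix_inv (g x) *v x) - (norm x)\<^sup>2) / (norm x)\<^sup>2"
    using n0 by (simp add: diff_divide_distrib)
  ultimately show ?thesis by (simp only: abs_divide abs_power2)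
qed

lemma trGam_bound:
  assumes x: "x \<in> M"
  shows "\<bar>trGam x\<bar> \<le> 27 * C / (2 * c\<^sup>2) * norm x powr - d"
proof -
  have n0: "norm x > 0" using x by (auto simp: mem_M)
  have r: "norm x * norm x powr - (d + 1) = norm x powr - d"
    using powr_mult_base[of "norm x" "- (d + 1)"] by simp
  have "\<bar>trGam x\<bar> \<le> (\<Sum>i\<in>UNIV. \<bar>\<Sum>j\<in>UNIV. matrix_inv (g x) $ i $ j * (x \<bullet> Gam g x (axis j 1) (axis i 1))\<bar>)"
    unfolding trGam_def by (rule sum_abs)
  also have "\<dots> \<le> (\<Sum>i\<in>(UNIV :: 3 set). \<Sum>j\<in>(UNIV :: 3 set). 1 / c * (3 * C / (2 * c) * norm x powr - d))"
  proof (intro sum_mono order_trans[OF sum_abs sum_mono])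
    fix i j :: 3
    have "matrix_inv (g x) $ i $ j = (matrix_inv (g x) *v axis j 1) $ i"
      by (simp add: matrix_vector_mult_basis column_def)
    then have 1: "\<bar>matrix_inv (g x) $ i $ j\<bar> \<le> 1 / c"
      using order_trans[OF component_le_norm_cart ginv_norm_le[OF x, of "axis j 1"], of i] by simp
    have "\<bar>x \<bullet> Gam g x (axis j 1) (axis i 1)\<bar> \<le> norm x * (3 * C / (2 * c) * norm x powr - (d + 1))"
      using order_trans[OF Cauchy_Schwarz_ineq2 mult_left_mono[OF Gam_norm_le[OF x, of "axis j 1" "axis i 1"], of "norm x"]]
      by simp
    also have "\<dots> = 3 * C / (2 * c) * norm x powr - d"
      unfolding r[symmetric] by (simp add: mult_ac)
    finally show "\<bar>matrix_inv (g x) $ i $ j * (x \<bullet> Gam g x (axis j 1) (axis i 1))\<bar>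
        \<le> 1 / c * (3 * C / (2 * c) * norm x powr - d)"
      unfolding abs_mult using 1 c_pos by (intro mult_mono) auto
  qed
  also have "\<dots> = 27 * C / (2 * c\<^sup>2) * norm x powr - d"
    using c_pos by (simp add: power2_eq_square field_simps)
  finally show ?thesis .
qed

text \<open>Twice the Laplacian of \<open>cfactor K d\<close> plus its squared gradient is
  \<open>cfactor' K d x\<close>, which is negative, times the expression bounded here. Its leading term is
  \<open>2 - 2 d\<close>; the error terms are of order \<open>r\<^sup>-\<^sup>d\<close> and are absorbed by the term containing \<open>K\<close>.\<close>

lemma ex_superharmonic_constant:
  obtains K where "K > 0"
    and "\<And>x. x \<in> M \<Longrightarrow> 0 \<le> 2 * (tr x - trGam x)
      + (2 * (K * d * norm x powr (- d - 2) - (d + 2) * norm x powr - 2) + cfactor' K d x) * (x \<bullet> (matrix_inv (g x) *v x))"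
proof -
  \<comment> \<open>\<open>D\<close> times r^-d is the total error 12 X + 2 Y below: 6 X from twice
    the trace, 6 X from the radial term, and 2 Y from twice the connection term.\<close>
  define D where "D = 12 * (C / c) + 2 * (27 * C / (2 * c\<^sup>2))"
  define k where "k = c / L\<^sup>2"
  have k: "k > 0" using c_pos L_pos by (simp add: k_def)
  have D: "D \<ge> 0" using C_nonneg c_pos by (simp add: D_def)
  \<comment> \<open>As \<open>k\<close> is the lower bound for the normalised radial term
    \<open>\<sigma>\<close>, this makes \<open>K * d * k\<close> at least \<open>D\<close>; the
    summand 1 ensures positivity also when \<open>D\<close> is 0.\<close>
  define K where "K = D / (d * k) + 1"
  have K: "K > 0" using D k d_pos by (simp add: K_def add_nonneg_pos)
  have Kk: "K * d * k \<ge> D" using k d_pos by (simp add: K_def field_simps)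
  have "0 \<le> 2 * (tr x - trGam x)
      + (2 * (K * d * norm x powr (- d - 2) - (d + 2) * norm x powr - 2) + cfactor' K d x) * (x \<bullet> (matrix_inv (g x) *v x))"
    if x: "x \<in> M" for x
  proof -
    define \<sigma> where "\<sigma> = x \<bullet> (matrix_inv (g x) *v x) / (norm x)\<^sup>2"
    define \<rho> where "\<rho> = norm x powr - d"
    define E where "E = exp (- K * norm x powr - d)"
    have n0: "norm x > 0" using x by (auto simp: mem_M)
    have S: "x \<bullet> (matrix_inv (g x) *v x) = \<sigma> * (norm x)\<^sup>2" using n0 by (simp add: \<sigma>_def)
    have \<rho>: "\<rho> > 0" using n0 by (simp add: \<rho>_def)
    have r2: "norm x powr - 2 * (norm x)\<^sup>2 = 1" "norm x powr (- d - 2) * (norm x)\<^sup>2 = \<rho>"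
      using n0 by (simp_all add: \<rho>_def powr_numeral[symmetric] powr_add[symmetric] del: powr_numeral)
    have \<sigma>k: "\<sigma> \<ge> k"
      using ginv_lower[OF x, of x] n0 by (simp add: \<sigma>_def k_def pos_le_divide_eq)
    have E: "0 < E" "E \<le> 1" using K by (simp_all add: E_def)
    define X where "X = C / c * \<rho>"
    define Y where "Y = 27 * C / (2 * c\<^sup>2) * \<rho>"
    have X: "X \<ge> 0" using C_nonneg c_pos \<rho> by (simp add: X_def)
    have \<sigma>1: "\<sigma> \<le> 1 + X" using radial_bound[OF x] unfolding \<sigma>_def \<rho>_def X_def by linarith
    have tr3: "tr x \<ge> 3 - 3 * X" using tr_bound[OF x] unfolding \<rho>_def X_def by linarith
    have tG: "trGam x \<le> Y" using trGam_bound[OF x] unfolding \<rho>_def Y_def by linarith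
    have "(2 * (K * d * norm x powr (- d - 2) - (d + 2) * norm x powr - 2) + cfactor' K d x) * (x \<bullet> (matrix_inv (g x) *v x))
      = \<sigma> * (2 * (K * d * (norm x powr (- d - 2) * (norm x)\<^sup>2) - (d + 2) * (norm x powr - 2 * (norm x)\<^sup>2))
          - K * d * (norm x powr (- d - 2) * (norm x)\<^sup>2) * E)"
      unfolding S cfactor'_def E_def by (simp add: algebra_simps)
    also have "\<dots> = K * d * \<rho> * \<sigma> * (2 - E) - 2 * (d + 2) * \<sigma>"
      unfolding r2 by (simp add: algebra_simps)
    finally have eq: "(2 * (K * d * norm x powr (- d - 2) - (d + 2) * norm x powr - 2) + cfactor' K d x) * (x \<bullet> (matrix_inv (g x) *v x))
      = K * d * \<rho> * \<sigma> * (2 - E) - 2 * (d + 2) * \<sigma>" .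
    have "D * \<rho> \<le> K * d * k * \<rho>" using Kk \<rho> by (intro mult_right_mono) auto
    also have "\<dots> = K * d * \<rho> * k * 1" by (simp add: mult_ac)
    \<comment> \<open>The squared gradient costs the part \<open>E\<close> of the factor 2, but
      \<open>E \<le> 1\<close>, so at least one half of the good term is left.\<close>
    also have "\<dots> \<le> K * d * \<rho> * \<sigma> * (2 - E)"
      using \<sigma>k k K d_pos \<rho> E by (intro mult_mono mult_left_mono) auto
    finally have 1: "D * \<rho> \<le> K * d * \<rho> * \<sigma> * (2 - E)" .
    have "2 * (d + 2) * \<sigma> \<le> 2 * (d + 2) * (1 + X)"
      using \<sigma>1 d_pos by (intro mult_left_mono) auto
    \<comment> \<open>Here \<open>d \<le> 1\<close> enters: it brings the radial loss down to 6,
      exactly what twice the flat trace 3 provides.\<close>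
    also have "\<dots> \<le> 2 * 3 * (1 + X)"
      using d_le X by (intro mult_right_mono) auto
    finally have 2: "2 * (d + 2) * \<sigma> \<le> 6 + 6 * X" by simp
    have "D * \<rho> = 12 * X + 2 * Y"
      by (simp add: D_def X_def Y_def algebra_simps)
    moreover have "0 \<le> 2 * (t - u) + (T\<^sub>1 - T\<^sub>2)"
      if "B = 12 * X + 2 * Y" "B \<le> T\<^sub>1" "T\<^sub>2 \<le> 6 + 6 * X" "3 - 3 * X \<le> t" "u \<le> Y" for t u T\<^sub>1 T\<^sub>2 B :: real
      using that by (simp add: algebra_simps)
    ultimately show ?thesis unfolding eq using 1 2 tr3 tG by blast
  qed
  with K show thesis by (rule that)
qed

lemma ex_conformal_factor:
  obtains K where "K > 0"
    and "\<And>x. x \<in> M \<Longrightarrow> scalar_curvature g x \<ge> 0 \<Longrightarrow>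
      scalar_curvature (\<lambda>x. exp (2 * cfactor K d x) *\<^sub>R g x) x \<ge> 0"
proof -
  obtain K where K: "K > 0"
    and le: "\<And>x. x \<in> M \<Longrightarrow> 0 \<le> 2 * (tr x - trGam x)
      + (2 * (K * d * norm x powr (- d - 2) - (d + 2) * norm x powr - 2) + cfactor' K d x) * (x \<bullet> (matrix_inv (g x) *v x))"
    by (rule ex_superharmonic_constant, rule that)
  interpret conformal_change g "cfactor K d" "\<lambda>x. cfactor' K d x *\<^sub>R x"
    "\<lambda>x. cfactor' K d x *\<^sub>R mat 1 + cfactor'' K d x *\<^sub>R outer x"
    by (rule cfactor_conformal_change)
  have "scalar_curvature gc x \<ge> 0" if x: "x \<in> M" and R: "scalar_curvature g x \<ge> 0" for x
  proof -
    define a where "a = cfactor' K d x"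
    define b where "b = cfactor'' K d x"
    have a: "a \<le> 0" using K d_pos by (simp add: a_def cfactor'_def)
    have hs: "hs x (axis j 1) (axis i 1) = a * (if i = j then 1 else 0) + b * (x $ i * x $ j)
        - a * (x \<bullet> Gam g x (axis j 1) (axis i 1))" for i j
      by (simp add: hs_def a_def b_def matrix_vector_mult_add_rdistrib scaleR_matrix_vector_assoc[symmetric]
          outer_mult inner_add_left inner_axis inner_axis_axis mult_ac) (simp add: axis_def)
    have t: "(\<Sum>j\<in>UNIV. matrix_inv (g x) $ i $ j * (if i = j then 1 else 0)) = matrix_inv (g x) $ i $ i" for i
    proof -
      have "(\<Sum>j\<in>UNIV. matrix_inv (g x) $ i $ j * (if i = j then 1 else 0)) = (\<Sum>j\<in>UNIV. if j = i then matrix_inv (g x) $ i $ j else 0)"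
        by (intro sum.cong) auto
      then show ?thesis by simp
    qed
    have lap: "lap x = a * tr x + b * (x \<bullet> (matrix_inv (g x) *v x)) - a * trGam x"
    proof -
      have "lap x = (\<Sum>i\<in>UNIV. \<Sum>j\<in>UNIV. a * (matrix_inv (g x) $ i $ j * (if i = j then 1 else 0))
          + b * (x $ i * (matrix_inv (g x) $ i $ j * x $ j))
          - a * (matrix_inv (g x) $ i $ j * (x \<bullet> Gam g x (axis j 1) (axis i 1))))"
        unfolding lap_def hs by (intro sum.cong refl) (simp add: algebra_simps)
      also have "\<dots> = a * tr x + b * (\<Sum>i\<in>UNIV. x $ i * (\<Sum>j\<in>UNIV. matrix_inv (g x) $ i $ j * x $ j)) - a * trGam x"
        by (simp add: sum.distrib sum_subtractf sum_distrib_left[symmetric] t tr_def trGam_def)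
      finally show ?thesis by (simp add: inner_vec_def matrix_vector_mult_def)
    qed
    have P: "(a *\<^sub>R x) \<bullet> P x = a * a * (x \<bullet> (matrix_inv (g x) *v x))"
      by (simp add: P_def a_def matrix_vector_mult_scaleR)
    have b: "b = a * (K * d * norm x powr (- d - 2) - (d + 2) * norm x powr - 2)"
      by (simp add: b_def a_def cfactor''_def)
    \<comment> \<open>Both \<open>b\<close> and the squared gradient contain the factor a, which is
      at most 0; the sign is decided by the bracket that \<open>K\<close> was chosen to make
      non-negative.\<close>
    have "4 * lap x + 2 * ((a *\<^sub>R x) \<bullet> P x) = 2 * a * (2 * (tr x - trGam x)
      + (2 * (K * d * norm x powr (- d - 2) - (d + 2) * norm x powr - 2) + a) * (x \<bullet> (matrix_inv (g x) *v x)))"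
      unfolding lap P b by (simp add: algebra_simps)
    also have "\<dots> \<le> 0"
      using le[OF x] a unfolding a_def[symmetric] by - (rule mult_nonpos_nonneg, simp, assumption)
    finally show ?thesis
      using R unfolding scalar_curvature_gc[OF x] a_def[symmetric] by (intro mult_nonneg_nonneg) auto
  qed
  with K show thesis by (rule that)
qed

end

section \<open>The radial diffeomorphism\<close>

text \<open>The map is \<open>x \<mapsto> f(|x|) x\<close> with \<open>f(r) = 1 + \<beta> (1 - 1/r)\<^sup>3\<close>. In terms of \<open>s = 1/r\<close>, the functions
  \<open>radial1\<close>, \<open>radial2\<close>, \<open>radial3\<close> arise from \<open>radial0\<close> by iterating \<open>q \<mapsto> - s\<^sup>3 q'(s)\<close>, which is
  \<open>f \<mapsto> f'(r)/r\<close>.\<close>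

definition radial0 :: "real \<Rightarrow> real \<Rightarrow> real" where
  "radial0 \<beta> s = 1 + \<beta> * (1 - s) ^ 3"

definition radial1 :: "real \<Rightarrow> real \<Rightarrow> real" where
  "radial1 \<beta> s = 3 * \<beta> * s ^ 3 * (1 - s)\<^sup>2"

definition radial2 :: "real \<Rightarrow> real \<Rightarrow> real" where
  "radial2 \<beta> s = - (s ^ 3) * (3 * \<beta> * (3 * s\<^sup>2 * (1 - s)\<^sup>2 - 2 * s ^ 3 * (1 - s)))"

definition radial3 :: "real \<Rightarrow> real \<Rightarrow> real" where
  "radial3 \<beta> s = s ^ 3 * (3 * \<beta> * (15 * s ^ 4 * (1 - s)\<^sup>2 - 18 * s ^ 5 * (1 - s) + 2 * s ^ 6))"

lemma DERIV_radial:
  "(radial0 \<beta> has_real_derivative - 3 * \<beta> * (1 - s)\<^sup>2) (at s)"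
  "(radial1 \<beta> has_real_derivative 3 * \<beta> * (3 * s\<^sup>2 * (1 - s)\<^sup>2 - 2 * s ^ 3 * (1 - s))) (at s)"
  "(radial2 \<beta> has_real_derivative - 3 * \<beta> * (15 * s ^ 4 * (1 - s)\<^sup>2 - 18 * s ^ 5 * (1 - s) + 2 * s ^ 6)) (at s)"
  unfolding radial0_def[abs_def] radial1_def[abs_def] radial2_def[abs_def]
  by (auto intro!: derivative_eq_intros simp: power2_eq_square power3_eq_cube power4_eq_xxxx
      eval_nat_numeral algebra_simps)

text \<open>The radial coefficients are polynomials in 1/r, and so are those of their derivatives;
  membership in the weighted spaces then reduces to that of 1/r.\<close>

definition rinv :: "real^3 \<Rightarrow> real" where
  "rinv x = norm x powr - 1"

lemma rinv_bounds: "x \<in> M \<Longrightarrow> 0 < rinv x" "x \<in> M \<Longrightarrow> rinv x \<le> 1"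
  by (auto simp: rinv_def mem_M powr_minus_divide divide_le_eq_1)

lemma has_derivative_rinv_compose:
  assumes x: "x \<in> M" and q: "(q has_real_derivative q') (at (rinv x))" and eq: "q'' = - (rinv x ^ 3) * q'"
  shows "((\<lambda>y. q (rinv y)) has_derivative (\<lambda>u. q'' * (x \<bullet> u))) (at x within M)"
proof -
  have x0: "x \<noteq> 0" using x by (auto simp: mem_M)
  have "norm x powr (- 1 - 2) = rinv x ^ 3"
    unfolding rinv_def power3_eq_cube powr_add[symmetric] by simp
  then have "(rinv has_derivative (\<lambda>u. - 1 * rinv x ^ 3 * (x \<bullet> u))) (at x within M)"
    using has_derivative_norm_powr[OF x0, of "- 1" M] by (simp add: rinv_def[abs_def])
  from DERIV_compose_FDERIV[OF q this] show ?thesis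
    by (rule has_derivative_eq_rhs) (simp add: eq mult_ac)
qed

definition dilation :: "real \<Rightarrow> real^3 \<Rightarrow> real^3" where
  "dilation \<beta> x = radial0 \<beta> (rinv x) *\<^sub>R x"

definition dilation1 :: "real \<Rightarrow> real^3 \<Rightarrow> real^3^3" where
  "dilation1 \<beta> x = radial0 \<beta> (rinv x) *\<^sub>R mat 1 + radial1 \<beta> (rinv x) *\<^sub>R outer x"

definition dilation2 :: "real \<Rightarrow> real^3 \<Rightarrow> real^3 \<Rightarrow> real^3 \<Rightarrow> real^3" where
  "dilation2 \<beta> x u v = radial1 \<beta> (rinv x) *\<^sub>R ((x \<bullet> u) *\<^sub>R v + (u \<bullet> v) *\<^sub>R x + (x \<bullet> v) *\<^sub>R u)
     + (radial2 \<beta> (rinv x) * (x \<bullet> u) * (x \<bullet> v)) *\<^sub>R x"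

definition dilation3 :: "real \<Rightarrow> real^3 \<Rightarrow> real^3 \<Rightarrow> real^3 \<Rightarrow> real^3 \<Rightarrow> real^3" where
  "dilation3 \<beta> x w u v =
     radial1 \<beta> (rinv x) *\<^sub>R ((w \<bullet> u) *\<^sub>R v + (u \<bullet> v) *\<^sub>R w + (w \<bullet> v) *\<^sub>R u)
     + (radial2 \<beta> (rinv x) * (x \<bullet> w)) *\<^sub>R ((x \<bullet> u) *\<^sub>R v + (u \<bullet> v) *\<^sub>R x + (x \<bullet> v) *\<^sub>R u)
     + (radial2 \<beta> (rinv x) * (x \<bullet> u) * (x \<bullet> v)) *\<^sub>R w
     + (radial3 \<beta> (rinv x) * (x \<bullet> w) * (x \<bullet> u) * (x \<bullet> v)
         + radial2 \<beta> (rinv x) * (w \<bullet> u) * (x \<bullet> v) + radial2 \<beta> (rinv x) * (x \<bullet> u) * (w \<bullet> v)) *\<^sub>R x"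

lemma dilation1_mult:
  "dilation1 \<beta> x *v v = radial0 \<beta> (rinv x) *\<^sub>R v + (radial1 \<beta> (rinv x) * (x \<bullet> v)) *\<^sub>R x"
  by (simp add: dilation1_def matrix_vector_mult_add_rdistrib scaleR_matrix_vector_assoc[symmetric] outer_mult)

lemma radial_derivative:
  assumes "x \<in> M"
  shows "((\<lambda>y. radial0 \<beta> (rinv y)) has_derivative (\<lambda>u. radial1 \<beta> (rinv x) * (x \<bullet> u))) (at x within M)"
    and "((\<lambda>y. radial1 \<beta> (rinv y)) has_derivative (\<lambda>u. radial2 \<beta> (rinv x) * (x \<bullet> u))) (at x within M)"
    and "((\<lambda>y. radial2 \<beta> (rinv y)) has_derivative (\<lambda>u. radial3 \<beta> (rinv x) * (x \<bullet> u))) (at x within M)"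
  by (rule has_derivative_rinv_compose[OF assms DERIV_radial(1)], simp add: radial1_def)
    (rule has_derivative_rinv_compose[OF assms DERIV_radial(2)], simp add: radial2_def,
     rule has_derivative_rinv_compose[OF assms DERIV_radial(3)], simp add: radial3_def)

lemma inner_left_derivative: "((\<lambda>y. y \<bullet> u) has_derivative (\<lambda>w. w \<bullet> u)) (at x within S)"
  by (rule has_derivative_inner_left[OF has_derivative_ident])

lemma dilation_derivative:
  assumes "x \<in> M"
  shows "(dilation \<beta> has_derivative (\<lambda>u. dilation1 \<beta> x *v u)) (at x within M)"
  unfolding dilation_def[abs_def] dilation1_mult
  by (rule has_derivative_scaleR[OF radial_derivative(1)[OF assms] has_derivative_ident])

lemma dilation1_derivative:
  assumes "x \<in> M"
  shows "((\<lambda>y. dilation1 \<beta> y *v v) has_derivative (\<lambda>u. dilation2 \<beta> x u v)) (at x within M)"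
proof -
  have "((\<lambda>y. dilation1 \<beta> y *v v) has_derivative
    (\<lambda>u. (radial1 \<beta> (rinv x) * (x \<bullet> u)) *\<^sub>R v + ((radial1 \<beta> (rinv x) * (x \<bullet> v)) *\<^sub>R u
       + (radial1 \<beta> (rinv x) * (u \<bullet> v) + radial2 \<beta> (rinv x) * (x \<bullet> u) * (x \<bullet> v)) *\<^sub>R x))) (at x within M)"
    unfolding dilation1_mult
    by (intro has_derivative_add has_derivative_scaleR_left has_derivative_scaleR has_derivative_mult
        radial_derivative[OF assms] inner_left_derivative has_derivative_ident)
  then show ?thesis
    by (rule has_derivative_eq_rhs) (simp add: dilation2_def fun_eq_iff algebra_simps)
qed

lemma dilation2_derivative:
  assumes "x \<in> M"
  shows "((\<lambda>y. dilation2 \<beta> y u v) has_derivative (\<lambda>w. dilation3 \<beta> x w u v)) (at x within M)"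
proof -
  have "((\<lambda>y. dilation2 \<beta> y u v) has_derivative
    (\<lambda>w. (radial1 \<beta> (rinv x) *\<^sub>R ((w \<bullet> u) *\<^sub>R v + (u \<bullet> v) *\<^sub>R w + (w \<bullet> v) *\<^sub>R u)
        + (radial2 \<beta> (rinv x) * (x \<bullet> w)) *\<^sub>R ((x \<bullet> u) *\<^sub>R v + (u \<bullet> v) *\<^sub>R x + (x \<bullet> v) *\<^sub>R u))
      + ((radial2 \<beta> (rinv x) * (x \<bullet> u) * (x \<bullet> v)) *\<^sub>R w
        + (radial2 \<beta> (rinv x) * (x \<bullet> u) * (w \<bullet> v)
           + (radial2 \<beta> (rinv x) * (w \<bullet> u) + radial3 \<beta> (rinv x) * (x \<bullet> w) * (x \<bullet> u)) * (x \<bullet> v)) *\<^sub>R x))) (at x within M)"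
    unfolding dilation2_def
    by (intro has_derivative_add has_derivative_scaleR_left has_derivative_scaleR_right has_derivative_scaleR
        has_derivative_mult radial_derivative[OF assms] inner_left_derivative has_derivative_ident)
  then show ?thesis
    by (rule has_derivative_eq_rhs) (simp add: dilation3_def fun_eq_iff algebra_simps)
qed

lemma dilation2_commute: "dilation2 \<beta> x u v = dilation2 \<beta> x v u"
  by (simp add: dilation2_def inner_commute[of u v] algebra_simps)

lemma dilation3_commute: "dilation3 \<beta> x u v w = dilation3 \<beta> x v u w"
  by (simp add: dilation3_def inner_commute[of u v] algebra_simps)

context
  fixes \<beta> :: real
  assumes \<beta>: "0 \<le> \<beta>"
begin

lemma radial0_bounds:
  assumes "x \<in> M"
  shows "1 \<le> radial0 \<beta> (rinv x)" "radial0 \<beta> (rinv x) \<le> 1 + \<beta>"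
proof -
  have "0 \<le> (1 - rinv x) ^ 3" "(1 - rinv x) ^ 3 \<le> 1"
    using rinv_bounds[OF assms] by (auto intro!: power_le_one)
  then show "1 \<le> radial0 \<beta> (rinv x)" "radial0 \<beta> (rinv x) \<le> 1 + \<beta>"
    using \<beta> mult_left_le[of "(1 - rinv x) ^ 3" \<beta>] by (auto simp: radial0_def)
qed

lemma norm_dilation:
  assumes "x \<in> M"
  shows "norm x \<le> norm (dilation \<beta> x)" "norm (dilation \<beta> x) \<le> (1 + \<beta>) * norm x"
proof -
  have "norm (dilation \<beta> x) = radial0 \<beta> (rinv x) * norm x"
    using radial0_bounds[OF assms] by (simp add: dilation_def)
  then show "norm x \<le> norm (dilation \<beta> x)" "norm (dilation \<beta> x) \<le> (1 + \<beta>) * norm x"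
    using mult_right_mono[OF radial0_bounds(1)[OF assms], of "norm x"]
      mult_right_mono[OF radial0_bounds(2)[OF assms], of "norm x"] by auto
qed

lemma dilation_M: "dilation \<beta> ` M \<subseteq> M"
proof (rule image_subsetI)
  fix x assume "x \<in> M"
  then show "dilation \<beta> x \<in> M"
    using order_trans[OF _ norm_dilation(1), of 1 x] by (simp add: mem_M)
qed

text \<open>The quadratic form of the derivative is at least |v|^2, because the stretching factor is
  at least 1 and increases outwards.\<close>

lemma dilation1_invertible:
  assumes x: "x \<in> M"
  shows "invertible (dilation1 \<beta> x)"
proof -
  have r1: "radial1 \<beta> (rinv x) \<ge> 0"
    using \<beta> rinv_bounds[OF x] by (simp add: radial1_def)
  have "v = 0" if "dilation1 \<beta> x *v v = 0" for v
  proof -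
    have "v \<bullet> (dilation1 \<beta> x *v v) = radial0 \<beta> (rinv x) * (norm v)\<^sup>2 + radial1 \<beta> (rinv x) * (x \<bullet> v)\<^sup>2"
      unfolding power2_norm_eq_inner
      by (simp add: dilation1_mult inner_add_right power2_eq_square inner_commute mult_ac)
    moreover have "1 * (norm v)\<^sup>2 \<le> radial0 \<beta> (rinv x) * (norm v)\<^sup>2"
      using radial0_bounds(1)[OF x] by (rule mult_right_mono) simp
    moreover have "0 \<le> radial1 \<beta> (rinv x) * (x \<bullet> v)\<^sup>2" using r1 by simp
    moreover have "v \<bullet> (dilation1 \<beta> x *v v) = 0" using that by simp
    ultimately have "(norm v)\<^sup>2 \<le> 0" by linarith
    then show "v = 0" by simp
  qed
  then have "\<exists>B. B ** dilation1 \<beta> x = mat 1" by (simp add: matrix_left_invertible_ker)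
  then show ?thesis by (simp add: invertible_left_inverse)
qed

end

section \<open>Functions with a limit at infinity, and the radial map in weighted spaces\<close>

text \<open>Keeping a function together with its limit \<open>a\<close> lets the same rules that
  prove membership also compute the limit of a compound expression, such as an entry of the pulled
  back metric.\<close>

definition near :: "nat \<Rightarrow> real \<Rightarrow> real \<Rightarrow> (real^3 \<Rightarrow> real) \<Rightarrow> real \<Rightarrow> bool" where
  "near m \<alpha> \<delta> f a \<longleftrightarrow> (\<lambda>x. f x - a) \<in> weighted_holder m \<alpha> \<delta>"

context
  fixes \<alpha> \<delta> :: real
  assumes \<alpha>: "0 < \<alpha>" "\<alpha> \<le> 1" and \<delta>: "0 \<le> \<delta>" "\<delta> \<le> 1"
begin

lemma near_const: "near m \<alpha> \<delta> (\<lambda>x. a) a"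
  by (simp add: near_def weighted_holder_zero)

lemma near_add:
  assumes "near m \<alpha> \<delta> f a" "near m \<alpha> \<delta> h b"
  shows "near m \<alpha> \<delta> (\<lambda>x. f x + h x) (a + b)"
  using weighted_holder_add[OF assms[unfolded near_def]] by (simp add: near_def algebra_simps)

lemma near_mult:
  assumes "near m \<alpha> \<delta> f a" "near m \<alpha> \<delta> h b"
  shows "near m \<alpha> \<delta> (\<lambda>x. f x * h x) (a * b)"
proof -
  note fh = assms[unfolded near_def]
  have "(\<lambda>x. (f x - a) * (h x - b)) \<in> weighted_holder m \<alpha> \<delta>"
    by (rule weighted_holder_mono[OF weighted_holder_mult[OF fh \<alpha> \<delta>(1) \<delta>(1)]]) (use \<alpha> \<delta> in auto)
  then have "(\<lambda>x. (f x - a) * (h x - b) + (a * (h x - b) + b * (f x - a))) \<in> weighted_holder m \<alpha> \<delta>"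
    by (intro weighted_holder_add weighted_holder_cmult fh \<alpha> \<delta>)
  then show ?thesis by (simp add: near_def algebra_simps)
qed

lemma near_sum:
  assumes "\<And>i. i \<in> I \<Longrightarrow> near m \<alpha> \<delta> (f i) (a i)"
  shows "near m \<alpha> \<delta> (\<lambda>x. \<Sum>i\<in>I. f i x) (\<Sum>i\<in>I. a i)"
  using weighted_holder_sum[of I "\<lambda>i x. f i x - a i" m \<alpha> \<delta>] assms
  by (simp add: near_def sum_subtractf)

lemma near_rinv: "near m \<alpha> \<delta> rinv 0"
proof -
  have "rinv \<in> weighted_holder m \<alpha> 1"
    using weighted_holder_radial(1)[OF \<alpha>, of 1] by (simp add: rinv_def[abs_def])
  from weighted_holder_mono[OF this \<delta>(2) \<alpha>(1)] show ?thesis by (simp add: near_def)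
qed

lemma near_power: "near m \<alpha> \<delta> f a \<Longrightarrow> near m \<alpha> \<delta> (\<lambda>x. f x ^ n) (a ^ n)"
  by (induction n) (simp_all add: near_const near_mult)

lemma near_dilation1: "near m \<alpha> \<delta> (\<lambda>x. dilation1 \<beta> x $ i $ j) (if i = j then 1 + \<beta> else 0)"
proof -
  have d: "near m \<alpha> \<delta> (\<lambda>x. 1 + (- 1) * rinv x) (1 + (- 1) * 0)"
    by (intro near_add near_mult near_const near_rinv)
  have "near m \<alpha> \<delta> (\<lambda>x. (1 + \<beta> * (1 + (- 1) * rinv x) ^ 3) * (if i = j then 1 else 0))
      ((1 + \<beta> * (1 + (- 1) * 0) ^ 3) * (if i = j then 1 else 0))"
    by (intro near_add near_mult near_power near_const d)
  then have 1: "near m \<alpha> \<delta> (\<lambda>x. radial0 \<beta> (rinv x) * (if i = j then 1 else 0)) (if i = j then 1 + \<beta> else 0)"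
    using near_const[of m 0] by (cases "i = j") (simp_all add: radial0_def)
  have q: "(\<lambda>x. (rinv x * x $ i) * (rinv x * x $ j)) \<in> weighted_holder m \<alpha> 0"
    using weighted_holder_mult[OF weighted_holder_radial(2)[OF \<alpha>] weighted_holder_radial(2)[OF \<alpha>] \<alpha> order_refl order_refl]
    by (simp add: rinv_def)
  have "near m \<alpha> \<delta> (\<lambda>x. 3 * \<beta> * rinv x * (1 + (- 1) * rinv x)\<^sup>2) (3 * \<beta> * 0 * (1 + (- 1) * 0)\<^sup>2)"
    by (intro near_mult near_power near_const near_rinv d)
  then have "(\<lambda>x. 3 * \<beta> * rinv x * (1 + (- 1) * rinv x)\<^sup>2) \<in> weighted_holder m \<alpha> \<delta>"
    by (simp add: near_def)
  from weighted_holder_mult[OF this q \<alpha> \<delta>(1) order_refl]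
  have 2: "near m \<alpha> \<delta> (\<lambda>x. 3 * \<beta> * rinv x * (1 + (- 1) * rinv x)\<^sup>2 * ((rinv x * x $ i) * (rinv x * x $ j))) 0"
    by (simp add: near_def)
  \<comment> \<open>The outer product grows like r^2 but its coefficient contains r^-3: two factors
    1/r turn the coordinates into bounded direction cosines, and the third supplies the
    decay.\<close>
  have "dilation1 \<beta> x $ i $ j = radial0 \<beta> (rinv x) * (if i = j then 1 else 0)
      + 3 * \<beta> * rinv x * (1 + (- 1) * rinv x)\<^sup>2 * ((rinv x * x $ i) * (rinv x * x $ j))" for x
    by (simp add: dilation1_def mat_def outer_def radial1_def power3_eq_cube)
  then show ?thesis using near_add[OF 1 2] by simp
qed

lemma dilation1_weighted_holder: "(\<lambda>x. dilation1 \<beta> x $ i $ j) \<in> weighted_holder m \<alpha> 0"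
proof -
  have "(\<lambda>x. dilation1 \<beta> x $ i $ j - (if i = j then 1 + \<beta> else 0)) \<in> weighted_holder m \<alpha> 0"
    by (rule weighted_holder_mono[OF near_dilation1[unfolded near_def] \<delta>(1) \<alpha>(1)])
  from weighted_holder_add[OF this weighted_holder_const[of "if i = j then 1 + \<beta> else 0"]] show ?thesis by simp
qed

lemma weighted_holder_bounded:
  assumes "f \<in> weighted_holder m \<alpha> 0"
  shows "\<exists>C. \<forall>x\<in>M. \<bar>f x\<bar> \<le> C"
proof -
  obtain C where C: "\<forall>x\<in>M. norm x powr 0 * \<bar>f x\<bar> \<le> C"
    using weighted_holder_bound[OF assms] by blast
  have "\<bar>f x\<bar> \<le> C" if x: "x \<in> M" for x
  proof -
    have "x \<noteq> 0" using x by (auto simp: mem_M)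
    with bspec[OF C x] show ?thesis by simp
  qed
  then show ?thesis by blast
qed

text \<open>The same two cases as for Hoelder quotients: nearby points are joined by the path of
  \<open>path_bound\<close>, with 27 = 3 * 9 from the three components, while for distant points the
  sizes of the images are already bounded by a multiple of the distance.\<close>

lemma dilation_lipschitz:
  assumes \<beta>: "0 \<le> \<beta>"
  obtains L where "\<And>x y. x \<in> M \<Longrightarrow> y \<in> M \<Longrightarrow> dist (dilation \<beta> x) (dilation \<beta> y) \<le> L * dist x y"
proof -
  have "\<exists>C. \<forall>x\<in>M. \<bar>dilation1 \<beta> x $ fst ij $ snd ij\<bar> \<le> C" for ij
    by (rule weighted_holder_bounded[OF dilation1_weighted_holder[where m = 0]])
  from finite_uniform_bound[where F = "\<lambda>ij x. \<bar>dilation1 \<beta> x $ fst ij $ snd ij\<bar>", OF this]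
  obtain B where "\<And>ij x. x \<in> M \<Longrightarrow> \<bar>dilation1 \<beta> x $ fst ij $ snd ij\<bar> \<le> B" by blast
  then have B: "\<bar>dilation1 \<beta> x $ i $ j\<bar> \<le> B" if "x \<in> M" for x i j
    using that by (metis fst_conv snd_conv)
  have one: "(axis 1 1 :: real^3) \<in> M" by (simp add: mem_M)
  have B0: "B \<ge> 0" using B[OF one, of 1 1] by (simp add: order_trans[OF abs_ge_zero])
  have le: "dist (dilation \<beta> x) (dilation \<beta> y) \<le> (27 * B + 3 * (1 + \<beta>)) * dist x y"
    if x: "x \<in> M" and y: "y \<in> M" and xy: "norm x \<le> norm y" for x y
  proof (cases "dist x y \<le> norm x")
    case True
    have dc: "((\<lambda>y. dilation \<beta> y $ i) has_derivative (\<lambda>u. (dilation1 \<beta> z *v u) $ i)) (at z within M)" if "z \<in> M" for z i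
      by (rule has_derivative_vec_nth[OF dilation_derivative[OF that]])
    have "\<bar>dilation \<beta> x $ i - dilation \<beta> y $ i\<bar> \<le> 9 * B * dist x y" for i
    proof (rule path_bound[OF _ _ x xy True])
      show "(\<lambda>y. dilation \<beta> y $ i) differentiable_on M"
        using dc differentiableI differentiable_on_def by blast
      show "\<bar>pdiff M j (\<lambda>y. dilation \<beta> y $ i) z\<bar> \<le> B" if "z \<in> M" for z j
        using B[OF that, of i j] by (simp add: pdiff_M[OF that dc[OF that]] matrix_vector_mult_basis column_def)
    qed
    then have "(\<Sum>i\<in>(UNIV :: 3 set). \<bar>(dilation \<beta> x - dilation \<beta> y) $ i\<bar>) \<le> (\<Sum>i\<in>(UNIV :: 3 set). 9 * B * dist x y)"
      by (intro sum_mono) simp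
    then have "dist (dilation \<beta> x) (dilation \<beta> y) \<le> 27 * B * dist x y"
      using norm_le_l1_cart[of "dilation \<beta> x - dilation \<beta> y"] by (simp add: dist_norm)
    then show ?thesis using \<beta> by (simp add: distrib_right add_increasing2)
  next
    case False
    have "norm y \<le> norm x + dist x y"
      using norm_triangle_ineq4[of x "x - y"] by (simp add: dist_norm)
    then have "norm x + norm y \<le> 3 * dist x y" using False by linarith
    then have "(1 + \<beta>) * (norm x + norm y) \<le> (1 + \<beta>) * (3 * dist x y)"
      using \<beta> by (intro mult_left_mono) auto
    moreover have "dist (dilation \<beta> x) (dilation \<beta> y) \<le> norm (dilation \<beta> x) + norm (dilation \<beta> y)"
      by (simp add: dist_norm norm_triangle_ineq4)
    ultimately have "dist (dilation \<beta> x) (dilation \<beta> y) \<le> 3 * (1 + \<beta>) * dist x y"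
      using norm_dilation(2)[OF \<beta> x] norm_dilation(2)[OF \<beta> y] by (simp add: algebra_simps)
    then show ?thesis using B0 by (simp add: distrib_right add_increasing)
  qed
  show thesis
  proof (rule that)
    fix x y assume "x \<in> M" "y \<in> M"
    then show "dist (dilation \<beta> x) (dilation \<beta> y) \<le> (27 * B + 3 * (1 + \<beta>)) * dist x y"
      using le[of x y] le[of y x] by (cases "norm x \<le> norm y") (auto simp: dist_commute)
  qed
qed

lemma dilation_compose_weighted_holder:
  assumes f: "f \<in> weighted_holder m \<alpha> \<delta>" and \<beta>: "0 \<le> \<beta>"
  shows "(\<lambda>x. f (dilation \<beta> x)) \<in> weighted_holder m \<alpha> \<delta>"
proof -
  obtain L where L: "\<And>x y. x \<in> M \<Longrightarrow> y \<in> M \<Longrightarrow> dist (dilation \<beta> x) (dilation \<beta> y) \<le> L * dist x y"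
    by (rule dilation_lipschitz[OF \<beta>], rule that)
  show ?thesis
    by (rule weighted_holder_compose[OF f \<alpha> \<delta>(1) norm_dilation(1)[OF \<beta>] L dilation_derivative dilation1_weighted_holder])
qed

text \<open>Twice \<open>cfactor\<close> is its limit \<open>- 2 * (1 - exp (- K))\<close> plus a
  remainder that is itself an exponential minus 1. So \<open>weighted_holder_exp_minus_one\<close>
  is applied twice, to the inner exponential before the composition with the radial map and to the
  outer one after it.\<close>

lemma near_cfactor:
  assumes K: "K > 0" and \<beta>: "0 \<le> \<beta>"
  shows "near m \<alpha> \<delta> (\<lambda>x. exp (2 * cfactor K \<delta> (dilation \<beta> x))) (exp (- 2 * (1 - exp (- K))))"
proof -
  have "(\<lambda>x. - K * norm x powr - \<delta>) \<in> weighted_holder k \<alpha> \<delta>" for k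
    by (intro weighted_holder_cmult weighted_holder_radial \<alpha> \<delta>)
  from weighted_holder_exp_minus_one[OF \<alpha> \<delta>(1) this]
  have "(\<lambda>x. - 2 * (exp (- K * norm x powr - \<delta>) - 1)) \<in> weighted_holder k \<alpha> \<delta>" for k
    by (intro weighted_holder_cmult \<alpha> \<delta>)
  from dilation_compose_weighted_holder[OF this \<beta>]
  have "(\<lambda>x. - 2 * (exp (- K * norm (dilation \<beta> x) powr - \<delta>) - 1)) \<in> weighted_holder k \<alpha> \<delta>" for k .
  from weighted_holder_exp_minus_one[OF \<alpha> \<delta>(1) this]
  have "near m \<alpha> \<delta> (\<lambda>x. exp (- 2 * (exp (- K * norm (dilation \<beta> x) powr - \<delta>) - 1))) 1"
    by (simp only: near_def)
  from near_mult[OF near_const[of m "exp (- 2 * (1 - exp (- K)))"] this]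
  show ?thesis
    by (simp add: cfactor_def exp_add[symmetric] algebra_simps)
qed

end

section \<open>Lowering the boundary mean curvature\<close>

lemma pdiffs_const: "pdiffs UNIV is (\<lambda>_. c) = (\<lambda>_. if is = [] then c else 0)"
  by (induction "is") (simp_all add: pdiff_def[abs_def])

lemma sphere_function_const: "sphere_function k \<alpha> (\<lambda>_. c)"
  unfolding sphere_function_def C_k_alpha_on_def C_k_on_def
  by (auto simp: pdiffs_const intro!: exI[of _ 0])

lemma asymptotically_flat_near:
  "asymptotically_flat m \<alpha> \<delta> g \<longleftrightarrow>
    riemannian g \<and> (\<forall>i j. near m \<alpha> \<delta> (\<lambda>x. g x $ i $ j) (if i = j then 1 else 0))"
  by (simp add: asymptotically_flat_def near_def)

locale lowering = flat_metric +
  fixes m :: nat and \<alpha> K :: real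
  assumes af: "asymptotically_flat m \<alpha> d g" and m: "2 \<le> m" and \<alpha>: "0 < \<alpha>" "\<alpha> \<le> 1" and K: "K > 0"
begin

definition \<beta> :: real where "\<beta> = exp (1 - exp (- K)) - 1"

lemma \<beta>: "0 \<le> \<beta>"
  using K by (simp add: \<beta>_def)

abbreviation gc :: metric where "gc \<equiv> \<lambda>x. exp (2 * cfactor K d x) *\<^sub>R g x"

definition gl :: metric where
  "gl x = transpose (dilation1 \<beta> x) ** gc (dilation \<beta> x) ** dilation1 \<beta> x"

sublocale cc: conformal_change g "cfactor K d" "\<lambda>x. cfactor' K d x *\<^sub>R x"
    "\<lambda>x. cfactor' K d x *\<^sub>R mat 1 + cfactor'' K d x *\<^sub>R outer x"
  by (rule cfactor_conformal_change)

lemma C2_gc: "C2_metric gc"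
  by (rule cc.C2_metric_gc)

lemma gl_inner: "v \<bullet> (gl x *v w) = (dilation1 \<beta> x *v v) \<bullet> (gc (dilation \<beta> x) *v (dilation1 \<beta> x *v w))"
  by (simp only: gl_def matrix_vector_mul_assoc[symmetric] inner_transpose)

lemma riemannian_gl: "riemannian gl"
  unfolding riemannian_def
proof (intro ballI conjI allI impI)
  fix x assume x: "x \<in> M"
  have \<Phi>x: "dilation \<beta> x \<in> M" using dilation_M[OF \<beta>] x by blast
  show "transpose (gl x) = gl x"
  proof (subst vec_eq_iff, subst vec_eq_iff, intro allI)
    fix i j
    have "gl x $ j $ i = gl x $ i $ j"
      unfolding matrix_entry_inner gl_inner by (rule C2_metric.inner_g_commute[OF C2_gc \<Phi>x])
    then show "transpose (gl x) $ i $ j = gl x $ i $ j" by (simp add: transpose_def)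
  qed
  fix v :: "real^3" assume "v \<noteq> 0"
  moreover have "matrix_inv (dilation1 \<beta> x) *v (dilation1 \<beta> x *v v) = v"
    by (simp add: matrix_vector_mul_assoc matrix_inv_mult dilation1_invertible[OF \<beta> x])
  ultimately have "dilation1 \<beta> x *v v \<noteq> 0" by auto
  then show "0 < v \<bullet> (gl x *v v)"
    unfolding gl_inner by (rule C2_metric.pos[OF C2_gc \<Phi>x])
qed

lemma near_gl: "near m \<alpha> d (\<lambda>x. gl x $ i $ j) (if i = j then 1 else 0)"
proof -
  have d: "0 \<le> d" "d \<le> 1" using d_pos d_le by auto
  note A = near_dilation1[OF \<alpha> d, of m \<beta>]
  have G: "near m \<alpha> d (\<lambda>x. g (dilation \<beta> x) $ a $ b) (if a = b then 1 else 0)" for a b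
    using dilation_compose_weighted_holder[OF \<alpha> d _ \<beta>, of "\<lambda>x. g x $ a $ b - (if a = b then 1 else 0)" m]
      af unfolding asymptotically_flat_near near_def by blast
  note E = near_cfactor[OF \<alpha> d K \<beta>, of m]
  \<comment> \<open>This identity dictates \<open>\<beta>\<close>: the conformal factor tends to the
    first term, and far out the pullback multiplies the metric by the square of 1 +
    \<open>\<beta>\<close>.\<close>
  have e: "exp (- 2 * (1 - exp (- K))) * (1 + \<beta>)\<^sup>2 = 1"
    by (simp add: \<beta>_def power2_eq_square exp_add[symmetric])
  have gl: "gl x $ i $ j = exp (2 * cfactor K d (dilation \<beta> x)) * (\<Sum>a\<in>UNIV. \<Sum>b\<in>UNIV.
      dilation1 \<beta> x $ b $ i * g (dilation \<beta> x) $ b $ a * dilation1 \<beta> x $ a $ j)" for x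
    by (simp add: gl_def matrix_matrix_mult_def transpose_def sum_distrib_left sum_distrib_right mult_ac)
  have "near m \<alpha> d (\<lambda>x. gl x $ i $ j) (exp (- 2 * (1 - exp (- K))) * (\<Sum>a\<in>UNIV. \<Sum>b\<in>UNIV.
      (if b = i then 1 + \<beta> else 0) * (if b = a then 1 else 0) * (if a = j then 1 + \<beta> else 0)))"
    unfolding gl by (intro near_mult[OF \<alpha> d] near_sum[OF \<alpha> d] A G E)
  moreover have "(\<Sum>a\<in>UNIV. \<Sum>b\<in>UNIV. (if b = i then 1 + \<beta> else 0) * (if b = a then 1 else 0) * (if a = j then 1 + \<beta> else 0))
      = (1 + \<beta>)\<^sup>2 * (if i = j then 1 else 0)"
    using exhaust_3[of i] exhaust_3[of j] by (elim disjE) (simp_all add: sum_3 power2_eq_square)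
  ultimately have "near m \<alpha> d (\<lambda>x. gl x $ i $ j) (exp (- 2 * (1 - exp (- K))) * ((1 + \<beta>)\<^sup>2 * (if i = j then 1 else 0)))"
    by (simp only:)
  then show ?thesis unfolding mult.assoc[symmetric] e by simp
qed

lemma asymptotically_flat_gl: "asymptotically_flat m \<alpha> d gl"
  unfolding asymptotically_flat_near using riemannian_gl near_gl by blast

lemma C2_gl: "C2_metric gl"
  by (rule asymptotically_flat_C2[OF asymptotically_flat_gl m \<alpha>(1)]) (use d_pos in simp)

sublocale im: immersion gc gl "dilation \<beta>" "dilation1 \<beta>" "dilation2 \<beta>" "dilation3 \<beta>"
proof (rule immersion.intro[OF C2_gl C2_gc], unfold_locales)
  show "dilation \<beta> ` M \<subseteq> M" by (rule dilation_M[OF \<beta>])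
  fix x assume x: "x \<in> M"
  show "(dilation \<beta> has_derivative (\<lambda>u. dilation1 \<beta> x *v u)) (at x within M)"
    by (rule dilation_derivative[OF x])
  show "((\<lambda>y. dilation1 \<beta> y *v v) has_derivative (\<lambda>u. dilation2 \<beta> x u v)) (at x within M)" for v
    by (rule dilation1_derivative[OF x])
  show "((\<lambda>y. dilation2 \<beta> y u v) has_derivative (\<lambda>w. dilation3 \<beta> x w u v)) (at x within M)" for u v
    by (rule dilation2_derivative[OF x])
  show "dilation2 \<beta> x u v = dilation2 \<beta> x v u" for u v by (rule dilation2_commute)
  show "dilation3 \<beta> x u v w = dilation3 \<beta> x v u w" for u v w by (rule dilation3_commute)
  show "invertible (dilation1 \<beta> x)" by (rule dilation1_invertible[OF \<beta> x])
qed (rule gl_def)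

lemma scalar_curvature_gl:
  "x \<in> M \<Longrightarrow> scalar_curvature gl x = scalar_curvature gc (dilation \<beta> x)"
  by (rule im.scalar_curvature_gt)

section \<open>The 1-jet of the new metric on the sphere\<close>

context
  fixes x assumes x: "x \<in> S2"
begin

lemma S2_simps:
  "x \<in> M" "rinv x = 1" "dilation \<beta> x = x" "dilation1 \<beta> x = mat 1" "dilation2 \<beta> x u v = 0"
  "cfactor K d x = 0" "cfactor' K d x = - (K * d * exp (- K))"
  using x by (auto simp: S2_def mem_M rinv_def dilation_def dilation1_def dilation2_def
      radial0_def radial1_def radial2_def cfactor_def cfactor'_def)

lemma gl_S2: "gl x = g x"
  by (simp add: gl_def S2_simps)

text \<open>On the sphere the radial map has the identity as derivative and vanishing second
  derivative, so the pullback adds nothing to the first derivative of \<open>gc\<close>; the factor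
  itself is 1 there since \<open>cfactor\<close> vanishes.\<close>

lemma dmet_gl_S2: "dmet gl x u = dmet g x u + (2 * ((cfactor' K d x *\<^sub>R x) \<bullet> u)) *\<^sub>R g x"
proof -
  have "dmet gl x u $ i $ j = dmet gc x u $ i $ j" for i j
    unfolding matrix_entry_inner im.dmet_gt[OF S2_simps(1)] by (simp add: S2_simps)
  then have "dmet gl x u = dmet gc x u" by (simp add: vec_eq_iff)
  then show ?thesis by (simp add: cc.dmet_gc[OF S2_simps(1)] S2_simps)
qed

text \<open>The differential of the factor is \<open>cfactor' K d x *\<^sub>R x\<close>, and x . nu
  is the g-norm of the covector x, which ellipticity bounds below by
  \<open>sqrt (c / L\<^sup>2)\<close>. This makes the drop uniform over the sphere.\<close>

lemma mean_curvature_gl: "mean_curvature gl x \<le> mean_curvature g x - 2 * K * d * exp (- K) * sqrt (c / L\<^sup>2)"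
proof -
  have s: "c / L\<^sup>2 \<le> x \<bullet> (matrix_inv (g x) *v x)"
    using ginv_lower[OF S2_simps(1), of x] x by (simp add: S2_def)
  have "x \<bullet> nu x = sqrt (x \<bullet> (matrix_inv (g x) *v x))"
    using ginv_x_pos[OF S2_simps(1)] by (simp add: nu_def real_div_sqrt)
  then have "sqrt (c / L\<^sup>2) \<le> x \<bullet> nu x" using s by simp
  then have "2 * K * d * exp (- K) * sqrt (c / L\<^sup>2) \<le> 2 * K * d * exp (- K) * (x \<bullet> nu x)"
    using K d_pos by (intro mult_left_mono) auto
  then show ?thesis
    using mean_curvature_conformal_jet[OF C2_gl S2_simps(1) gl_S2 dmet_gl_S2]
    by (simp add: S2_simps(7))
qed

end

end

theorem proposition3p2:
  fixes m :: nat and \<alpha> \<delta> :: real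
    and \<gamma> :: sphere_form and H :: "real^3 \<Rightarrow> real"
  assumes "1/2 < \<delta>" and "\<delta> < 1" and "m \<ge> 3" and "0 < \<alpha>" and "\<alpha> < 1"
    and "(\<gamma>, H) \<in> P_data m \<alpha> \<delta>"
  shows "\<exists>\<mu> :: real^3 \<Rightarrow> real.
           sphere_function (m - 1) \<alpha> \<mu> \<and> (\<forall>p\<in>S2. \<mu> p > 0) \<and>
           (\<forall>H\<^sub>0. sphere_function (m - 1) \<alpha> H\<^sub>0 \<and> (\<forall>p\<in>S2. H\<^sub>0 p \<ge> H p - \<mu> p) \<longrightarrow>
              (\<gamma>, H\<^sub>0) \<in> P_data m \<alpha> \<delta>)"
proof -
  obtain g where g: "asymptotically_flat m \<alpha> \<delta> g" and R: "\<And>x. x \<in> M \<Longrightarrow> scalar_curvature g x \<ge> 0"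
    and ind: "induces g \<gamma>" and mc: "\<And>p. p \<in> S2 \<Longrightarrow> mean_curvature g p \<le> H p" and \<gamma>: "sphere_metric m \<alpha> \<gamma>"
    using assms(6) by (auto simp: P_data_def boundary_data_def admissible_extension_def P_metrics_def)
  have m2: "2 \<le> m" and \<delta>: "0 < \<delta>" "\<delta> \<le> 1" using assms(1-3) by auto
  obtain c L C where "flat_metric g c L C \<delta>"
    by (rule asymptotically_flat_metric[OF g m2 assms(4) \<delta>], rule that)
  then interpret f: flat_metric g c L C \<delta> .
  obtain K where K: "K > 0" and Rc: "\<And>x. x \<in> M \<Longrightarrow> scalar_curvature g x \<ge> 0 \<Longrightarrow>
      scalar_curvature (\<lambda>x. exp (2 * cfactor K \<delta> x) *\<^sub>R g x) x \<ge> 0"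
    by (rule f.ex_conformal_factor, rule that)
  interpret l: lowering g c L C \<delta> m \<alpha> K
    by unfold_locales (use g m2 assms(4,5) K in auto)
  define \<mu> where "\<mu> = 2 * K * \<delta> * exp (- K) * sqrt (c / L\<^sup>2)"
  have \<mu>: "\<mu> > 0" using K \<delta> f.c_pos f.L_pos by (simp add: \<mu>_def)
  \<comment> \<open>At x the scalar curvature of the new metric is that of the conformal metric at
    the dilated point, which again lies in \<open>M\<close>.\<close>
  have "l.gl \<in> P_metrics m \<alpha> \<delta>"
    unfolding P_metrics_def
    using l.asymptotically_flat_gl Rc R dilation_M[OF l.\<beta>] by (auto simp: l.scalar_curvature_gl)
  moreover have "induces l.gl \<gamma>"
    using ind by (simp add: induces_def l.gl_S2)
  moreover have "mean_curvature l.gl p \<le> H\<^sub>0 p" if "p \<in> S2" "H\<^sub>0 p \<ge> H p - \<mu>" for p and H\<^sub>0 :: "real^3 \<Rightarrow> real"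
    using l.mean_curvature_gl[OF that(1)] mc[OF that(1)] that(2) by (simp add: \<mu>_def)
  ultimately have "(\<gamma>, H\<^sub>0) \<in> P_data m \<alpha> \<delta>"
    if "sphere_function (m - 1) \<alpha> H\<^sub>0" "\<forall>p\<in>S2. H\<^sub>0 p \<ge> H p - \<mu>" for H\<^sub>0
    using that \<gamma> unfolding P_data_def boundary_data_def admissible_extension_def by blast
  then show ?thesis
    using \<mu> sphere_function_const by (intro exI[of _ "\<lambda>_. \<mu>"]) blast
qed

end
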